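(* Let $p$ be a prime and let $A>1$ be an odd integer. Consider the Diophantine equation $$y^2=px(Ax^2+2)\qquad(\ast)$$ in positive integers $(x,y)$. (1) If $p=2$, then $(\ast)$ has at most one positive integer solution $(x,y)$. (2) Suppose that $p$ is odd and that $p\mid A$ or $\left(\frac{-2A}{p}\right)=-1$. (a) If $(A,p)\equiv (7,1)$ or $(7,7)\pmod 8$, then $(\ast)$ has at most three positive integer solutions $(x,y)$. (b) Otherwise, $(\ast)$ has at most one positive integer solution $(x,y)$. (3) Suppose that $p$ is odd and that $\left(\frac{-2A}{p}\right)=1$. (a) If $(A,p)\equiv (1,5),(1,7),(3,3),(5,5),(7,3)$, or $(7,5)\pmod 8$, then $(\ast)$ has at most one positive integer solution $(x,y)$. (b) If $(A,p)\equiv (1,1),(3,1),(3,7),(5,1),(5,3)$, or $(5,7)\pmod 8$, then $(\ast)$ has at most two positive integer solutions $(x,y)$. (c) If $(A,p)\equiv (1,3)$ or $(3,5)\pmod 8$, then $(\ast)$ has at most three positive integer solutions $(x,y)$. (d) If $(A,p)\equiv (7,7)\pmod 8$, then $(\ast)$ has at most four positive integer solutions $(x,y)$. (e) If $(A,p)\equiv (7,1)\pmod 8$, then $(\ast)$ has at most six positive integer solutions $(x,y)$.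
   Context: $\left(\frac{\cdot}{p}\right)$ denotes the Legendre symbol modulo the odd prime $p$. The notation $(A,p)\equiv(r,s)\pmod 8$ means $A\equiv r\pmod 8$ and $p\equiv s\pmod 8$. A positive integer solution is a pair $(x,y)$ of integers with $x,y\geq 1$ satisfying the equation. *)

theory Defs
  imports "HOL-Number_Theory.Number_Theory"
begin

definition pos_solutions :: "int \<Rightarrow> int \<Rightarrow> (int \<times> int) set" where
  "pos_solutions p A = {(x, y). 1 \<le> x \<and> 1 \<le> y \<and> y\<^sup>2 = p * x * (A * x\<^sup>2 + 2)}"

text \<open>Finiteness is demanded explicitly because the cardinality of an infinite set is 0 in HOL.\<close>

definition at_most :: "nat \<Rightarrow> 'a set \<Rightarrow> bool" where
  "at_most n S \<longleftrightarrow> finite S \<and> card S \<le> n"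

definition cong8 :: "int \<Rightarrow> int \<Rightarrow> int \<times> int \<Rightarrow> bool" where
  "cong8 A p rs \<longleftrightarrow> [A = fst rs] (mod 8) \<and> [p = snd rs] (mod 8)"

end

theory Submission
  imports "HOL-Analysis.FPS_Convergence" "HOL-Computational_Algebra.Nth_Powers" Defs
begin

text \<open>
  Since \<open>p\<close> divides \<open>y\<close> and \<open>gcd x (A * x\<^sup>2 + 2)\<close> divides 2, a solution yields an integer point on one of at most
  four quartic equations \<open>C * a\<^sup>2 - B * u ^ 4 = c\<close> with \<open>c \<in> {1, 2}\<close>, most of which are excluded by congruences modulo 8
  and by the Legendre symbol.

  Such a point gives a unit \<open>\<alpha> = (a * \<surd>C + u\<^sup>2 * \<surd>B) / \<surd>c\<close> of norm 1, a power of a fundamental unit, and the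
  relative unit \<open>E = \<alpha> + u * \<surd>(2 * \<surd>(B / c) * \<alpha>)\<close> of norm 1 over the lattice containing \<open>\<alpha>\<close>.
  If the exponents of two points are congruent modulo 4, both relative units lie in one
  discrete group, as all conjugates have absolute value 1; so they are powers of one \<open>\<eta>\<close>. With
  \<open>x = (\<eta> + 1 / \<eta>) / 2\<close> the units \<open>\<alpha>\<close> are Chebyshev values \<open>T\<^sub>k x\<close>, \<open>T\<^sub>l x\<close> for (without loss of generality) coprime
  \<open>k\<close>, \<open>l\<close>. Then \<open>x\<close> is a unit too, and a 2-adic expansion around \<open>x\<^sup>2 = 1\<close> shows that \<open>T\<^sub>n x\<close> is not a unit for \<open>n \<ge> 2\<close>.
  Hence there is at most one point for every class of exponents modulo 4; in most cases a congruence for Lucas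
  sequences leaves only one class.

  For \<open>C = c = 1\<close> both parities of the exponent can occur, and excluding a coexistence comes down to
  Ljunggren's equation \<open>g\<^sup>2 + 1 = 2 * f ^ 4\<close>, which is solved by Pade approximation of the fourth root of
  \<open>(239 - \<i>) / (239 + \<i>)\<close>: the known solution \<open>239\<^sup>2 + 1 = 2 * 13 ^ 4\<close> makes a further large solution too good an approximation.
\<close>

section \<open>Discrete groups and Chebyshev polynomials\<close>

text \<open>Products of elements of the lattice containing \<alpha> fall into
  \<open>\<int>[\<surd>(B * C)]\<close>; a Boolean grade tells the two apart, and exponents are
  compared modulo 4 because the quotient of two units has to be the square of a unit of grade
  \<open>False\<close>. Conjugation is a relation between reals, as \<open>B * C\<close> is known to
  be no square only once a solution is at hand.

  What makes the 2-adic step elementary: when \<open>x\<close> is a unit, \<open>x\<^sup>2\<close>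
  has norm 1 and even trace, so \<open>x\<^sup>2 - 1\<close> and its conjugate are the roots of
  \<open>t\<^sup>2 = D * t + D\<close> with \<open>D\<close> even. The parity of the constant
  coefficient then replaces the arithmetic of the primes above 2.

  The counts in the theorem are sums over the families that survive the congruences. A family with
  \<open>c = 2\<close> counts twice when \<open>B\<close> is 3 modulo 4, as there the Lucas sequence
  no longer separates the classes of exponents. The Pade estimate excludes only large solutions of
  Ljunggren's equation; the gap below \<open>10 ^ 31\<close> is closed along the solutions of a Pell
  equation.\<close>

text \<open>The least element \<open>g\<close> above 1 generates: dividing \<open>z\<close> by the
  largest power of \<open>g\<close> not exceeding it leaves a member of \<open>S\<close> in
  \<open>[1, g)\<close>, which must be 1.\<close>

lemma discrete_subgroup_cyclic:
  fixes S :: "real set"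
  assumes pos: "\<And>z. z \<in> S \<Longrightarrow> z > 0"
    and div: "\<And>z w. z \<in> S \<Longrightarrow> w \<in> S \<Longrightarrow> z / w \<in> S"
    and fin: "\<And>K. finite (S \<inter> {1..K})"
    and ex: "z0 \<in> S" "z0 > 1"
  obtains g where "g \<in> S" "g > 1" "\<And>z. z \<in> S \<Longrightarrow> z > 1 \<Longrightarrow> \<exists>n\<ge>1. z = g ^ n"
proof -
  define F where "F = S \<inter> {1<..z0}"
  have finF: "finite F"
    by (rule finite_subset[OF _ fin[of z0]]) (auto simp: F_def)
  have neF: "F \<noteq> {}" using ex by (auto simp: F_def)
  define g where "g = Min F"
  have gF: "g \<in> F" unfolding g_def using finF neF by (rule Min_in)
  have g: "g \<in> S" "g > 1" "g \<le> z0" using gF by (auto simp: F_def)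
  have g_least: "g \<le> w" if "w \<in> S" "w > 1" for w
    using Min_le[OF finF, of w] that g unfolding g_def F_def by fastforce
  have one: "1 \<in> S" using div[OF g(1) g(1)] g by simp
  have inv: "1 / g \<in> S" using div[OF one g(1)] .
  have pow: "g ^ n \<in> S" for n
  proof (induction n)
    case (Suc n)
    have "g ^ n / (1 / g) \<in> S" by (rule div[OF Suc inv])
    then show ?case by (simp add: mult.commute)
  qed (simp add: one)
  have "\<exists>n\<ge>1. z = g ^ n" if z: "z \<in> S" "z > 1" for z
  proof -
    obtain m where m: "z < g ^ m" using real_arch_pow[OF g(2)] by blast
    define n where "n = (LEAST m. z < g ^ m)"
    have n1: "z < g ^ n" unfolding n_def by (rule LeastI[of "\<lambda>m. z < g ^ m", OF m])
    have n0: "n \<noteq> 0" using n1 z by (intro notI) simp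
    have n2: "g ^ (n - 1) \<le> z"
    proof -
      have "\<not> z < g ^ (n - 1)" unfolding n_def
        by (rule not_less_Least) (use n0 in \<open>simp add: n_def\<close>)
      then show ?thesis by simp
    qed
    have gp: "g ^ (n - 1) > 0" using g by simp
    have q: "z / g ^ (n - 1) \<in> S" using z pow by (intro div)
    have "g ^ n = g * g ^ (n - 1)" using n0 by (cases n) auto
    with n1 gp have lt: "z / g ^ (n - 1) < g" by (simp add: field_simps)
    have "z / g ^ (n - 1) = 1"
    proof (rule ccontr)
      assume "z / g ^ (n - 1) \<noteq> 1"
      moreover have "z / g ^ (n - 1) \<ge> 1" using n2 gp by simp
      ultimately have "z / g ^ (n - 1) > 1" by linarith
      from g_least[OF q this] lt show False by simp
    qed
    then have "z = g ^ (n - 1)" using gp by simp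
    moreover have "n - 1 \<ge> 1" using calculation z by (cases "n - 1") auto
    ultimately show ?thesis by blast
  qed
  then show thesis using that g by blast
qed

section \<open>Chebyshev polynomials as coordinates of powers\<close>

text \<open>The pair holds the coordinates of \<open>(x + \<surd>(x\<^sup>2 - 1)) ^ n\<close>: the
  Chebyshev polynomial of the first kind of degree \<open>n\<close> and that of the second kind with
  index \<open>n - 1\<close>. In this form it makes sense over every commutative ring.\<close>

fun cheb :: "nat \<Rightarrow> 'a::comm_ring_1 \<Rightarrow> 'a \<times> 'a" where
  "cheb 0 x = (1, 0)"
| "cheb (Suc n) x = (x * fst (cheb n x) + (x\<^sup>2 - 1) * snd (cheb n x), x * snd (cheb n x) + fst (cheb n x))"

abbreviation chebT :: "nat \<Rightarrow> 'a::comm_ring_1 \<Rightarrow> 'a" where "chebT n x \<equiv> fst (cheb n x)"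
abbreviation chebU :: "nat \<Rightarrow> 'a::comm_ring_1 \<Rightarrow> 'a" where "chebU n x \<equiv> snd (cheb n x)"

lemma cheb_add:
  "chebT (m + n) x = chebT m x * chebT n x + (x\<^sup>2 - 1) * (chebU m x * chebU n x) \<and>
   chebU (m + n) x = chebT m x * chebU n x + chebU m x * chebT n x"
proof (induction m)
  case (Suc m)
  then have T: "chebT (m + n) x = chebT m x * chebT n x + (x\<^sup>2 - 1) * (chebU m x * chebU n x)"
    and U: "chebU (m + n) x = chebT m x * chebU n x + chebU m x * chebT n x" by blast+
  have "chebT (Suc (m + n)) x = x * chebT (m + n) x + (x\<^sup>2 - 1) * chebU (m + n) x"
    "chebU (Suc (m + n)) x = x * chebU (m + n) x + chebT (m + n) x" by simp_all
  then show ?case unfolding T U by (simp add: algebra_simps)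
qed simp

lemma cheb_pell: "(chebT n x)\<^sup>2 - (x\<^sup>2 - 1) * (chebU n x)\<^sup>2 = 1"
proof (induction n)
  case (Suc n)
  have "(chebT (Suc n) x)\<^sup>2 - (x\<^sup>2 - 1) * (chebU (Suc n) x)\<^sup>2
      = (x\<^sup>2 - (x\<^sup>2 - 1)) * ((chebT n x)\<^sup>2 - (x\<^sup>2 - 1) * (chebU n x)\<^sup>2)"
    by (simp add: algebra_simps power2_eq_square)
  with Suc show ?case by simp
qed simp

lemma chebT_double: "chebT (2 * n) x = 1 + 2 * ((x\<^sup>2 - 1) * (chebU n x)\<^sup>2)"
proof -
  have "chebT (n + n) x = (chebT n x)\<^sup>2 + (x\<^sup>2 - 1) * (chebU n x)\<^sup>2"
    using cheb_add[of n n x] by (simp only: power2_eq_square)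
  moreover have "(chebT n x)\<^sup>2 = 1 + (x\<^sup>2 - 1) * (chebU n x)\<^sup>2"
    using cheb_pell[of n x] by (simp only: diff_eq_eq)
  ultimately show ?thesis by (simp only: mult_2 add.assoc)
qed

lemma chebU_double: "chebU (2 * n) x = 2 * (chebT n x * chebU n x)"
proof -
  have "chebU (n + n) x = chebT n x * chebU n x + chebT n x * chebU n x"
    using cheb_add[of n n x] by (simp only: mult.commute)
  then show ?thesis by (simp only: mult_2)
qed

text \<open>The term \<open>b\<close> occurs twice: once in the addition formula for
  \<open>n + Suc n\<close>, and once because the Pell relation turns
  \<open>chebT n x * chebT (Suc n) x\<close> into \<open>x + b\<close>. Together with
  \<open>chebT_double\<close> this starts the expansion around \<open>x\<^sup>2 = 1\<close>.\<close>

lemma chebT_odd: "chebT (2 * n + 1) x = x + 2 * ((x\<^sup>2 - 1) * (chebU n x * chebU (Suc n) x))"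
proof -
  define b where "b = (x\<^sup>2 - 1) * (chebU n x * chebU (Suc n) x)"
  have "chebT n x * chebT (Suc n) x - b = x * ((chebT n x)\<^sup>2 - (x\<^sup>2 - 1) * (chebU n x)\<^sup>2)"
    by (simp add: b_def algebra_simps power2_eq_square)
  then have "chebT n x * chebT (Suc n) x = x + b" by (simp only: cheb_pell mult_1_right diff_eq_eq)
  then have "chebT (n + Suc n) x = x + b + b" using cheb_add[of n "Suc n" x] by (simp only: b_def)
  moreover have "n + Suc n = 2 * n + 1" by simp
  ultimately have "chebT (2 * n + 1) x = x + b + b" by (simp only:)
  then show ?thesis by (simp only: b_def mult_2 add.assoc)
qed

lemma cheb_power:
  fixes u v k :: "'a::comm_ring_1"
  assumes "u\<^sup>2 - k\<^sup>2 * v\<^sup>2 = 1"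
  shows "(u + v * k) ^ n = chebT n u + chebU n u * v * k"
proof (induction n)
  case (Suc n)
  have k: "k\<^sup>2 * v\<^sup>2 = u\<^sup>2 - 1" using assms by (simp add: algebra_simps)
  have "(u + v * k) ^ Suc n = (u + v * k) * (chebT n u + chebU n u * v * k)" using Suc by simp
  also have "\<dots> = u * chebT n u + (k\<^sup>2 * v\<^sup>2) * chebU n u + (u * chebU n u + chebT n u) * v * k"
    by (simp add: algebra_simps power2_eq_square)
  finally show ?case by (simp add: k)
qed simp

text \<open>\<open>chebT n\<close> is an even or odd polynomial and \<open>chebU n\<close> has the
  opposite parity; \<open>w\<close> and \<open>v\<close> are the cofactors, polynomials in
  \<open>x\<^sup>2\<close>. At \<open>x\<^sup>2 = 1\<close> they take the values 1 and
  \<open>n\<close>, which the Boolean of \<open>R\<close> tracks modulo 2. The relation is abstract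
  because two rings of pairs are served, those of \<open>zpair\<close> and of
  \<open>conj_pair False\<close>.\<close>

lemma cheb_parity:
  fixes R :: "bool \<Rightarrow> 'a::comm_ring_1 \<Rightarrow> 'a \<Rightarrow> bool"
  assumes add: "\<And>a b z z' w w'. R a z z' \<Longrightarrow> R b w w' \<Longrightarrow> R (a \<noteq> b) (z + w) (z' + w')"
    and mult: "\<And>a b z z' w w'. R a z z' \<Longrightarrow> R b w w' \<Longrightarrow> R (a \<and> b) (z * w) (z' * w')"
    and base: "R True 1 1" "R False 0 0" "R True (x\<^sup>2) (x'\<^sup>2)" "R False (x\<^sup>2 - 1) (x'\<^sup>2 - 1)"
  shows "\<exists>w w' v v'. R True w w' \<and> R (odd n) v v' \<and>
    chebT n x = (if odd n then x else 1) * w \<and> chebT n x' = (if odd n then x' else 1) * w' \<and>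
    chebU n x = (if odd n then 1 else x) * v \<and> chebU n x' = (if odd n then 1 else x') * v'"
proof (induction n)
  case 0
  have "R True 1 1 \<and> R (odd (0::nat)) 0 0 \<and> chebT 0 x = (if odd (0::nat) then x else 1) * 1 \<and>
    chebT 0 x' = (if odd (0::nat) then x' else 1) * 1 \<and> chebU 0 x = (if odd (0::nat) then 1 else x) * 0 \<and>
    chebU 0 x' = (if odd (0::nat) then 1 else x') * 0"
    using base by simp
  then show ?case by blast
next
  case (Suc n)
  then obtain w w' v v' where w: "R True w w'" and v: "R (odd n) v v'"
    and T: "chebT n x = (if odd n then x else 1) * w" "chebT n x' = (if odd n then x' else 1) * w'"
    and U: "chebU n x = (if odd n then 1 else x) * v" "chebU n x' = (if odd n then 1 else x') * v'"
    by blast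
  have Zv: "R False ((x\<^sup>2 - 1) * v) ((x'\<^sup>2 - 1) * v')" using mult[OF base(4) v] by simp
  show ?case
  proof (cases "odd n")
    case True
    have "R True (x\<^sup>2 * w + (x\<^sup>2 - 1) * v) (x'\<^sup>2 * w' + (x'\<^sup>2 - 1) * v')" "R (odd (Suc n)) (v + w) (v' + w')"
      using add[OF mult[OF base(3) w] Zv] add[OF v w] True by simp_all
    moreover have "chebT (Suc n) x = (if odd (Suc n) then x else 1) * (x\<^sup>2 * w + (x\<^sup>2 - 1) * v)"
      "chebT (Suc n) x' = (if odd (Suc n) then x' else 1) * (x'\<^sup>2 * w' + (x'\<^sup>2 - 1) * v')"
      "chebU (Suc n) x = (if odd (Suc n) then 1 else x) * (v + w)"
      "chebU (Suc n) x' = (if odd (Suc n) then 1 else x') * (v' + w')"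
      using True T U by (simp_all add: algebra_simps power2_eq_square)
    ultimately show ?thesis by blast
  next
    case False
    have "R True (w + (x\<^sup>2 - 1) * v) (w' + (x'\<^sup>2 - 1) * v')" "R (odd (Suc n)) (x\<^sup>2 * v + w) (x'\<^sup>2 * v' + w')"
      using add[OF w Zv] add[OF mult[OF base(3) v] w] False by simp_all
    moreover have "chebT (Suc n) x = (if odd (Suc n) then x else 1) * (w + (x\<^sup>2 - 1) * v)"
      "chebT (Suc n) x' = (if odd (Suc n) then x' else 1) * (w' + (x'\<^sup>2 - 1) * v')"
      "chebU (Suc n) x = (if odd (Suc n) then 1 else x) * (x\<^sup>2 * v + w)"
      "chebU (Suc n) x' = (if odd (Suc n) then 1 else x') * (x'\<^sup>2 * v' + w')"
      using False T U by (simp_all add: algebra_simps power2_eq_square)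
    ultimately show ?thesis by blast
  qed
qed

text \<open>The pairs \<open>(m + n * Z, m + n * Z')\<close> with integers \<open>m\<close>, \<open>n\<close> form a ring whenever \<open>Z\<close>, \<open>Z'\<close> are the
  roots of \<open>t\<^sup>2 = D * t + D\<close>; if \<open>D\<close> is even, then the parity of \<open>m\<close> is a ring homomorphism.\<close>

definition zpair :: "real \<Rightarrow> real \<Rightarrow> bool \<Rightarrow> real \<Rightarrow> real \<Rightarrow> bool" where
  "zpair Z Z' b w w' \<longleftrightarrow> (\<exists>m n :: int. odd m = b \<and> w = of_int m + of_int n * Z \<and> w' = of_int m + of_int n * Z')"

section \<open>2-adic expansion of Chebyshev values\<close>

text \<open>Meant for \<open>Z = x\<^sup>2 - 1\<close> and \<open>Z' = x'\<^sup>2 - 1\<close> with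
  \<open>x\<^sup>2 * x'\<^sup>2 = 1\<close>. Then \<open>(1 + Z) * (1 + Z') = 1\<close>, so the
  product of \<open>Z\<close> and \<open>Z'\<close> is minus their sum.\<close>

locale even_trace =
  fixes D :: int and Z Z' :: real
  assumes evenD: "even D" and sum: "Z + Z' = of_int D" and prod: "Z * Z' = - of_int D"
begin

lemma sq: "Z\<^sup>2 = D * Z + D" "Z'\<^sup>2 = D * Z' + D"
proof -
  have "Z * (Z + Z') = D * Z" "Z' * (Z + Z') = D * Z'" using sum by simp_all
  then show "Z\<^sup>2 = D * Z + D" "Z'\<^sup>2 = D * Z' + D" using prod by (simp_all add: algebra_simps power2_eq_square)
qed

lemma zpair_add: "zpair Z Z' a w w' \<Longrightarrow> zpair Z Z' b v v' \<Longrightarrow> zpair Z Z' (a \<noteq> b) (w + v) (w' + v')"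
  unfolding zpair_def
proof (elim exE conjE)
  fix m n k l :: int
  assume "odd m = a" "w = m + n * Z" "w' = m + n * Z'" "odd k = b" "v = k + l * Z" "v' = k + l * Z'"
  then show "\<exists>m n. odd m = (a \<noteq> b) \<and> w + v = real_of_int m + real_of_int n * Z \<and> w' + v' = real_of_int m + real_of_int n * Z'"
    by (intro exI[of _ "m + k"] exI[of _ "n + l"]) (auto simp: algebra_simps)
qed

lemma zpair_mult: "zpair Z Z' a w w' \<Longrightarrow> zpair Z Z' b v v' \<Longrightarrow> zpair Z Z' (a \<and> b) (w * v) (w' * v')"
  unfolding zpair_def
proof (elim exE conjE)
  fix m n k l :: int
  assume h: "odd m = a" "w = m + n * Z" "w' = m + n * Z'" "odd k = b" "v = k + l * Z" "v' = k + l * Z'"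
  \<comment> \<open>Reducing \<open>z\<^sup>2\<close> changes the constant coefficient
    \<open>m * k\<close> only by a multiple of the even number \<open>D\<close>, so parities
    multiply.\<close>
  have e: "(m + n * z) * (k + l * z) = real_of_int (m * k + n * l * D) + real_of_int (m * l + n * k + n * l * D) * z"
    if "z\<^sup>2 = D * z + D" for z :: real
  proof -
    have "(m + n * z) * (k + l * z) = m * k + (m * l + n * k) * z + n * l * z\<^sup>2"
      by (simp add: algebra_simps power2_eq_square)
    also have "\<dots> = m * k + (m * l + n * k) * z + n * l * (D * z + D)" by (simp only: that)
    finally show ?thesis by (simp add: algebra_simps)
  qed
  show "\<exists>m n. odd m = (a \<and> b) \<and> w * v = real_of_int m + real_of_int n * Z \<and> w' * v' = real_of_int m + real_of_int n * Z'"
    using h e[OF sq(1)] e[OF sq(2)] evenD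
    by (intro exI[of _ "m * k + n * l * D"] exI[of _ "m * l + n * k + n * l * D"]) auto
qed

lemma zpair_Z: "zpair Z Z' False Z Z'"
  unfolding zpair_def by (intro exI[of _ 0] exI[of _ 1]) auto

lemma zpair_one: "zpair Z Z' True 1 1"
  unfolding zpair_def by (intro exI[of _ 1] exI[of _ 0]) auto

lemma zpair_zero: "zpair Z Z' False 0 0"
  unfolding zpair_def by (intro exI[of _ 0] exI[of _ 0]) auto

lemma cheb_zpair:
  assumes x: "x\<^sup>2 = 1 + Z" "x'\<^sup>2 = 1 + Z'"
  shows "\<exists>w w' v v'. zpair Z Z' True w w' \<and> zpair Z Z' (odd n) v v' \<and>
    chebT n x = (if odd n then x else 1) * w \<and> chebT n x' = (if odd n then x' else 1) * w' \<and>
    chebU n x = (if odd n then 1 else x) * v \<and> chebU n x' = (if odd n then 1 else x') * v'"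
proof (rule cheb_parity)
  show "zpair Z Z' True (x\<^sup>2) (x'\<^sup>2)" "zpair Z Z' False (x\<^sup>2 - 1) (x'\<^sup>2 - 1)"
    using zpair_add[OF zpair_one zpair_Z] zpair_Z unfolding x by simp_all
qed (use zpair_add zpair_mult zpair_one zpair_zero in blast)+

text \<open>As long as \<open>n\<close> is even, \<open>chebU_double\<close> pulls out a factor 2
  and an odd cofactor from \<open>chebT k\<close>; an odd index leaves an odd \<open>v\<close>. For
  even \<open>n\<close> exactly one of \<open>chebT k x\<close> and \<open>chebU k x\<close>
  supplies the factor \<open>x\<close>.\<close>

lemma chebU_zpair:
  assumes x: "x\<^sup>2 = 1 + Z" "x'\<^sup>2 = 1 + Z'" and "n > 0"
  shows "\<exists>e v v'. zpair Z Z' True v v' \<and>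
    chebU n x = 2 ^ e * (if odd n then 1 else x) * v \<and> chebU n x' = 2 ^ e * (if odd n then 1 else x') * v'"
  using \<open>n > 0\<close>
proof (induction n rule: less_induct)
  case (less n)
  show ?case
  proof (cases "odd n")
    case True
    from cheb_zpair[OF x, of n] obtain v v' where "zpair Z Z' (odd n) v v'"
      "chebU n x = (if odd n then 1 else x) * v" "chebU n x' = (if odd n then 1 else x') * v'" by blast
    with True have "zpair Z Z' True v v' \<and> chebU n x = 2 ^ 0 * (if odd n then 1 else x) * v \<and>
      chebU n x' = 2 ^ 0 * (if odd n then 1 else x') * v'" by simp
    then show ?thesis by blast
  next
    case False
    then obtain k where k: "n = 2 * k" by auto
    with less.prems have k0: "k < n" "k > 0" by auto
    from less.IH[OF this] obtain e v v' where v: "zpair Z Z' True v v'"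
      and U: "chebU k x = 2 ^ e * (if odd k then 1 else x) * v" "chebU k x' = 2 ^ e * (if odd k then 1 else x') * v'"
      by blast
    from cheb_zpair[OF x, of k] obtain w w' where w: "zpair Z Z' True w w'"
      and T: "chebT k x = (if odd k then x else 1) * w" "chebT k x' = (if odd k then x' else 1) * w'"
      by blast
    have "zpair Z Z' True (w * v) (w' * v')" using zpair_mult[OF w v] by simp
    moreover have "chebU n x = 2 ^ Suc e * x * (w * v)" "chebU n x' = 2 ^ Suc e * x' * (w' * v')"
      unfolding k chebU_double T U by simp_all
    ultimately have "zpair Z Z' True (w * v) (w' * v') \<and> chebU n x = 2 ^ Suc e * (if odd n then 1 else x) * (w * v) \<and>
      chebU n x' = 2 ^ Suc e * (if odd n then 1 else x') * (w' * v')"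
      using False by (simp del: power_Suc)
    then show ?thesis by blast
  qed
qed

text \<open>In \<open>chebT_odd\<close> the indices \<open>k\<close> and \<open>Suc k\<close> differ
  in parity, so exactly one of the two values of \<open>chebU\<close> supplies a factor
  \<open>x\<close>. In \<open>chebT_double\<close> the square supplies 1 or
  \<open>x\<^sup>2 = 1 + Z\<close>, whose constant coefficient is odd. The factor 2 in both
  identities makes \<open>e\<close> positive.\<close>

lemma chebT_expansion:
  assumes x: "x\<^sup>2 = 1 + Z" "x'\<^sup>2 = 1 + Z'" and n: "n \<ge> 2"
  shows "\<exists>e w w'. e > 0 \<and> zpair Z Z' True w w' \<and>
    chebT n x = (if odd n then x else 1) * (1 + 2 ^ e * Z * w) \<and>
    chebT n x' = (if odd n then x' else 1) * (1 + 2 ^ e * Z' * w')"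
proof (cases "odd n")
  case True
  then obtain k where k: "n = 2 * k + 1" by (elim oddE)
  with n have k0: "k > 0" by auto
  obtain e v v' where v: "zpair Z Z' True v v'"
    and U: "chebU k x = 2 ^ e * (if odd k then 1 else x) * v" "chebU k x' = 2 ^ e * (if odd k then 1 else x') * v'"
    using chebU_zpair[OF x k0] by blast
  obtain f u u' where u: "zpair Z Z' True u u'"
    and U': "chebU (Suc k) x = 2 ^ f * (if odd (Suc k) then 1 else x) * u"
       "chebU (Suc k) x' = 2 ^ f * (if odd (Suc k) then 1 else x') * u'"
    using chebU_zpair[OF x zero_less_Suc[of k]] by blast
  have "zpair Z Z' True (v * u) (v' * u')" using zpair_mult[OF v u] by simp
  moreover have "x\<^sup>2 - 1 = Z" "x'\<^sup>2 - 1 = Z'" using x by auto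
  ultimately have "chebT n x = x * (1 + 2 ^ Suc (e + f) * Z * (v * u))"
    "chebT n x' = x' * (1 + 2 ^ Suc (e + f) * Z' * (v' * u'))"
    unfolding k chebT_odd U U' by (simp_all add: algebra_simps power_add)
  with \<open>zpair Z Z' True (v * u) (v' * u')\<close> True
  have "Suc (e + f) > 0 \<and> zpair Z Z' True (v * u) (v' * u') \<and>
    chebT n x = (if odd n then x else 1) * (1 + 2 ^ Suc (e + f) * Z * (v * u)) \<and>
    chebT n x' = (if odd n then x' else 1) * (1 + 2 ^ Suc (e + f) * Z' * (v' * u'))"
    by (simp del: power_Suc)
  then show ?thesis by blast
next
  case False
  then obtain k where k: "n = 2 * k" by auto
  with n have k0: "k > 0" by auto
  obtain e v v' where v: "zpair Z Z' True v v'"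
    and U: "chebU k x = 2 ^ e * (if odd k then 1 else x) * v" "chebU k x' = 2 ^ e * (if odd k then 1 else x') * v'"
    using chebU_zpair[OF x k0] by blast
  have X: "zpair Z Z' True (1 + Z) (1 + Z')" using zpair_add[OF zpair_one zpair_Z] by simp
  have vv: "zpair Z Z' True (v * v) (v' * v')" using zpair_mult[OF v v] by simp
  define u where "u = (if odd k then 1 else 1 + Z) * (v * v)"
  define u' where "u' = (if odd k then 1 else 1 + Z') * (v' * v')"
  have u: "zpair Z Z' True u u'"
    using vv zpair_mult[OF X vv] by (simp add: u_def u'_def)
  have "(c * d * r)\<^sup>2 = c\<^sup>2 * (d\<^sup>2 * (r * r))" for c d r :: real
    by (simp add: power2_eq_square)
  moreover have "(2 ^ e)\<^sup>2 = (2 ^ (2 * e) :: real)" by (simp add: power_mult[symmetric] mult.commute)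
  moreover have "(if odd k then 1 else x)\<^sup>2 = (if odd k then 1 else 1 + Z)"
    "(if odd k then 1 else x')\<^sup>2 = (if odd k then 1 else 1 + Z')" using x by auto
  ultimately have sq: "(chebU k x)\<^sup>2 = 2 ^ (2 * e) * u" "(chebU k x')\<^sup>2 = 2 ^ (2 * e) * u'"
    unfolding U u_def u'_def by (simp_all only: mult.assoc)
  have "x\<^sup>2 - 1 = Z" "x'\<^sup>2 - 1 = Z'" using x by auto
  then have "chebT n x = 1 + 2 ^ Suc (2 * e) * Z * u" "chebT n x' = 1 + 2 ^ Suc (2 * e) * Z' * u'"
    unfolding k chebT_double sq by simp_all
  with u False have "Suc (2 * e) > 0 \<and> zpair Z Z' True u u' \<and>
    chebT n x = (if odd n then x else 1) * (1 + 2 ^ Suc (2 * e) * Z * u) \<and>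
    chebT n x' = (if odd n then x' else 1) * (1 + 2 ^ Suc (2 * e) * Z' * u')"
    by (simp del: power_Suc)
  then show ?thesis by blast
qed

text \<open>\<open>2 ^ e * D\<close> divides the product below minus 1 exactly, up to an odd factor.\<close>

lemma expansion_product_neq:
  assumes "D \<noteq> 0" "e > 0" "zpair Z Z' True w w'"
  shows "((1 + 2 ^ e * Z * w) * (1 + 2 ^ e * Z' * w'))\<^sup>2 \<noteq> 1"
proof
  assume eq: "((1 + 2 ^ e * Z * w) * (1 + 2 ^ e * Z' * w'))\<^sup>2 = 1"
  from assms(3) obtain m n :: int where m: "odd m" and w: "w = m + n * Z" "w' = m + n * Z'"
    unfolding zpair_def by auto
  \<comment> \<open>This is the trace plus the norm of \<open>2 ^ e * Z * w\<close>. The bracket is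
    odd, since \<open>m\<close> is odd while \<open>D\<close> and \<open>2 ^ e\<close> are
    even.\<close>
  define t where "t = 2 ^ e * D * (m + n * (D + 2) - 2 ^ e * (m\<^sup>2 + m * n * D - n\<^sup>2 * D))"
  have zz: "Z\<^sup>2 + Z'\<^sup>2 = D\<^sup>2 + 2 * D"
  proof -
    have "Z\<^sup>2 + Z'\<^sup>2 = (Z + Z')\<^sup>2 - 2 * (Z * Z')" by (simp add: algebra_simps power2_eq_square)
    then show ?thesis by (simp add: sum prod)
  qed
  have lin: "Z * w + Z' * w' = D * (m + n * (D + 2))"
  proof -
    have "Z * w + Z' * w' = m * (Z + Z') + n * (Z\<^sup>2 + Z'\<^sup>2)"
      by (simp add: w algebra_simps power2_eq_square)
    also have "\<dots> = m * D + n * (D\<^sup>2 + 2 * D)" by (simp only: zz sum of_int_add of_int_mult)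
    finally show ?thesis by (simp add: algebra_simps power2_eq_square)
  qed
  have ww: "w * w' = m\<^sup>2 + m * n * D - n\<^sup>2 * D"
  proof -
    have "w * w' = m\<^sup>2 + m * n * (Z + Z') + n\<^sup>2 * (Z * Z')"
      by (simp add: w algebra_simps power2_eq_square)
    then show ?thesis by (simp add: sum prod)
  qed
  have "(1 + 2 ^ e * Z * w) * (1 + 2 ^ e * Z' * w') = 1 + 2 ^ e * (Z * w + Z' * w') + 2 ^ e * 2 ^ e * (Z * Z') * (w * w')"
    by (simp add: algebra_simps)
  also have "\<dots> = real_of_int (1 + t)"
    unfolding lin ww prod t_def by (simp add: algebra_simps)
  finally have "(real_of_int (1 + t))\<^sup>2 = 1" using eq by metis
  then have "(1 + t)\<^sup>2 = 1" by (simp only: of_int_power[symmetric] of_int_eq_1_iff)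
  then have "1 + t = 1 \<or> 1 + t = - 1" by (simp only: power2_eq_1_iff)
  then have t: "t = 0 \<or> t = - 2" by linarith
  have odd: "odd (m + n * (D + 2) - 2 ^ e * (m\<^sup>2 + m * n * D - n\<^sup>2 * D))"
    using m evenD assms(2) by simp
  have "t \<noteq> 0"
  proof -
    have "a \<noteq> 0" if "odd a" for a :: int using that by auto
    from this[OF odd] show ?thesis using assms(1) unfolding t_def by simp
  qed
  \<comment> \<open>Both \<open>2 ^ e\<close> and \<open>D\<close> are even, which excludes the
    value -1 for the product.\<close>
  moreover have "4 dvd t"
  proof -
    obtain d where "D = 2 * d" using evenD by auto
    moreover obtain k where "e = Suc k" using assms(2) by (cases e) auto
    ultimately show ?thesis unfolding t_def by (simp add: mult_ac)
  qed
  ultimately show False using t by auto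
qed

end

section \<open>Conjugate pairs and relative units\<close>

locale quartic_equation =
  fixes B C c :: int
  assumes B_pos: "B > 0" and C_pos: "C > 0" and c_cases: "c = 1 \<or> c = 2 \<and> odd B \<and> odd C"
begin

text \<open>Dividing by \<open>c\<close> under the roots lets both values of \<open>c\<close> be
  treated alike: a solution satisfies
  \<open>(a * rC)\<^sup>2 - (y\<^sup>2 * rB)\<^sup>2 = 1\<close>.\<close>

definition rB :: real where "rB = sqrt (B / c)"
definition rC :: real where "rC = sqrt (C / c)"
definition rN :: real where "rN = sqrt (B * C)"

lemma c_pos: "c > 0" using c_cases by auto

lemma r_pos: "rB > 0" "rC > 0" "rN > 0"
  using B_pos C_pos c_pos by (simp_all add: rB_def rC_def rN_def)

lemma r_mult: "rB * rB = B / c" "rC * rC = C / c" "rN * rN = B * C" "c * (rB * rC) = rN"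
  "rN * rB = B * rC" "rN * rC = C * rB"
proof -
  show 1: "rB * rB = B / c" and 2: "rC * rC = C / c" "rN * rN = B * C"
    using B_pos C_pos c_pos by (simp_all add: rB_def rC_def rN_def)
  have "rB * rC = sqrt (B * C) / sqrt (c * c)"
    unfolding rB_def rC_def by (simp add: real_sqrt_divide real_sqrt_mult)
  then show 3: "c * (rB * rC) = rN" using c_pos by (simp add: rN_def)
  have "rN * rB = c * (rB * rB) * rC" "rN * rC = c * (rC * rC) * rB"
    by (simp_all add: 3[symmetric])
  then show "rN * rB = B * rC" "rN * rC = C * rB" using c_pos by (simp_all add: 1 2)
qed

text \<open>Conjugate pairs over \<open>\<int>[\<surd>(B * C)]\<close> (grade \<open>False\<close>) and over the lattice containing
  \<open>(a * \<surd>C + b * \<surd>B) / \<surd>c\<close> (grade \<open>True\<close>).\<close>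

definition conj_pair :: "bool \<Rightarrow> real \<Rightarrow> real \<Rightarrow> bool" where
  "conj_pair i z z' \<longleftrightarrow>
    (if i then \<exists>a b :: int. c dvd a - b \<and> z = of_int a * rC + of_int b * rB \<and> z' = of_int a * rC - of_int b * rB
     else \<exists>a b :: int. z = of_int a + of_int b * rN \<and> z' = of_int a - of_int b * rN)"

lemma pairF: "conj_pair False (of_int a + of_int b * rN) (of_int a - of_int b * rN)"
  by (auto simp: conj_pair_def)

lemma pairT: "c dvd a - b \<Longrightarrow> conj_pair True (of_int a * rC + of_int b * rB) (of_int a * rC - of_int b * rB)"
  by (auto simp: conj_pair_def)

lemma pair_of_int: "conj_pair False (of_int a) (of_int a)"
  using pairF[of a 0] by simp

lemma pair_one: "conj_pair False 1 1" using pair_of_int[of 1] by simp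

lemma pair_zero: "conj_pair i 0 0"
  using pairF[of 0 0] pairT[of 0 0] by (cases i) auto

lemma pair_add: "conj_pair i z z' \<Longrightarrow> conj_pair i w w' \<Longrightarrow> conj_pair i (z + w) (z' + w')"
proof (cases i)
  case True
  assume "conj_pair i z z'" "conj_pair i w w'"
  with True obtain a b k l :: int where "c dvd a - b" "c dvd k - l"
    and e: "z = a * rC + b * rB" "z' = a * rC - b * rB" "w = k * rC + l * rB" "w' = k * rC - l * rB"
    unfolding conj_pair_def by auto
  then have "c dvd (a + k) - (b + l)" using dvd_add[of c "a - b" "k - l"] by (simp add: algebra_simps)
  from pairT[OF this] True show ?thesis unfolding e by (simp add: algebra_simps)
next
  case False
  assume "conj_pair i z z'" "conj_pair i w w'"
  with False obtain a b k l :: int where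
    e: "z = a + b * rN" "z' = a - b * rN" "w = k + l * rN" "w' = k - l * rN"
    unfolding conj_pair_def by auto
  from pairF[of "a + k" "b + l"] False show ?thesis unfolding e by (simp add: algebra_simps)
qed

lemma pair_uminus: "conj_pair i z z' \<Longrightarrow> conj_pair i (- z) (- z')"
proof (cases i)
  case True
  assume "conj_pair i z z'"
  with True obtain a b :: int where "c dvd a - b"
    and e: "z = a * rC + b * rB" "z' = a * rC - b * rB"
    unfolding conj_pair_def by auto
  then have "c dvd (- a) - (- b)" using dvd_minus_iff[of c "a - b"] by (simp add: algebra_simps)
  from pairT[OF this] True show ?thesis unfolding e by (simp add: algebra_simps)
next
  case False
  assume "conj_pair i z z'"
  with False obtain a b :: int where e: "z = a + b * rN" "z' = a - b * rN"
    unfolding conj_pair_def by auto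
  from pairF[of "- a" "- b"] False show ?thesis unfolding e by (simp add: algebra_simps)
qed

lemma pair_diff: "conj_pair i z z' \<Longrightarrow> conj_pair i w w' \<Longrightarrow> conj_pair i (z - w) (z' - w')"
  using pair_add[OF _ pair_uminus, of i z z' w w'] by simp

lemma pair_swap: "conj_pair i z z' \<Longrightarrow> conj_pair i z' z"
proof (cases i)
  case True
  assume "conj_pair i z z'"
  with True obtain a b :: int where d: "c dvd a - b"
    and e: "z = a * rC + b * rB" "z' = a * rC - b * rB"
    unfolding conj_pair_def by auto
  have "c dvd a - (- b)"
  proof -
    \<comment> \<open>\<open>a - b\<close> and \<open>a + b\<close> agree modulo \<open>c\<close>,
      as \<open>c\<close> is 1 or 2.\<close>
    have "c dvd 2 * b" using c_cases by auto
    from dvd_add[OF d this] show ?thesis by (simp add: add.commute)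
  qed
  from pairT[OF this] show ?thesis using True e by simp
next
  case False
  assume "conj_pair i z z'"
  with False obtain a b :: int where e: "z = a + b * rN" "z' = a - b * rN"
    unfolding conj_pair_def by auto
  from pairF[of a "- b"] show ?thesis using False e by simp
qed

lemma pair_mult_FF:
  assumes "conj_pair False z z'" "conj_pair False w w'" shows "conj_pair False (z * w) (z' * w')"
proof -
  obtain a b k l :: int where
    e: "z = a + b * rN" "z' = a - b * rN" "w = k + l * rN" "w' = k - l * rN"
    using assms unfolding conj_pair_def by auto
  have "z * w = a * k + b * l * (rN * rN) + (a * l + b * k) * rN"
    "z' * w' = a * k + b * l * (rN * rN) - (a * l + b * k) * rN"
    by (simp_all add: e algebra_simps)
  then show ?thesis using pairF[of "a * k + b * l * (B * C)" "a * l + b * k"] unfolding r_mult by simp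
qed

lemma pair_mult_FT:
  assumes "conj_pair False z z'" "conj_pair True w w'" shows "conj_pair True (z * w) (z' * w')"
proof -
  obtain a b k l :: int where d: "c dvd k - l" and
    e: "z = a + b * rN" "z' = a - b * rN" "w = k * rC + l * rB" "w' = k * rC - l * rB"
    using assms unfolding conj_pair_def by auto
  have "z * w = a * k * rC + b * l * (rN * rB) + (a * l * rB + b * k * (rN * rC))"
    "z' * w' = a * k * rC + b * l * (rN * rB) - (a * l * rB + b * k * (rN * rC))"
    by (simp_all add: e algebra_simps)
  then have m: "z * w = (a * k + b * l * B) * rC + (a * l + b * k * C) * rB"
    "z' * w' = (a * k + b * l * B) * rC - (a * l + b * k * C) * rB"
    unfolding r_mult by (simp_all add: algebra_simps)
  have "c dvd (a * k + b * l * B) - (a * l + b * k * C)"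
  proof (cases "c = 1")
    case False
    then have "c = 2" "odd B" "odd C" using c_cases by auto
    with d show ?thesis by auto
  qed simp
  from pairT[OF this] show ?thesis unfolding m by simp
qed

text \<open>For \<open>c = 2\<close> both coordinates of the product come with a denominator 2. It
  cancels because \<open>a\<close> and \<open>b\<close> agree in parity, so do \<open>k\<close> and
  \<open>l\<close>, and \<open>B\<close> and \<open>C\<close> are odd.\<close>

lemma pair_mult_TT:
  assumes "conj_pair True z z'" "conj_pair True w w'" shows "conj_pair False (z * w) (z' * w')"
proof -
  obtain a b k l :: int where d: "c dvd a - b" "c dvd k - l" and
    e: "z = a * rC + b * rB" "z' = a * rC - b * rB" "w = k * rC + l * rB" "w' = k * rC - l * rB"
    using assms unfolding conj_pair_def by auto
  have "c dvd a * k * C + b * l * B \<and> c dvd a * l + b * k"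
  proof (cases "c = 1")
    case False
    then have "c = 2" "odd B" "odd C" using c_cases by auto
    with d show ?thesis by auto
  qed simp
  then obtain s t where s: "a * k * C + b * l * B = c * s" and t: "a * l + b * k = c * t" by (auto elim!: dvdE)
  have "real_of_int c * (rC * rC) = C" "real_of_int c * (rB * rB) = B" using c_pos by (simp_all add: r_mult)
  moreover have "c * (z * w) = a * k * (c * (rC * rC)) + b * l * (c * (rB * rB)) + (a * l + b * k) * (c * (rB * rC))"
    "c * (z' * w') = a * k * (c * (rC * rC)) + b * l * (c * (rB * rB)) - (a * l + b * k) * (c * (rB * rC))"
    by (simp_all add: e algebra_simps)
  ultimately have "c * (z * w) = of_int (a * k * C + b * l * B) + of_int (a * l + b * k) * rN"
    "c * (z' * w') = of_int (a * k * C + b * l * B) - of_int (a * l + b * k) * rN"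
    by (simp_all add: r_mult(4))
  then have "c * (z * w) = c * (s + t * rN)" "c * (z' * w') = c * (s - t * rN)"
    unfolding s t by (simp_all add: algebra_simps)
  then have "z * w = s + t * rN" "z' * w' = s - t * rN" using c_pos by simp_all
  then show ?thesis using pairF[of s t] by simp
qed

lemma pair_mult:
  assumes "conj_pair i z z'" "conj_pair j w w'" shows "conj_pair (i \<noteq> j) (z * w) (z' * w')"
  using assms pair_mult_FF[of z z' w w'] pair_mult_FT[of z z' w w'] pair_mult_FT[of w w' z z'] pair_mult_TT[of z z' w w']
  by (cases i; cases j) (simp_all add: mult.commute)

lemma pair_square: "conj_pair i z z' \<Longrightarrow> conj_pair False (z\<^sup>2) (z'\<^sup>2)"
  using pair_mult[of i z z' i z z'] by (simp add: power2_eq_square)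

lemma pair_power: "conj_pair i z z' \<Longrightarrow> conj_pair (i \<and> odd n) (z ^ n) (z' ^ n)"
proof (induction n)
  case (Suc n)
  have "(i \<noteq> (i \<and> odd n)) = (i \<and> odd (Suc n))" by auto
  then show ?case using pair_mult[OF Suc.prems Suc.IH[OF Suc.prems]] by (simp add: mult.commute)
qed (simp add: pair_one)

lemma pair_norm:
  assumes "conj_pair i z z'" shows "\<exists>n :: int. z * z' = of_int n"
proof -
  obtain s t :: int where "z * z' = s + t * rN" "z' * z = s - t * rN"
    using pair_mult[OF assms pair_swap[OF assms]] by (auto simp: conj_pair_def)
  then have "z * z' = s" by (simp add: mult.commute)
  then show ?thesis by blast
qed

text \<open>Squares of either grade lie in \<open>\<int>[\<surd>(B * C)]\<close>, where traces are
  even; the 2-adic argument lives on this evenness.\<close>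

lemma pair_sum_squares:
  assumes "conj_pair i z z'" shows "\<exists>n :: int. z\<^sup>2 + z'\<^sup>2 = 2 * of_int n"
proof -
  obtain s t :: int where "z\<^sup>2 = s + t * rN" "z'\<^sup>2 = s - t * rN"
    using pair_square[OF assms] by (auto simp: conj_pair_def)
  then have "z\<^sup>2 + z'\<^sup>2 = 2 * of_int s" by simp
  then show ?thesis by blast
qed

lemma r_ge: "rN \<ge> 1" "2 * rB \<ge> 1" "2 * rC \<ge> 1"
proof -
  have "1 * 1 \<le> B * C" using B_pos C_pos by (intro mult_mono) auto
  then have "real_of_int (B * C) \<ge> 1" by linarith
  then show "rN \<ge> 1" unfolding rN_def by simp
  have c2: "c \<le> 2" using c_cases by auto
  have "sqrt (1 / 4) \<le> rB" "sqrt (1 / 4) \<le> rC" unfolding rB_def rC_def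
    using B_pos C_pos c_pos c2 by (simp_all add: field_simps)
  then show "2 * rB \<ge> 1" "2 * rC \<ge> 1" by (simp_all add: real_sqrt_divide)
qed

text \<open>Sum and difference of \<open>z\<close> and \<open>z'\<close> recover the two
  coordinates, scaled by numbers that are at least 1/2, so only coefficients up to
  \<open>2 * K\<close> in absolute value occur.\<close>

lemma finite_conj_pair: "finite {z. \<exists>z'. conj_pair i z z' \<and> \<bar>z\<bar> \<le> K \<and> \<bar>z'\<bar> \<le> K}"
proof -
  define k where "k = \<lceil>2 * K\<rceil>"
  have bound: "a \<in> {- k..k}" if "\<bar>of_int a * r\<bar> \<le> K" "2 * r \<ge> 1" for a r
  proof -
    have "\<bar>real_of_int a\<bar> * 1 \<le> \<bar>real_of_int a\<bar> * (2 * r)" using that by (intro mult_left_mono) auto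
    also have "\<dots> = 2 * \<bar>of_int a * r\<bar>" using that by (simp add: abs_mult)
    also have "\<dots> \<le> 2 * K" using that by simp
    finally have "real_of_int \<bar>a\<bar> \<le> 2 * K" by simp
    then have "\<bar>a\<bar> \<le> k" unfolding k_def by linarith
    then show ?thesis by auto
  qed
  have half: "\<bar>x\<bar> \<le> K" "\<bar>y\<bar> \<le> K" if "\<bar>x + y\<bar> \<le> K" "\<bar>x - y\<bar> \<le> K" for x y :: real
    using that by linarith+
  define F where "F = (\<lambda>(a, b). if i then of_int a * rC + of_int b * rB else of_int a + of_int b * rN) ` ({- k..k} \<times> {- k..k})"
  have "finite F" unfolding F_def by auto
  moreover have "{z. \<exists>z'. conj_pair i z z' \<and> \<bar>z\<bar> \<le> K \<and> \<bar>z'\<bar> \<le> K} \<subseteq> F"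
  proof (intro subsetI, elim CollectE exE conjE)
    fix z z' assume p: "conj_pair i z z'" and K: "\<bar>z\<bar> \<le> K" "\<bar>z'\<bar> \<le> K"
    show "z \<in> F"
    proof (cases i)
      case True
      with p obtain a b :: int where e: "z = a * rC + b * rB" "z' = a * rC - b * rB"
        unfolding conj_pair_def by auto
      have "\<bar>a * rC\<bar> \<le> K" "\<bar>b * rB\<bar> \<le> K" using half[of "a * rC" "b * rB"] K e by auto
      then have "a \<in> {- k..k}" "b \<in> {- k..k}" using bound r_ge by blast+
      with True e show ?thesis unfolding F_def by auto
    next
      case False
      with p obtain a b :: int where e: "z = a + b * rN" "z' = a - b * rN"
        unfolding conj_pair_def by auto
      have "\<bar>a * 1\<bar> \<le> K" "\<bar>b * rN\<bar> \<le> K" using half[of a "b * rN"] K e by auto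
      then have "a \<in> {- k..k}" "b \<in> {- k..k}" using bound[of a 1] bound[of b rN] r_ge by auto
      with False e show ?thesis unfolding F_def by auto
    qed
  qed
  ultimately show ?thesis by (rule finite_subset[rotated])
qed

lemma pair_cheb:
  assumes x: "conj_pair i x x'"
  shows "\<exists>w w' v v'. conj_pair False w w' \<and> conj_pair False v v' \<and>
    chebT n x = (if odd n then x else 1) * w \<and> chebT n x' = (if odd n then x' else 1) * w' \<and>
    chebU n x = (if odd n then 1 else x) * v \<and> chebU n x' = (if odd n then 1 else x') * v'"
  by (rule cheb_parity[of "\<lambda>_. conj_pair False"])
     (use pair_add pair_mult_FF pair_one pair_zero pair_square[OF x] pair_diff[OF pair_square[OF x] pair_one] in blast)+

lemma pair_chebT:
  assumes "conj_pair i x x'" shows "conj_pair False ((chebT n x)\<^sup>2) ((chebT n x')\<^sup>2)"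
proof -
  from pair_cheb[OF assms, of n] obtain w w' where w: "conj_pair False w w'"
    and T: "chebT n x = (if odd n then x else 1) * w" "chebT n x' = (if odd n then x' else 1) * w'" by blast
  have "conj_pair (i \<and> odd n) (if odd n then x else 1) (if odd n then x' else 1)" using assms pair_one by auto
  from pair_mult[OF this w] show ?thesis unfolding T by (rule pair_square)
qed

text \<open>If the Chebyshev values of \<open>x\<close> at two coprime degrees are units, then \<open>x\<close> itself is a unit because one of
  the degrees is odd, and then both degrees are at most 1 by 2-adic reasons.\<close>

lemma cheb_units_trivial:
  assumes x: "conj_pair i x x'" "x\<^sup>2 \<noteq> 1" and k: "coprime k l" "k \<ge> 1" "l \<ge> 1"
    and unit: "(chebT k x * chebT k x')\<^sup>2 = 1" "(chebT l x * chebT l x')\<^sup>2 = 1"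
  shows "k = 1 \<and> l = 1"
proof -
  have int_unit: "(of_int a :: real)\<^sup>2 = 1" if "(of_int a :: real)\<^sup>2 * (of_int b)\<^sup>2 = 1" for a b :: int
  proof -
    have "of_int (a\<^sup>2 * b\<^sup>2) = (of_int 1 :: real)" using that by simp
    then have "a\<^sup>2 * b\<^sup>2 = 1" by (simp only: of_int_eq_iff)
    then have "a\<^sup>2 = 1 \<or> a\<^sup>2 = - 1" by (auto simp: zmult_eq_1_iff)
    moreover have "a\<^sup>2 \<ge> 0" by simp
    ultimately have "a\<^sup>2 = 1" by linarith
    then show ?thesis by (metis of_int_1 of_int_power)
  qed
  \<comment> \<open>For odd \<open>n\<close> the value is \<open>x * w\<close>, so the squares of
    the integer norms of \<open>x\<close> and \<open>w\<close> multiply to 1.\<close>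
  have norm: "(x * x')\<^sup>2 = 1" if n: "odd n" and u: "(chebT n x * chebT n x')\<^sup>2 = 1" for n
  proof -
    from pair_cheb[OF x(1), of n] obtain w w' where w: "conj_pair False w w'"
      and T: "chebT n x = (if odd n then x else 1) * w" "chebT n x' = (if odd n then x' else 1) * w'" by blast
    obtain a b :: int where "x * x' = a" "w * w' = b" using pair_norm[OF x(1)] pair_norm[OF w] by auto
    moreover have "(x * x')\<^sup>2 * (w * w')\<^sup>2 = 1" using u n unfolding T by (simp add: power_mult_distrib mult_ac)
    ultimately show ?thesis using int_unit by metis
  qed
  have "odd k \<or> odd l" using k(1) by (metis coprime_common_divisor_nat even_numeral not_coprimeI odd_one)
  then have xx: "(x * x')\<^sup>2 = 1" using norm unit by blast
  obtain s :: int where s: "x\<^sup>2 + x'\<^sup>2 = 2 * of_int s" using pair_sum_squares[OF x(1)] by auto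
  have xx': "x\<^sup>2 * x'\<^sup>2 = 1" using xx by (simp add: power_mult_distrib)
  \<comment> \<open>As \<open>x\<^sup>2 * x'\<^sup>2 = 1\<close>, the norm of
    \<open>x\<^sup>2 - 1\<close> is \<open>2 - 2 * s\<close>, the negative of its trace.\<close>
  interpret even_trace "2 * s - 2" "x\<^sup>2 - 1" "x'\<^sup>2 - 1"
  proof
    show "x\<^sup>2 - 1 + (x'\<^sup>2 - 1) = real_of_int (2 * s - 2)" using s by simp
    have "(x\<^sup>2 - 1) * (x'\<^sup>2 - 1) = x\<^sup>2 * x'\<^sup>2 - (x\<^sup>2 + x'\<^sup>2) + 1" by (simp add: algebra_simps)
    then show "(x\<^sup>2 - 1) * (x'\<^sup>2 - 1) = - real_of_int (2 * s - 2)" unfolding xx' s by simp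
  qed simp
  have nz: "2 * s - 2 \<noteq> 0"
  proof
    assume "2 * s - 2 = 0"
    then have "x\<^sup>2 + x'\<^sup>2 = 2" using s by simp
    then have "x'\<^sup>2 = 2 - x\<^sup>2" by simp
    with xx' have "x\<^sup>2 * (2 - x\<^sup>2) = 1" by simp
    then have "(x\<^sup>2 - 1)\<^sup>2 = 0" by (simp add: power2_eq_square algebra_simps)
    with x(2) show False by simp
  qed
  have small: "n < 2" if u: "(chebT n x * chebT n x')\<^sup>2 = 1" for n
  proof (rule ccontr)
    assume "\<not> n < 2"
    then have n: "n \<ge> 2" by simp
    from chebT_expansion[OF _ _ n, of x x'] obtain e w w' where e: "e > 0" "zpair (x\<^sup>2 - 1) (x'\<^sup>2 - 1) True w w'"
      and T: "chebT n x = (if odd n then x else 1) * (1 + 2 ^ e * (x\<^sup>2 - 1) * w)"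
       "chebT n x' = (if odd n then x' else 1) * (1 + 2 ^ e * (x'\<^sup>2 - 1) * w')" by auto
    have "((if odd n then x else 1) * (if odd n then x' else 1))\<^sup>2 = 1" using xx by auto
    moreover have "(chebT n x * chebT n x')\<^sup>2 = ((if odd n then x else 1) * (if odd n then x' else 1))\<^sup>2 *
      ((1 + 2 ^ e * (x\<^sup>2 - 1) * w) * (1 + 2 ^ e * (x'\<^sup>2 - 1) * w'))\<^sup>2"
      unfolding T by (simp only: power_mult_distrib mult_ac)
    ultimately have "((1 + 2 ^ e * (x\<^sup>2 - 1) * w) * (1 + 2 ^ e * (x'\<^sup>2 - 1) * w'))\<^sup>2 = 1" using u by simp
    with expansion_product_neq[OF nz e] show False by simp
  qed
  from small[OF unit(1)] small[OF unit(2)] k show ?thesis by simp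
qed


text \<open>The relation \<open>conj_pair\<close> determines the conjugate once
  \<open>\<surd>(B * C)\<close> is irrational. This identifies the conjugate of a Chebyshev value
  with that of the unit it equals.\<close>

lemma conj_unique:
  assumes ns: "\<And>k :: int. k\<^sup>2 \<noteq> B * C"
    and p: "conj_pair False z z'" "conj_pair False z z''"
  shows "z' = z''"
proof -
  obtain a b :: int where e1: "z = a + b * rN" "z' = a - b * rN"
    using p(1) unfolding conj_pair_def by auto
  obtain k l :: int where e2: "z = k + l * rN" "z'' = k - l * rN"
    using p(2) unfolding conj_pair_def by auto
  note e = e1 e2
  have "of_int (b - l) * rN = of_int (k - a)" using e(1,3) by (simp add: algebra_simps)
  then have "(of_int (b - l) * rN)\<^sup>2 = (of_int (k - a))\<^sup>2" by simp
  then have "(of_int (b - l))\<^sup>2 * (rN * rN) = (of_int (k - a))\<^sup>2" by (simp add: power2_eq_square mult_ac)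
  then have "real_of_int ((b - l)\<^sup>2 * (B * C)) = of_int ((k - a)\<^sup>2)" unfolding r_mult by simp
  then have q: "(b - l)\<^sup>2 * (B * C) = (k - a)\<^sup>2" by (simp only: of_int_eq_iff)
  have "b = l"
  proof (rule ccontr)
    assume "b \<noteq> l"
    have "(b - l)\<^sup>2 dvd (k - a)\<^sup>2" unfolding q[symmetric] by simp
    then have "b - l dvd k - a" by simp
    then obtain m where m: "k - a = (b - l) * m" by (elim dvdE)
    from q have "(b - l)\<^sup>2 * (B * C) = (b - l)\<^sup>2 * m\<^sup>2" unfolding m by (simp add: power_mult_distrib)
    with \<open>b \<noteq> l\<close> have "m\<^sup>2 = B * C" by simp
    with ns show False by blast
  qed
  then show ?thesis using e by simp
qed

text \<open>The units \<open>u + v * \<surd>\<kappa>\<close> of relative norm 1 over the lattice, homogeneous with respect to the grading. For \<open>\<kappa>' \<le> 0\<close>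
  they form a discrete group, because the conjugate of \<open>u\<close> is bounded by 1.\<close>

definition rel_units :: "real \<Rightarrow> real \<Rightarrow> real set" where
  "rel_units \<kappa> \<kappa>' = {E. E > 0 \<and> (\<exists>i u u' v v'. conj_pair i u u' \<and> conj_pair (\<not> i) v v' \<and>
     E = u + v * sqrt \<kappa> \<and> u\<^sup>2 - \<kappa> * v\<^sup>2 = 1 \<and> u'\<^sup>2 - \<kappa>' * v'\<^sup>2 = 1)}"

lemma rel_unitsI:
  "E > 0 \<Longrightarrow> conj_pair i u u' \<Longrightarrow> conj_pair (\<not> i) v v' \<Longrightarrow> E = u + v * sqrt \<kappa> \<Longrightarrow> u\<^sup>2 - \<kappa> * v\<^sup>2 = 1 \<Longrightarrow>
   u'\<^sup>2 - \<kappa>' * v'\<^sup>2 = 1 \<Longrightarrow> E \<in> rel_units \<kappa> \<kappa>'"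
  unfolding rel_units_def by blast

lemma rel_unitsE:
  assumes "E \<in> rel_units \<kappa> \<kappa>'" "\<kappa> \<ge> 0"
  obtains i u u' v v' where "conj_pair i u u'" "conj_pair (\<not> i) v v'" "E = u + v * sqrt \<kappa>" "1 / E = u - v * sqrt \<kappa>"
    "u\<^sup>2 - \<kappa> * v\<^sup>2 = 1" "u'\<^sup>2 - \<kappa>' * v'\<^sup>2 = 1"
proof -
  from assms(1) obtain i u u' v v' where h: "conj_pair i u u'" "conj_pair (\<not> i) v v'" "E = u + v * sqrt \<kappa>"
    "u\<^sup>2 - \<kappa> * v\<^sup>2 = 1" "u'\<^sup>2 - \<kappa>' * v'\<^sup>2 = 1" and E: "E > 0" unfolding rel_units_def by blast
  have "E * (u - v * sqrt \<kappa>) = u\<^sup>2 - (sqrt \<kappa>)\<^sup>2 * v\<^sup>2"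
    unfolding h(3) by (simp add: algebra_simps power2_eq_square)
  also have "\<dots> = 1" using h(4) assms(2) by simp
  finally have "1 / E = u - v * sqrt \<kappa>" using E by (simp add: field_simps)
  with h that show thesis by blast
qed

text \<open>The relative norm is multiplicative by Brahmagupta's identity, over \<kappa> and over
  its conjugate alike. The grades of the two coordinates stay opposite because \<kappa> has grade
  \<open>False\<close>.\<close>

lemma rel_units_divide:
  assumes k: "conj_pair False \<kappa> \<kappa>'" "\<kappa> \<ge> 0" and E: "E \<in> rel_units \<kappa> \<kappa>'" and F: "F \<in> rel_units \<kappa> \<kappa>'"
  shows "E / F \<in> rel_units \<kappa> \<kappa>'"
proof -
  obtain i u u' v v' where e: "conj_pair i u u'" "conj_pair (\<not> i) v v'" "E = u + v * sqrt \<kappa>"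
    "u\<^sup>2 - \<kappa> * v\<^sup>2 = 1" "u'\<^sup>2 - \<kappa>' * v'\<^sup>2 = 1" using rel_unitsE[OF E k(2)] by metis
  obtain j w w' t t' where f: "conj_pair j w w'" "conj_pair (\<not> j) t t'" "1 / F = w - t * sqrt \<kappa>"
    "w\<^sup>2 - \<kappa> * t\<^sup>2 = 1" "w'\<^sup>2 - \<kappa>' * t'\<^sup>2 = 1" using rel_unitsE[OF F k(2)] by metis
  have brahmagupta: "(a * c - \<kappa> * (b * d))\<^sup>2 - \<kappa> * (b * c - a * d)\<^sup>2 = (a\<^sup>2 - \<kappa> * b\<^sup>2) * (c\<^sup>2 - \<kappa> * d\<^sup>2)"
    for a b c d \<kappa> :: real by (simp add: algebra_simps power2_eq_square)
  have pos: "E / F > 0" using E F unfolding rel_units_def by simp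
  have "conj_pair (False \<noteq> ((\<not> i) \<noteq> (\<not> j))) (\<kappa> * (v * t)) (\<kappa>' * (v' * t'))"
    using e f k by (intro pair_mult)
  then have 1: "conj_pair (i \<noteq> j) (u * w - \<kappa> * (v * t)) (u' * w' - \<kappa>' * (v' * t'))"
    using pair_mult[OF e(1) f(1)] by (intro pair_diff) auto
  have 2: "conj_pair (\<not> (i \<noteq> j)) (v * w - u * t) (v' * w' - u' * t')"
    using pair_mult[OF e(2) f(1)] pair_mult[OF e(1) f(2)] by (intro pair_diff) auto
  have sk: "sqrt \<kappa> * sqrt \<kappa> = \<kappa>" using k by simp
  have "E / F = E * (1 / F)" by simp
  also have "\<dots> = u * w - (sqrt \<kappa> * sqrt \<kappa>) * (v * t) + (v * w - u * t) * sqrt \<kappa>"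
    unfolding e f by (simp add: algebra_simps)
  finally have 3: "E / F = u * w - \<kappa> * (v * t) + (v * w - u * t) * sqrt \<kappa>" unfolding sk .
  show ?thesis
    by (rule rel_unitsI[OF pos 1 2 3]) (simp_all only: brahmagupta e f mult_1)
qed

text \<open>\<open>u = (E + 1 / E) / 2\<close> lies between 0 and \<open>K\<close>, its conjugate
  between -1 and 1, so finitely many \<open>u\<close> occur; and \<open>u\<close> determines
  \<open>E\<close>, since \<open>v * sqrt \<kappa>\<close> is the nonnegative root of
  \<open>u\<^sup>2 - 1\<close>.\<close>

lemma finite_rel_units:
  assumes k: "\<kappa> \<ge> 0" "\<kappa>' \<le> 0"
  shows "finite (rel_units \<kappa> \<kappa>' \<inter> {1..K})"
proof -
  define F where "F = (\<Union>i. {z. \<exists>z'. conj_pair i z z' \<and> \<bar>z\<bar> \<le> max K 1 \<and> \<bar>z'\<bar> \<le> max K 1})"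
  have "finite F" unfolding F_def by (intro finite_UN_I finite_conj_pair) simp
  moreover have "rel_units \<kappa> \<kappa>' \<inter> {1..K} \<subseteq> (\<lambda>u. u + sqrt (u\<^sup>2 - 1)) ` F"
  proof
    fix E assume E: "E \<in> rel_units \<kappa> \<kappa>' \<inter> {1..K}"
    then obtain i u u' v v' where e: "conj_pair i u u'" "conj_pair (\<not> i) v v'" "E = u + v * sqrt \<kappa>" "1 / E = u - v * sqrt \<kappa>"
    "u\<^sup>2 - \<kappa> * v\<^sup>2 = 1" "u'\<^sup>2 - \<kappa>' * v'\<^sup>2 = 1" using rel_unitsE[OF _ k(1)] by blast
    have i1: "1 / E \<le> 1" "1 / E > 0" using E by auto
    have "u > 0" "u \<le> K" using e(3,4) i1 E by auto
    moreover have "u'\<^sup>2 \<le> 1"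
    proof -
      have "\<kappa>' * v'\<^sup>2 \<le> 0" using k by (intro mult_nonpos_nonneg) auto
      then show ?thesis using e(6) by linarith
    qed
    ultimately have "u \<in> F" unfolding F_def using e(1) abs_le_square_iff[of u' 1] by (auto intro!: exI[of _ i] exI[of _ u'])
    moreover have "sqrt (u\<^sup>2 - 1) = v * sqrt \<kappa>"
    proof -
      have "v * sqrt \<kappa> \<ge> 0" using e(3,4) i1 E by auto
      moreover have "u\<^sup>2 - 1 = (v * sqrt \<kappa>)\<^sup>2" using e(5) k by (simp add: power_mult_distrib mult.commute)
      ultimately show ?thesis by (simp add: real_sqrt_unique)
    qed
    ultimately have "u \<in> F" "E = u + sqrt (u\<^sup>2 - 1)" using e(3) by simp_all
    then show "E \<in> (\<lambda>u. u + sqrt (u\<^sup>2 - 1)) ` F" by (rule image_eqI[rotated])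
  qed
  ultimately show ?thesis by (meson finite_imageI finite_subset)
qed


section \<open>Units attached to solutions, and uniqueness up to squares\<close>

definition sol_unit :: "int \<Rightarrow> int \<Rightarrow> real" where
  "sol_unit a y = of_int a * rC + of_int (y\<^sup>2) * rB"

definition is_sol :: "int \<Rightarrow> int \<Rightarrow> bool" where
  "is_sol a y \<longleftrightarrow> a > 0 \<and> y > 0 \<and> C * a\<^sup>2 - B * y ^ 4 = c"

lemma sol_unit:
  assumes "is_sol a y"
  shows "conj_pair True (sol_unit a y) (1 / sol_unit a y)" "sol_unit a y > 1"
    "sol_unit a y - 1 / sol_unit a y = 2 * of_int (y\<^sup>2) * rB" "sol_unit a y + 1 / sol_unit a y = 2 * of_int a * rC"
proof -
  have pos: "a > 0" "y > 0" and eq: "C * a\<^sup>2 - B * y ^ 4 = c" using assms unfolding is_sol_def by auto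
  have s0: "sol_unit a y > 0" unfolding sol_unit_def using pos r_pos by (simp add: add_pos_pos)
  have "sol_unit a y * (of_int a * rC - of_int (y\<^sup>2) * rB) = of_int (a\<^sup>2) * (rC * rC) - of_int (y ^ 4) * (rB * rB)"
    unfolding sol_unit_def by (simp add: algebra_simps power2_eq_square power4_eq_xxxx)
  also have "\<dots> = of_int (C * a\<^sup>2 - B * y ^ 4) / c" unfolding r_mult by (simp add: diff_divide_distrib mult.commute)
  also have "\<dots> = 1" unfolding eq using c_pos by simp
  finally have inv: "1 / sol_unit a y = of_int a * rC - of_int (y\<^sup>2) * rB" using s0 by (simp add: field_simps)
  have "c dvd a - y\<^sup>2"
  proof (cases "c = 1")
    case False
    then have c: "c = 2" "odd B" "odd C" using c_cases by auto
    have "even (C * a\<^sup>2 - B * y ^ 4)" unfolding eq using c by simp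
    with c show ?thesis by auto
  qed simp
  from pairT[OF this] show "conj_pair True (sol_unit a y) (1 / sol_unit a y)"
    unfolding inv unfolding sol_unit_def .
  show d: "sol_unit a y - 1 / sol_unit a y = 2 * of_int (y\<^sup>2) * rB" "sol_unit a y + 1 / sol_unit a y = 2 * of_int a * rC"
    unfolding inv unfolding sol_unit_def by simp_all
  have "sol_unit a y - 1 / sol_unit a y > 0" unfolding d using pos r_pos by simp
  then have "(sol_unit a y)\<^sup>2 > 1" using s0 by (simp add: field_simps power2_eq_square)
  then show "sol_unit a y > 1" using s0 by (metis abs_of_pos abs_square_le_1 linorder_not_le)
qed

text \<open>Otherwise \<open>c\<^sup>2\<close> would be a difference of two squares, of
  \<open>P > Q\<close> with \<open>Q \<ge> 2\<close>. Such a difference is at least 5, whereas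
  \<open>c\<^sup>2 \<le> 4\<close>.\<close>

lemma sol_nonsquare:
  assumes "is_sol a y" shows "k\<^sup>2 \<noteq> B * C"
proof
  assume k: "k\<^sup>2 = B * C"
  have pos: "a > 0" "y > 0" and eq: "C * a\<^sup>2 - B * y ^ 4 = c" using assms unfolding is_sol_def by auto
  define P where "P = C * a\<^sup>2 + B * y ^ 4"
  have "P\<^sup>2 - (2 * k * (a * y\<^sup>2))\<^sup>2 = P\<^sup>2 - 4 * k\<^sup>2 * (a\<^sup>2 * y ^ 4)"
    by (simp add: algebra_simps power2_eq_square power4_eq_xxxx)
  also have "\<dots> = (C * a\<^sup>2 - B * y ^ 4)\<^sup>2"
    unfolding k by (simp add: P_def algebra_simps power2_eq_square power4_eq_xxxx)
  finally have "P\<^sup>2 - (2 * k * (a * y\<^sup>2))\<^sup>2 = (C * a\<^sup>2 - B * y ^ 4)\<^sup>2" .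
  then have P2: "P\<^sup>2 - (2 * k * (a * y\<^sup>2))\<^sup>2 = c\<^sup>2" unfolding eq .
  define Q where "Q = \<bar>2 * k * (a * y\<^sup>2)\<bar>"
  have "k \<noteq> 0" using k B_pos C_pos by auto
  then have Q2: "Q \<ge> 2" unfolding Q_def using pos by (simp add: abs_mult) (smt (verit) mult_pos_pos zero_less_power zero_less_abs_iff)
  have "Q\<^sup>2 = (2 * k * (a * y\<^sup>2))\<^sup>2" unfolding Q_def by simp
  then have PQ: "P\<^sup>2 = Q\<^sup>2 + c\<^sup>2" using P2 by simp
  have P0: "P > 0" unfolding P_def using pos B_pos C_pos by (simp add: add_pos_pos)
  have "P > Q"
  proof (rule ccontr)
    assume "\<not> P > Q"
    then have "P\<^sup>2 \<le> Q\<^sup>2" using P0 by (intro power_mono) auto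
    then show False using PQ c_pos by simp
  qed
  then have "(Q + 1)\<^sup>2 \<le> P\<^sup>2" using Q2 by (intro power_mono) auto
  then have "2 * Q + 1 \<le> c\<^sup>2" unfolding PQ by (simp add: power2_eq_square algebra_simps)
  moreover have "c\<^sup>2 \<le> 4" using c_cases by auto
  ultimately show False using Q2 by linarith
qed

text \<open>A square ratio of the two units is exactly what puts both relative units over the same
  \<kappa>, hence into one cyclic group.\<close>

theorem sol_unique_modulo_squares:
  assumes s1: "is_sol a1 y1" and s2: "is_sol a2 y2"
    and g: "conj_pair False g (1 / g)" "g > 0" "sol_unit a2 y2 = g\<^sup>2 * sol_unit a1 y1"
  shows "y1 = y2"
proof -
  define \<alpha>1 where "\<alpha>1 = sol_unit a1 y1"
  define \<alpha>2 where "\<alpha>2 = sol_unit a2 y2"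
  note su1 = sol_unit[OF s1, folded \<alpha>1_def] and su2 = sol_unit[OF s2, folded \<alpha>2_def]
  have pos: "y1 > 0" "y2 > 0" using s1 s2 unfolding is_sol_def by auto
  have \<alpha>g: "\<alpha>2 = g\<^sup>2 * \<alpha>1" using g(3) unfolding \<alpha>1_def \<alpha>2_def .
  define \<kappa> where "\<kappa> = 2 * rB * \<alpha>1"
  \<comment> \<open>Conjugation sends \<open>rB\<close> to \<open>- rB\<close> and
    \<open>\<alpha>1\<close> to its positive inverse, so this is negative, as discreteness
    demands.\<close>
  define \<kappa>' where "\<kappa>' = (- 2 * rB) * (1 / \<alpha>1)"
  have a1: "\<alpha>1 > 0" and a2: "\<alpha>2 > 0" using su1 su2 by auto
  have "c dvd 0 - 2" using c_cases by auto
  from pairT[OF this] have "conj_pair True (2 * rB) (- 2 * rB)" by simp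
  from pair_mult_TT[OF this su1(1)] have k: "conj_pair False \<kappa> \<kappa>'" unfolding \<kappa>_def \<kappa>'_def .
  have k0: "\<kappa> > 0" "\<kappa>' \<le> 0" unfolding \<kappa>_def \<kappa>'_def using a1 r_pos by simp_all
  have rel: "x\<^sup>2 - (2 * r * x) * y = 1" "(1 / x)\<^sup>2 - (- 2 * r * (1 / x)) * y = 1" if "x - 1 / x = 2 * y * r" "x > 0" for x y r :: real
  proof -
    have "x\<^sup>2 - (2 * r * x) * y = x * (x - 2 * y * r)" by (simp add: algebra_simps power2_eq_square)
    then show "x\<^sup>2 - (2 * r * x) * y = 1" unfolding that(1)[symmetric] using that(2) by simp
    have "(1 / x)\<^sup>2 - (- 2 * r * (1 / x)) * y = (1 / x) * (1 / x + 2 * y * r)" by (simp add: algebra_simps power2_eq_square)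
    then show "(1 / x)\<^sup>2 - (- 2 * r * (1 / x)) * y = 1" unfolding that(1)[symmetric] using that(2) by simp
  qed
  define E1 where "E1 = \<alpha>1 + of_int y1 * sqrt \<kappa>"
  \<comment> \<open>The root belonging to \<open>\<alpha>2\<close> is
    \<open>sqrt (2 * rB * \<alpha>2) = g * sqrt \<kappa>\<close>; its coefficient
    \<open>y2 * g\<close> has the conjugate \<open>y2 / g\<close>.\<close>
  define E2 where "E2 = \<alpha>2 + of_int y2 * g * sqrt \<kappa>"
  have "of_int y1 * sqrt \<kappa> > 0" "of_int y2 * g * sqrt \<kappa> > 0" using k0 pos g by simp_all
  then have E1_gt: "E1 > 1" "E2 > 1" unfolding E1_def E2_def using su1(2) su2(2) by linarith+
  have norm1: "\<alpha>1\<^sup>2 - \<kappa> * (of_int y1)\<^sup>2 = 1" "(1 / \<alpha>1)\<^sup>2 - \<kappa>' * (of_int y1)\<^sup>2 = 1"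
    using rel[OF su1(3) a1] unfolding \<kappa>_def \<kappa>'_def by simp_all
  have norm2: "\<alpha>2\<^sup>2 - \<kappa> * (of_int y2 * g)\<^sup>2 = 1" "(1 / \<alpha>2)\<^sup>2 - \<kappa>' * (of_int y2 * (1 / g))\<^sup>2 = 1"
  proof -
    have "\<kappa> * (of_int y2 * g)\<^sup>2 = 2 * rB * \<alpha>2 * of_int (y2\<^sup>2)" unfolding \<kappa>_def \<alpha>g by (simp add: power_mult_distrib)
    then show "\<alpha>2\<^sup>2 - \<kappa> * (of_int y2 * g)\<^sup>2 = 1" using rel(1)[OF su2(3) a2] by simp
    have "\<kappa>' * (of_int y2 * (1 / g))\<^sup>2 = - 2 * rB * (1 / \<alpha>2) * of_int (y2\<^sup>2)" unfolding \<kappa>'_def \<alpha>g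
      by (simp add: power_divide)
    then show "(1 / \<alpha>2)\<^sup>2 - \<kappa>' * (of_int y2 * (1 / g))\<^sup>2 = 1" using rel(2)[OF su2(3) a2] by simp
  qed
  let ?G = "rel_units \<kappa> \<kappa>'"
  have E1G: "E1 \<in> ?G"
    by (rule rel_unitsI[OF _ su1(1) _ E1_def norm1]) (use E1_gt pair_of_int in auto)
  have E2G: "E2 \<in> ?G"
    by (rule rel_unitsI[OF _ su2(1) _ _ norm2])
       (use E1_gt pair_mult_FF[OF pair_of_int g(1), of y2] in \<open>auto simp: E2_def\<close>)
  have div: "E / F \<in> ?G" if "E \<in> ?G" "F \<in> ?G" for E F
    using rel_units_divide[OF k less_imp_le[OF k0(1)] that] .
  obtain \<eta> where \<eta>: "\<eta> \<in> ?G" "\<eta> > 1" "\<And>z. z \<in> ?G \<Longrightarrow> z > 1 \<Longrightarrow> \<exists>n\<ge>1. z = \<eta> ^ n"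
  proof (rule discrete_subgroup_cyclic[of ?G E1])
    show "finite (?G \<inter> {1..K})" for K using finite_rel_units k0 by simp
  qed (use div E1G E1_gt in \<open>auto simp: rel_units_def\<close>)
  obtain m n where mn: "m \<ge> 1" "n \<ge> 1" and Em: "E1 = \<eta> ^ m" and En: "E2 = \<eta> ^ n"
    using \<eta>(3)[OF E1G] \<eta>(3)[OF E2G] E1_gt by auto
  \<comment> \<open>Replacing \<eta> by its power with exponent \<open>gcd m n\<close> makes the
    Chebyshev degrees \<open>p\<close> and \<open>q\<close> coprime.\<close>
  define d where "d = gcd m n"
  have d1: "d \<ge> 1" unfolding d_def using mn by (simp add: Suc_le_eq)
  obtain p q where pq: "m = d * p" "n = d * q" "coprime p q"
    unfolding d_def using mn by (metis gcd_coprime_exists mult.commute not_one_le_zero gcd_eq_0_iff)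
  have pq1: "p \<ge> 1" "q \<ge> 1" using mn pq by (auto simp: Suc_le_eq)
  define H where "H = \<eta> ^ d"
  have one: "1 \<in> ?G" using div[OF \<eta>(1) \<eta>(1)] \<eta>(2) by simp
  have "\<eta> ^ j \<in> ?G" for j
  proof (induction j)
    case (Suc j)
    show ?case using div[OF Suc div[OF one \<eta>(1)]] by (simp add: mult.commute)
  qed (simp add: one)
  then have HG: "H \<in> ?G" unfolding H_def .
  have H1: "H > 1" unfolding H_def using \<eta>(2) d1 by (simp add: one_less_power)
  have EH: "E1 = H ^ p" "E2 = H ^ q" unfolding Em En H_def pq by (simp_all add: power_mult)
  obtain i u u' v v' where h: "conj_pair i u u'" "conj_pair (\<not> i) v v'" "H = u + v * sqrt \<kappa>" "1 / H = u - v * sqrt \<kappa>"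
    "u\<^sup>2 - \<kappa> * v\<^sup>2 = 1" "u'\<^sup>2 - \<kappa>' * v'\<^sup>2 = 1" using rel_unitsE[OF HG less_imp_le[OF k0(1)]] by metis
  have ku: "u\<^sup>2 - (sqrt \<kappa>)\<^sup>2 * v\<^sup>2 = 1" using h(5) k0 by simp
  have T: "H ^ j + 1 / H ^ j = 2 * chebT j u" for j
  proof -
    have "H ^ j = chebT j u + chebU j u * v * sqrt \<kappa>" unfolding h(3) by (rule cheb_power[OF ku])
    moreover have "(1 / H) ^ j = chebT j u + chebU j u * (- v) * sqrt \<kappa>"
      using cheb_power[of u "sqrt \<kappa>" "- v" j] ku unfolding h(4) by simp
    ultimately show ?thesis by (simp add: power_one_over)
  qed
  have inv: "x + y * sqrt \<kappa> > 0 \<Longrightarrow> x\<^sup>2 - \<kappa> * y\<^sup>2 = 1 \<Longrightarrow> (x + y * sqrt \<kappa>) + 1 / (x + y * sqrt \<kappa>) = 2 * x" for x y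
  proof -
    assume p: "x + y * sqrt \<kappa> > 0" and e: "x\<^sup>2 - \<kappa> * y\<^sup>2 = 1"
    have "(x + y * sqrt \<kappa>) * (x - y * sqrt \<kappa>) = x\<^sup>2 - (sqrt \<kappa>)\<^sup>2 * y\<^sup>2" by (simp add: algebra_simps power2_eq_square)
    also have "\<dots> = 1" using e k0 by simp
    finally have "1 / (x + y * sqrt \<kappa>) = x - y * sqrt \<kappa>" using p by (simp add: field_simps)
    then show ?thesis by simp
  qed
  have Tp: "chebT p u = \<alpha>1" using T[of p] inv[of \<alpha>1 "of_int y1"] norm1 E1_gt unfolding EH(1)[symmetric] E1_def by simp
  have Tq: "chebT q u = \<alpha>2" using T[of q] inv[of \<alpha>2 "of_int y2 * g"] norm2 E1_gt unfolding EH(2)[symmetric] E2_def by simp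
  \<comment> \<open>Conjugates are unique in grade \<open>False\<close>, so the comparison is made
    after squaring; this is why units are characterised by a squared norm.\<close>
  have unit: "(chebT j u * chebT j u')\<^sup>2 = 1" if "chebT j u = \<alpha>" "conj_pair True \<alpha> (1 / \<alpha>)" "\<alpha> > 0" for j \<alpha>
  proof -
    have "conj_pair False (\<alpha>\<^sup>2) ((chebT j u')\<^sup>2)" using pair_chebT[OF h(1), of j] that by simp
    from conj_unique[OF sol_nonsquare[OF s1] this pair_square[OF that(2)]]
    have "(chebT j u')\<^sup>2 = (1 / \<alpha>)\<^sup>2" .
    then show ?thesis using that by (simp add: power_mult_distrib power_divide)
  qed
  have "u\<^sup>2 \<noteq> 1"
  proof
    assume "u\<^sup>2 = 1"
    with h(5) k0 have v: "v = 0" by simp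
    with h(3) H1 have "u > 1" by simp
    then have "u\<^sup>2 > 1" by (simp add: one_less_power)
    with \<open>u\<^sup>2 = 1\<close> show False by simp
  qed
  from cheb_units_trivial[OF h(1) this pq(3) pq1 unit[OF Tp su1(1) a1] unit[OF Tq su2(1) a2]]
  have "p = q" by simp
  then have "\<alpha>1 = \<alpha>2" using Tp Tq by simp
  then have "2 * of_int (y1\<^sup>2) * rB = 2 * of_int (y2\<^sup>2) * rB"
    unfolding su1(3)[symmetric] su2(3)[symmetric] by simp
  then have "real_of_int (y1\<^sup>2) = of_int (y2\<^sup>2)" using r_pos by (simp del: of_int_power)
  then have "y1\<^sup>2 = y2\<^sup>2" by (simp only: of_int_eq_iff)
  then show ?thesis using pos by (simp add: power2_eq_iff)
qed

end

section \<open>Pade approximants of binomial series\<close>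

text \<open>Up to a scalar the numerator of the diagonal Pade approximant of
  \<open>(1 + X) ^ \<nu>\<close>; the denominator is the same formula at \<open>- \<nu>\<close>. In
  this scaling only the generalised binomial has a denominator.\<close>

definition pade :: "'a::field_char_0 \<Rightarrow> nat \<Rightarrow> 'a fps" where
  "pade \<nu> r = Abs_fps (\<lambda>k. if k \<le> r then of_nat ((2 * r - k) choose r) * ((of_nat r + \<nu>) gchoose k) else 0)"

text \<open>Closed form of the remainder, which later gives its size coefficient by coefficient. The
  factor \<open>(m - r) choose r\<close> vanishes for \<open>m < 2 * r\<close>, so the series starts
  no earlier than at \<open>X ^ (2 * r + 1)\<close>.\<close>

definition pade_rem :: "'a::field_char_0 \<Rightarrow> nat \<Rightarrow> 'a fps" where
  "pade_rem \<nu> r = Abs_fps (\<lambda>k. case k of 0 \<Rightarrow> 0 | Suc m \<Rightarrow> if r \<le> m then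
     (-1) ^ Suc m * \<nu> * pochhammer (1 + \<nu>) r * pochhammer (1 - \<nu>) (m - r) * of_nat ((m - r) choose r) / fact (Suc m) else 0)"

text \<open>The recurrence is even in \<nu>. Numerators, denominators and remainders therefore all
  satisfy it, and identities between them reduce to the indices 0 and 1.\<close>

definition pade_rec :: "'a::field_char_0 \<Rightarrow> (nat \<Rightarrow> 'a fps) \<Rightarrow> bool" where
  "pade_rec \<nu> f \<longleftrightarrow> (\<forall>s. fps_const (of_nat (s + 2)) * f (s + 2) = fps_const (of_nat (2 * s + 3)) * ((2 + fps_X) * f (s + 1)) -
     fps_const ((of_nat (s + 1) ^ 2 - \<nu> ^ 2) / of_nat (s + 1)) * (fps_X ^ 2 * f s))"

lemma pade_recI:
  assumes "\<And>s. of_nat (s + 2) * fps_nth (f (s + 2)) 0 = of_nat (2 * s + 3) * (2 * fps_nth (f (s + 1)) 0)"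
    and "\<And>s. of_nat (s + 2) * fps_nth (f (s + 2)) 1 = of_nat (2 * s + 3) * (2 * fps_nth (f (s + 1)) 1 + fps_nth (f (s + 1)) 0)"
    and "\<And>s j. of_nat (s + 2) * fps_nth (f (s + 2)) (j + 2) = of_nat (2 * s + 3) * (2 * fps_nth (f (s + 1)) (j + 2) + fps_nth (f (s + 1)) (j + 1))
      - (of_nat (s + 1) ^ 2 - \<nu> ^ 2) / of_nat (s + 1) * fps_nth (f s) j"
  shows "pade_rec \<nu> f"
  unfolding pade_rec_def
proof (intro allI fps_ext)
  fix s k :: nat
  have two: "fps_nth (2 * g) k = 2 * fps_nth g k" for g :: "'a fps" and k
    by (metis fps_mult_left_const_nth numeral_fps_const)
  have "k = 0 \<or> k = 1 \<or> k = (k - 2) + 2" by arith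
  then consider "k = 0" | "k = 1" | j where "k = j + 2" by blast
  then show "fps_nth (fps_const (of_nat (s + 2)) * f (s + 2)) k = fps_nth (fps_const (of_nat (2 * s + 3)) * ((2 + fps_X) * f (s + 1)) -
     fps_const ((of_nat (s + 1) ^ 2 - \<nu> ^ 2) / of_nat (s + 1)) * (fps_X ^ 2 * f s)) k"
  proof cases
    case 1
    then show ?thesis using assms(1)[of s] by (simp add: distrib_right two fps_X_power_mult_nth)
  next
    case 2
    have "fps_nth 2 (Suc 0) = (0 :: 'a)" by (simp add: numeral_fps_const)
    then show ?thesis using 2 assms(2)[of s] by (simp add: distrib_right two fps_X_power_mult_nth)
  next
    case 3
    then show ?thesis using assms(3)[of s j] by (simp add: distrib_right two fps_X_power_mult_nth)
  qed
qed

lemma gbinomial_Suc_shift: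
  fixes a :: "'a::field_char_0"
  shows "(a + 1) gchoose Suc k = (a gchoose k) * (a + 1) / of_nat (Suc k)"
  using gbinomial_absorption'[of "Suc k" "a + 1"] by (simp add: field_simps)

lemma gbinomial_Suc_lower:
  fixes a :: "'a::field_char_0"
  shows "a gchoose Suc k = (a gchoose k) * (a - of_nat k) / of_nat (Suc k)"
  by (simp add: gbinomial_mult_1 gbinomial_prod_rev field_simps)

lemma of_nat_mult_eq_imp_divide:
  "of_nat (Suc k) * x = y \<Longrightarrow> x = y / (of_nat (Suc k) :: 'a::field_char_0)"
  using of_nat_neq_0[of k, where 'a='a] by (auto simp: nonzero_eq_divide_eq mult.commute)

lemma of_nat_binomial_Suc_Suc:
  "(of_nat (Suc n choose Suc k) :: 'a::field_char_0) = of_nat (n choose k) * of_nat (Suc n) / of_nat (Suc k)"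
proof (rule of_nat_mult_eq_imp_divide)
  have "(of_nat (Suc k * (Suc n choose Suc k)) :: 'a) = of_nat (Suc n * (n choose k))"
    by (simp only: Suc_times_binomial_eq mult.commute)
  then show "of_nat (Suc k) * (of_nat (Suc n choose Suc k) :: 'a) = of_nat (n choose k) * of_nat (Suc n)"
    by (simp only: of_nat_mult mult.commute)
qed

lemma of_nat_binomial_Suc_right:
  "(of_nat (n choose Suc k) :: 'a::field_char_0) = of_nat (n choose k) * (of_nat n - of_nat k) / of_nat (Suc k)"
proof (rule of_nat_mult_eq_imp_divide)
  have e: "Suc k * (n choose Suc k) = (n - k) * (n choose k)"
    by (metis binomial_absorb_comp binomial_absorption mult.commute)
  show "of_nat (Suc k) * (of_nat (n choose Suc k) :: 'a) = of_nat (n choose k) * (of_nat n - of_nat k)"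
  proof -
    have "of_nat (Suc k) * (of_nat (n choose Suc k) :: 'a) = of_nat (n - k) * of_nat (n choose k)"
      using arg_cong[OF e, of "of_nat :: nat \<Rightarrow> 'a"] by (simp only: of_nat_mult)
    then show ?thesis by (cases "k \<le> n") (simp_all add: of_nat_diff mult.commute binomial_eq_0 del: of_nat_Suc)
  qed
qed

lemma pade_nth: "k \<le> r \<Longrightarrow> fps_nth (pade \<nu> r) k = of_nat ((2 * r - k) choose r) * ((of_nat r + \<nu>) gchoose k)"
  "r < k \<Longrightarrow> fps_nth (pade \<nu> r) k = 0"
  by (simp_all add: pade_def)

lemma pade_0: "pade \<mu> 0 = 1"
  by (rule fps_ext) (simp add: pade_def)

lemma pade_1: "pade \<mu> 1 = 2 + fps_const (1 + \<mu>) * fps_X"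
proof (rule fps_ext)
  fix k :: nat
  have "k = 0 \<or> k = 1 \<or> k > 1" by arith
  then show "fps_nth (pade \<mu> 1) k = fps_nth (2 + fps_const (1 + \<mu>) * fps_X) k"
    by (auto simp: pade_def numeral_fps_const)
qed

lemma pade_recurrence: "pade_rec \<nu> (pade \<nu>)"
proof (rule pade_recI)
  fix s
  have a: "(2 * (s + 2)) = Suc (Suc (2 * s + 2))" "2 * (s + 1) = 2 * s + 2" by simp_all
  have n: "of_nat (s + 1) \<noteq> (0::'a)" "of_nat (s + 2) \<noteq> (0::'a)" by (metis of_nat_eq_0_iff add_eq_0_iff_both_eq_0 one_neq_zero zero_neq_numeral)+
  have C1: "(of_nat (2 * (s + 2) choose (s + 2)) :: 'a) = of_nat (2 * (s + 1) choose (s + 1)) * (2 * of_nat (2 * s + 3)) / of_nat (s + 2)"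
  proof -
    have "(of_nat (Suc (Suc (2 * s + 2)) choose Suc (Suc s)) :: 'a) = of_nat (Suc (2 * s + 2) choose Suc s) * of_nat (2 * s + 4) / of_nat (s + 2)"
      unfolding of_nat_binomial_Suc_Suc[of "Suc (2 * s + 2)"] by simp
    moreover have "Suc (2 * s + 2) choose Suc s = Suc (2 * s + 2) choose (s + 2)"
      using binomial_symmetric[of "Suc s" "Suc (2 * s + 2)"] by simp
    moreover have "(of_nat (Suc (2 * s + 2) choose Suc (s + 1)) :: 'a) = of_nat (2 * s + 2 choose (s + 1)) * of_nat (2 * s + 3) / of_nat (s + 2)"
      unfolding of_nat_binomial_Suc_Suc by simp
    moreover have "(of_nat (2 * s + 4) :: 'a) = 2 * of_nat (s + 2)" by simp
    moreover have "x * y / z * (2 * z) / z = x * (2 * y) / z" if "z \<noteq> 0" for x y z :: 'a using that by simp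
    ultimately show ?thesis using n(2) unfolding a by (simp only: add_2_eq_Suc' Suc_eq_plus1[symmetric])
  qed
  show "of_nat (s + 2) * fps_nth (pade \<nu> (s + 2)) 0 = of_nat (2 * s + 3) * (2 * fps_nth (pade \<nu> (s + 1)) 0)"
  proof -
    have "fps_nth (pade \<nu> (s + 2)) 0 = of_nat (2 * (s + 2) choose (s + 2))" "fps_nth (pade \<nu> (s + 1)) 0 = of_nat (2 * (s + 1) choose (s + 1))"
      using pade_nth(1)[of 0 "s + 2" \<nu>] pade_nth(1)[of 0 "s + 1" \<nu>] by simp_all
    moreover have "z * (x * (2 * y) / z) = y * (2 * x)" if "z \<noteq> 0" for x y z :: 'a using that by simp
    ultimately show ?thesis using n(2) by (simp only: C1)
  qed
  show "of_nat (s + 2) * fps_nth (pade \<nu> (s + 2)) 1 = of_nat (2 * s + 3) * (2 * fps_nth (pade \<nu> (s + 1)) 1 + fps_nth (pade \<nu> (s + 1)) 0)"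
  proof -
    define u :: 'a where "u = of_nat (2 * s + 1 choose (s + 1))"
    have u1: "(of_nat (Suc (Suc (2 * s)) choose Suc s) :: 'a) = 2 * u"
    proof -
      have "Suc (2 * s) choose s = Suc (2 * s) choose (s + 1)" using binomial_symmetric[of s "Suc (2 * s)"] by simp
      then show ?thesis unfolding u_def by simp
    qed
    have u2: "(of_nat (Suc (2 * s + 2) choose Suc (Suc s)) :: 'a) = 2 * u * of_nat (2 * s + 3) / of_nat (s + 2)"
      unfolding of_nat_binomial_Suc_Suc using u1 by (simp del: binomial_Suc_Suc add: numeral_3_eq_3)
    have "2 * (s + 2) - 1 = Suc (2 * s + 2)" "2 * (s + 1) - 1 = 2 * s + 1" "2 * (s + 1) = Suc (Suc (2 * s))" "s + 2 = Suc (Suc s)" "s + 1 = Suc s"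
      by simp_all
    then have "fps_nth (pade \<nu> (s + 2)) 1 = 2 * u * of_nat (2 * s + 3) / of_nat (s + 2) * (of_nat (s + 2) + \<nu>)"
      "fps_nth (pade \<nu> (s + 1)) 1 = u * (of_nat (s + 1) + \<nu>)" "fps_nth (pade \<nu> (s + 1)) 0 = 2 * u"
      using pade_nth(1)[of 1 "s + 2" \<nu>] pade_nth(1)[of 1 "s + 1" \<nu>] pade_nth(1)[of 0 "s + 1" \<nu>] u1 u2
      by (simp_all add: u_def del: binomial_Suc_Suc)
    moreover have "(of_nat (s + 2) + \<nu>) = 1 + (of_nat (s + 1) + \<nu>)" by simp
    moreover have "z * (2 * u * y / z * (1 + w)) = y * (2 * (u * w) + 2 * u)" if "z \<noteq> 0" for y z w :: 'a
    proof -
      have "z * (2 * u * y / z * (1 + w)) = 2 * u * y * (1 + w)" using that by simp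
      then show ?thesis by (simp only:) (simp add: algebra_simps)
    qed
    ultimately show ?thesis using n(2) by (simp only:)
  qed
next
  fix s j
  show "of_nat (s + 2) * fps_nth (pade \<nu> (s + 2)) (j + 2) =
       of_nat (2 * s + 3) * (2 * fps_nth (pade \<nu> (s + 1)) (j + 2) + fps_nth (pade \<nu> (s + 1)) (j + 1)) -
       ((of_nat (s + 1))\<^sup>2 - \<nu>\<^sup>2) / of_nat (s + 1) * fps_nth (pade \<nu> s) j"
  proof (cases "j \<le> s")
    case True
    then obtain d where s: "s = j + d" using le_Suc_ex by blast
    define u :: 'a where "u = of_nat (j + 2 * d choose s)"
    define G where "G = (of_nat s + \<nu>) gchoose j"
    have n: "of_nat (Suc k) \<noteq> (0::'a)" for k by (rule of_nat_neq_0)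
    have c2: "(of_nat (Suc (Suc (j + 2 * d)) choose Suc (Suc s)) :: 'a) = u * of_nat (Suc (j + 2 * d)) / of_nat (Suc s) * of_nat (Suc (Suc (j + 2 * d))) / of_nat (Suc (Suc s))"
      unfolding of_nat_binomial_Suc_Suc u_def ..
    have c1: "(of_nat (Suc (j + 2 * d) choose Suc s) :: 'a) = u * of_nat (Suc (j + 2 * d)) / of_nat (Suc s)"
      unfolding of_nat_binomial_Suc_Suc u_def ..
    have c0: "(of_nat ((j + 2 * d) choose Suc s) :: 'a) = u * of_nat d / of_nat (Suc s)"
      unfolding of_nat_binomial_Suc_right u_def s by simp
    have g1: "(of_nat (Suc s) + \<nu>) gchoose Suc j = G * (of_nat (Suc s) + \<nu>) / of_nat (Suc j)"
      using gbinomial_Suc_shift[of "of_nat s + \<nu>" j] unfolding G_def by (simp add: algebra_simps)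
    have g2: "(of_nat (Suc (Suc s)) + \<nu>) gchoose Suc (Suc j) = G * (of_nat (Suc s) + \<nu>) / of_nat (Suc j) * (of_nat (Suc (Suc s)) + \<nu>) / of_nat (Suc (Suc j))"
      using gbinomial_Suc_shift[of "of_nat (Suc s) + \<nu>" "Suc j"] unfolding g1 by (simp add: algebra_simps)
    have g3: "(of_nat (Suc s) + \<nu>) gchoose Suc (Suc j) = G * (of_nat (Suc s) + \<nu>) / of_nat (Suc j) * (of_nat d + \<nu>) / of_nat (Suc (Suc j))"
      unfolding gbinomial_Suc_lower[of _ "Suc j"] g1 by (simp add: s)
    have i: "2 * (s + 2) - (j + 2) = Suc (Suc (j + 2 * d))" "2 * (s + 1) - (j + 1) = Suc (j + 2 * d)" "2 * (s + 1) - (j + 2) = j + 2 * d" "2 * s - j = j + 2 * d"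
      unfolding s by simp_all
    have p2: "fps_nth (pade \<nu> (s + 2)) (j + 2) = u * of_nat (Suc (j + 2 * d)) / of_nat (Suc s) * of_nat (Suc (Suc (j + 2 * d))) / of_nat (Suc (Suc s)) *
        (G * (of_nat (Suc s) + \<nu>) / of_nat (Suc j) * (of_nat (Suc (Suc s)) + \<nu>) / of_nat (Suc (Suc j)))"
      using True pade_nth(1)[of "j + 2" "s + 2" \<nu>] unfolding i by (simp only: add_2_eq_Suc' c2 g2)
    have p1: "fps_nth (pade \<nu> (s + 1)) (j + 1) = u * of_nat (Suc (j + 2 * d)) / of_nat (Suc s) * (G * (of_nat (Suc s) + \<nu>) / of_nat (Suc j))"
      using True pade_nth(1)[of "j + 1" "s + 1" \<nu>] unfolding i by (simp only: Suc_eq_plus1[symmetric] c1 g1)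
    have p0: "fps_nth (pade \<nu> (s + 1)) (j + 2) = u * of_nat d / of_nat (Suc s) * (G * (of_nat (Suc s) + \<nu>) / of_nat (Suc j) * (of_nat d + \<nu>) / of_nat (Suc (Suc j)))"
    proof (cases "d = 0")
      case True
      then show ?thesis using pade_nth(2)[of "s + 1" "j + 2" \<nu>] s by simp
    next
      case False
      then have "j + 2 \<le> s + 1" using s by simp
      from pade_nth(1)[OF this, of \<nu>] show ?thesis unfolding i by (simp only: add_2_eq_Suc' Suc_eq_plus1[symmetric] c0 g3)
    qed
    have p: "fps_nth (pade \<nu> s) j = u * G" using pade_nth(1)[OF True, of \<nu>] unfolding i u_def G_def .
    have k: "(of_nat (s + 1))\<^sup>2 - \<nu>\<^sup>2 = (of_nat (Suc s) + \<nu>) * (of_nat (Suc s) - \<nu>)" by (simp add: algebra_simps power2_eq_square)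
    \<comment> \<open>All four coefficients are multiples of \<open>H\<close>; dividing it out
      leaves an identity of rational functions in \<open>J\<close>, \<open>D\<close> and
      \<nu>.\<close>
    define H where "H = u * G * (of_nat (Suc s) + \<nu>) / of_nat (Suc s)"
    define D where "D = (of_nat d :: 'a)" define J where "J = (of_nat j :: 'a)"
    have nz: "1 + J \<noteq> 0" "2 + J \<noteq> 0" using n[of j] n[of "Suc j"] by (simp_all add: J_def)
    have q2: "of_nat (s + 2) * fps_nth (pade \<nu> (s + 2)) (j + 2) = H * ((1 + J + 2 * D) * (2 + J + 2 * D) * (2 + J + D + \<nu>) / ((1 + J) * (2 + J)))"
    proof -
      have e: "of_nat (Suc (j + 2 * d)) = 1 + J + 2 * D" "of_nat (Suc (Suc (j + 2 * d))) = 2 + J + 2 * D"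
        "of_nat (Suc (Suc s)) + \<nu> = 2 + J + D + \<nu>" "of_nat (Suc j) = 1 + J" "of_nat (Suc (Suc j)) = 2 + J"
        by (simp_all add: s J_def D_def)
      have "z * (u * a1 / x * a2 / z * (G * y / j1 * y2 / j2)) = u * G * y / x * (a1 * a2 * y2 / (j1 * j2))" if "z \<noteq> 0" for z a1 x a2 y j1 y2 j2 :: 'a
        using that by (simp add: mult_ac)
      from this[OF n[of "Suc s"]] show ?thesis unfolding p2 H_def unfolding add_2_eq_Suc' e .
    qed
    have q1: "fps_nth (pade \<nu> (s + 1)) (j + 1) = H * ((1 + J + 2 * D) / (1 + J))"
      unfolding p1 H_def by (simp add: s J_def D_def field_simps)
    have q0: "fps_nth (pade \<nu> (s + 1)) (j + 2) = H * (D * (D + \<nu>) / ((1 + J) * (2 + J)))"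
      unfolding p0 H_def by (simp add: s J_def D_def field_simps)
    have q: "((of_nat (s + 1))\<^sup>2 - \<nu>\<^sup>2) / of_nat (s + 1) * fps_nth (pade \<nu> s) j = H * (1 + J + D - \<nu>)"
      unfolding p k H_def by (simp add: s J_def D_def)
    have s23: "(of_nat (2 * s + 3) :: 'a) = 3 + 2 * J + 2 * D" by (simp add: s J_def D_def)
    have "(1 + J + 2 * D) * (2 + J + 2 * D) * (2 + J + D + \<nu>) / ((1 + J) * (2 + J)) =
      (3 + 2 * J + 2 * D) * (2 * (D * (D + \<nu>) / ((1 + J) * (2 + J))) + (1 + J + 2 * D) / (1 + J)) - (1 + J + D - \<nu>)"
      using nz by (simp add: divide_simps) (simp add: algebra_simps)
    then show ?thesis unfolding q2 q1 q0 q s23 by (simp only: right_diff_distrib[symmetric] distrib_left[symmetric] mult.left_commute mult.commute mult.assoc)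
  next
    case False
    then show ?thesis by (simp add: pade_nth)
  qed
qed


lemma pade_rem_nth:
  "fps_nth (pade_rem \<nu> r) 0 = 0"
  "r \<le> m \<Longrightarrow> fps_nth (pade_rem \<nu> r) (Suc m) = (-1) ^ Suc m * \<nu> * pochhammer (1 + \<nu>) r * pochhammer (1 - \<nu>) (m - r) * of_nat ((m - r) choose r) / fact (Suc m)"
  "m < r \<Longrightarrow> fps_nth (pade_rem \<nu> r) (Suc m) = 0"
  by (simp_all add: pade_rem_def)

lemma pade_rem_recurrence: "pade_rec \<nu> (pade_rem \<nu>)"
proof (rule pade_recI)
  fix s
  show "of_nat (s + 2) * fps_nth (pade_rem \<nu> (s + 2)) 0 = of_nat (2 * s + 3) * (2 * fps_nth (pade_rem \<nu> (s + 1)) 0)"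
    by (simp add: pade_rem_nth)
  show "of_nat (s + 2) * fps_nth (pade_rem \<nu> (s + 2)) 1 = of_nat (2 * s + 3) * (2 * fps_nth (pade_rem \<nu> (s + 1)) 1 + fps_nth (pade_rem \<nu> (s + 1)) 0)"
    by (simp add: pade_rem_nth)
next
  fix s j
  show "of_nat (s + 2) * fps_nth (pade_rem \<nu> (s + 2)) (j + 2) =
       of_nat (2 * s + 3) * (2 * fps_nth (pade_rem \<nu> (s + 1)) (j + 2) + fps_nth (pade_rem \<nu> (s + 1)) (j + 1)) -
       ((of_nat (s + 1))\<^sup>2 - \<nu>\<^sup>2) / of_nat (s + 1) * fps_nth (pade_rem \<nu> s) j"
  proof (cases j)
    case 0
    have "fps_nth (pade_rem \<nu> (s + 2)) (Suc 1) = 0" "fps_nth (pade_rem \<nu> (s + 1)) (Suc 0) = 0" "fps_nth (pade_rem \<nu> s) 0 = 0"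
      using pade_rem_nth(3)[of 1 "s + 2" \<nu>] pade_rem_nth(3)[of 0 "s + 1" \<nu>] pade_rem_nth(1)[of \<nu> s] by simp_all
    moreover have "fps_nth (pade_rem \<nu> (s + 1)) (Suc 1) = 0"
    proof (cases "s = 0")
      case True
      then show ?thesis using pade_rem_nth(2)[of 1 1 \<nu>] by simp
    next
      case False
      then show ?thesis using pade_rem_nth(3)[of 1 "s + 1" \<nu>] by simp
    qed
    moreover have "j + 2 = Suc 1" "j + 1 = Suc 0" using 0 by simp_all
    ultimately show ?thesis using 0 by (simp only: mult_zero_right) simp
  next
    case (Suc m)
    show ?thesis
    proof (cases "s \<le> m")
      case False
      then have "fps_nth (pade_rem \<nu> (s + 2)) (j + 2) = 0" "fps_nth (pade_rem \<nu> (s + 1)) (j + 1) = 0" "fps_nth (pade_rem \<nu> s) j = 0"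
        using pade_rem_nth(3)[of _ _ \<nu>] Suc by simp_all
      moreover have "fps_nth (pade_rem \<nu> (s + 1)) (j + 2) = 0"
      proof (cases "s + 1 \<le> m + 2")
        case True
        with False have "s = m + 1" by simp
        then show ?thesis using Suc pade_rem_nth(2)[of "s + 1" "m + 2" \<nu>] by simp
      next
        case False
        then show ?thesis using Suc pade_rem_nth(3)[of "m + 2" "s + 1" \<nu>] by simp
      qed
      ultimately show ?thesis by simp
    next
      case True
      then obtain d where m: "m = s + d" using le_Suc_ex by blast
      define a where "a = (of_nat (d choose s) :: 'a)"
      define S where "S = (of_nat s :: 'a)" define D where "D = (of_nat d :: 'a)"
      define b where "b = a * (D - S) / (1 + S)"
      have nS: "1 + S \<noteq> 0" "2 + S \<noteq> 0" using of_nat_neq_0[of s, where 'a='a] of_nat_neq_0[of "Suc s", where 'a='a] by (simp_all add: S_def)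
      have b: "(of_nat (d choose Suc s) :: 'a) = b" unfolding of_nat_binomial_Suc_right b_def a_def S_def D_def by simp
      have b2: "(of_nat (d choose Suc (Suc s)) :: 'a) = b * (D - S - 1) / (2 + S)"
        unfolding of_nat_binomial_Suc_right[of d "Suc s"] b by (simp add: S_def D_def algebra_simps)
      have b3: "(of_nat (Suc d choose Suc s) :: 'a) = a + b" using b by (simp add: a_def)
      \<comment> \<open>The common factor of all coefficients of the remainders that occur; what
        remains is rational in \<open>S\<close>, \<open>D\<close>, \<nu> and linear in
        \<open>a\<close> and \<open>b\<close>.\<close>
      define W where "W = (-1) ^ Suc m * \<nu> * pochhammer (1 + \<nu>) s * pochhammer (1 - \<nu>) d / (fact (Suc m) :: 'a)"
      have nm: "2 + (S + D) \<noteq> 0" "3 + (S + D) \<noteq> 0" using of_nat_neq_0[of "Suc m", where 'a='a] of_nat_neq_0[of "Suc (Suc m)", where 'a='a]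
        by (simp_all add: S_def D_def m)
      have f2: "(fact (Suc (Suc m)) :: 'a) = (2 + (S + D)) * fact (Suc m)" "(fact (Suc (Suc (Suc m))) :: 'a) = (3 + (S + D)) * ((2 + (S + D)) * fact (Suc m))"
        by (subst fact_Suc, simp add: S_def D_def m)+
      have p1: "pochhammer (1 + \<nu>) (Suc s) = pochhammer (1 + \<nu>) s * (1 + \<nu> + S)" "pochhammer (1 + \<nu>) (Suc (Suc s)) = pochhammer (1 + \<nu>) s * (1 + \<nu> + S) * (2 + \<nu> + S)"
        "pochhammer (1 - \<nu>) (Suc d) = pochhammer (1 - \<nu>) d * (1 - \<nu> + D)" by (simp_all add: pochhammer_Suc S_def D_def algebra_simps)
      have nf: "(fact (Suc m) :: 'a) \<noteq> 0" by (rule fact_nonzero)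
      have i: "Suc (Suc m) - Suc (Suc s) = d" "Suc (Suc m) - Suc s = Suc d" "Suc m - Suc s = d" "m - s = d" unfolding m by simp_all
      have q2: "fps_nth (pade_rem \<nu> (s + 2)) (j + 2) = W * ((1 + \<nu> + S) * (2 + \<nu> + S) * (b * (D - S - 1) / (2 + S)) / ((3 + (S + D)) * (2 + (S + D))))"
        using pade_rem_nth(2)[of "Suc (Suc s)" "Suc (Suc m)" \<nu>] True unfolding Suc i b2 f2 p1 W_def add_2_eq_Suc'
        using nf nm by (simp del: fact_Suc add: divide_simps mult_ac)
      have q1: "fps_nth (pade_rem \<nu> (s + 1)) (j + 2) = W * ((1 + \<nu> + S) * (1 - \<nu> + D) * (a + b) / ((3 + (S + D)) * (2 + (S + D))))"
        using pade_rem_nth(2)[of "Suc s" "Suc (Suc m)" \<nu>] True unfolding Suc i b3 f2 p1 W_def add_2_eq_Suc' Suc_eq_plus1[symmetric]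
        using nf nm by (simp del: fact_Suc add: divide_simps mult_ac)
      have q0: "fps_nth (pade_rem \<nu> (s + 1)) (j + 1) = W * (- ((1 + \<nu> + S) * b / (2 + (S + D))))"
        using pade_rem_nth(2)[of "Suc s" "Suc m" \<nu>] True unfolding Suc i b f2 p1 W_def add_2_eq_Suc' Suc_eq_plus1[symmetric]
        using nf nm by (simp del: fact_Suc add: divide_simps mult_ac)
      have q: "fps_nth (pade_rem \<nu> s) j = W * a"
        using pade_rem_nth(2)[OF True, of \<nu>] unfolding Suc i a_def W_def by (simp del: fact_Suc add: divide_simps mult_ac)
      have k: "((of_nat (s + 1))\<^sup>2 - \<nu>\<^sup>2) / of_nat (s + 1) = (1 + S - \<nu>) * (1 + \<nu> + S) / (1 + S)" by (simp add: S_def algebra_simps power2_eq_square)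
      have c: "(of_nat (s + 2) :: 'a) = 2 + S" "(of_nat (2 * s + 3) :: 'a) = 3 + 2 * S" by (simp_all add: S_def)
      have "(2 + S) * ((1 + \<nu> + S) * (2 + \<nu> + S) * (b * (D - S - 1) / (2 + S)) / ((3 + (S + D)) * (2 + (S + D)))) =
        (3 + 2 * S) * (2 * ((1 + \<nu> + S) * (1 - \<nu> + D) * (a + b) / ((3 + (S + D)) * (2 + (S + D)))) + (- ((1 + \<nu> + S) * b / (2 + (S + D)))))
        - (1 + S - \<nu>) * (1 + \<nu> + S) / (1 + S) * a"
      proof -
        define K where "K = (3 + (S + D)) * (2 + (S + D))"
        have K: "K \<noteq> 0" unfolding K_def using nm by simp
        have ab: "a + b = a * (1 + D) / (1 + S)" unfolding b_def using nS by (simp add: field_simps)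
        have red: "x / (2 + (S + D)) = x * (3 + (S + D)) / K" "x = x * K / K" for x unfolding K_def using nm by simp_all
        have poly: "(2 + \<nu> + S) * ((D - S) * (D - S - 1)) = (3 + 2 * S) * (2 * ((1 - \<nu> + D) * (1 + D)) - (D - S) * (3 + (S + D))) - (1 + S - \<nu>) * K"
          unfolding K_def by (simp add: algebra_simps)
        define E where "E = a * (1 + \<nu> + S) / ((1 + S) * K)"
        have t1: "(2 + S) * ((1 + \<nu> + S) * (2 + \<nu> + S) * (b * (D - S - 1) / (2 + S)) / K) = E * ((2 + \<nu> + S) * ((D - S) * (D - S - 1)))"
          unfolding E_def b_def using nS K by (simp add: divide_simps mult_ac)
        have t2: "(1 + \<nu> + S) * (1 - \<nu> + D) * (a + b) / K = E * ((1 - \<nu> + D) * (1 + D))"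
          unfolding E_def ab using nS K by (simp add: divide_simps mult_ac)
        have t3: "(1 + \<nu> + S) * b / (2 + (S + D)) = E * ((D - S) * (3 + (S + D)))"
          unfolding red(1) unfolding E_def b_def using nS K by (simp add: divide_simps mult_ac)
        have t4: "(1 + S - \<nu>) * (1 + \<nu> + S) / (1 + S) * a = E * ((1 + S - \<nu>) * K)"
          unfolding E_def using nS K by (simp add: divide_simps mult_ac)
        show ?thesis unfolding K_def[symmetric] t1 t2 t3 t4 poly by (simp add: algebra_simps)
      qed
      then have "W * ((2 + S) * ((1 + \<nu> + S) * (2 + \<nu> + S) * (b * (D - S - 1) / (2 + S)) / ((3 + (S + D)) * (2 + (S + D))))) =
        W * ((3 + 2 * S) * (2 * ((1 + \<nu> + S) * (1 - \<nu> + D) * (a + b) / ((3 + (S + D)) * (2 + (S + D)))) + (- ((1 + \<nu> + S) * b / (2 + (S + D)))))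
        - (1 + S - \<nu>) * (1 + \<nu> + S) / (1 + S) * a)" by (simp only:)
      then show ?thesis unfolding q2 q1 q0 q k c
        by (simp only: right_diff_distrib distrib_left mult.left_commute mult.commute mult.assoc)
    qed
  qed
qed


lemma pade_rec_unique:
  assumes "pade_rec \<nu> f" "pade_rec \<nu> g" "f 0 = g 0" "f 1 = g 1"
  shows "f r = g r"
proof (induction r rule: induct_nat_012)
  case (ge2 s)
  have nz: "of_nat (s + 2) \<noteq> (0::'a)" using of_nat_neq_0[of "Suc s", where 'a='a] by simp
  have "fps_const (of_nat (s + 2)) * f (s + 2) = fps_const (of_nat (s + 2)) * g (s + 2)"
    using assms(1,2) ge2 unfolding pade_rec_def by simp
  then have "f (s + 2) = g (s + 2)" using nz by (simp del: of_nat_add)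
  then show ?case by simp
qed (use assms in simp_all)

text \<open>The recurrence is linear, so multiplication by the binomial series preserves it; only
  \<open>r = 0\<close> and \<open>r = 1\<close> have to be compared coefficientwise.\<close>

theorem pade_remainder: "pade_rem \<nu> r = pade \<nu> r - fps_binomial \<nu> * pade (- \<nu>) r"
proof (rule pade_rec_unique[OF pade_rem_recurrence])
  have "pade_rec (- \<nu>) (pade (- \<nu>))" by (rule pade_recurrence)
  then have r: "pade_rec \<nu> (pade (- \<nu>))" unfolding pade_rec_def by simp
  show "pade_rec \<nu> (\<lambda>r. pade \<nu> r - fps_binomial \<nu> * pade (- \<nu>) r)"
    unfolding pade_rec_def
  proof
    fix s
    let ?a = "fps_const (of_nat (s + 2)) :: 'a fps" and ?b = "fps_const (of_nat (2 * s + 3)) :: 'a fps"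
      and ?k = "fps_const ((of_nat (s + 1) ^ 2 - \<nu> ^ 2) / of_nat (s + 1)) :: 'a fps"
    have "?a * (pade \<nu> (s + 2) - fps_binomial \<nu> * pade (- \<nu>) (s + 2)) =
      ?a * pade \<nu> (s + 2) - fps_binomial \<nu> * (?a * pade (- \<nu>) (s + 2))" by (simp only: right_diff_distrib mult.left_commute)
    also have "?a * pade \<nu> (s + 2) = ?b * ((2 + fps_X) * pade \<nu> (s + 1)) - ?k * (fps_X ^ 2 * pade \<nu> s)"
      using pade_recurrence[of \<nu>] unfolding pade_rec_def by blast
    also have "?a * pade (- \<nu>) (s + 2) = ?b * ((2 + fps_X) * pade (- \<nu>) (s + 1)) - ?k * (fps_X ^ 2 * pade (- \<nu>) s)"
      using r unfolding pade_rec_def by blast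
    finally show "?a * (pade \<nu> (s + 2) - fps_binomial \<nu> * pade (- \<nu>) (s + 2)) =
      ?b * ((2 + fps_X) * (pade \<nu> (s + 1) - fps_binomial \<nu> * pade (- \<nu>) (s + 1))) -
      ?k * (fps_X ^ 2 * (pade \<nu> s - fps_binomial \<nu> * pade (- \<nu>) s))"
      by (simp only: right_diff_distrib mult.left_commute mult.assoc) (simp only: diff_diff_eq2 diff_diff_eq add.commute add.left_commute algebra_simps)
  qed
  have R0: "pade_rem \<nu> 0 = 1 - fps_binomial \<nu>"
  proof (rule fps_ext)
    fix k :: nat
    show "fps_nth (pade_rem \<nu> 0) k = fps_nth (1 - fps_binomial \<nu>) k"
    proof (cases k)
      case (Suc m)
      have "\<nu> gchoose Suc m = (-1) ^ Suc m * (- \<nu> * pochhammer (1 - \<nu>) m) / fact (Suc m)"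
        unfolding gbinomial_pochhammer by (simp only: pochhammer_rec) (simp add: add.commute)
      then show ?thesis using Suc pade_rem_nth(2)[of 0 m \<nu>] by (simp del: fact_Suc)
    qed (simp add: pade_rem_nth)
  qed
  then show "pade_rem \<nu> 0 = pade \<nu> 0 - fps_binomial \<nu> * pade (- \<nu>) 0" by (simp add: pade_0)
  have "pade_rem \<nu> 1 = fps_const (2 * \<nu>) * fps_X + (2 + fps_const (1 - \<nu>) * fps_X) * pade_rem \<nu> 0"
  proof (rule fps_ext)
    fix k :: nat
    have two: "fps_nth (2 * g) k = 2 * fps_nth g k" for g :: "'a fps" and k
      by (metis fps_mult_left_const_nth numeral_fps_const)
    have e: "fps_nth (fps_const (2 * \<nu>) * fps_X + (2 + fps_const (1 - \<nu>) * fps_X) * pade_rem \<nu> 0) k =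
      (if k = 1 then 2 * \<nu> else 0) + 2 * fps_nth (pade_rem \<nu> 0) k + (1 - \<nu>) * (if k = 0 then 0 else fps_nth (pade_rem \<nu> 0) (k - 1))"
      by (simp add: distrib_right two mult.assoc)
    have "k = 0 \<or> k = 1 \<or> k = Suc (Suc (k - 2))" by arith
    then consider "k = 0" | "k = 1" | m where "k = Suc (Suc m)" by blast
    then show "fps_nth (pade_rem \<nu> 1) k = fps_nth (fps_const (2 * \<nu>) * fps_X + (2 + fps_const (1 - \<nu>) * fps_X) * pade_rem \<nu> 0) k"
    proof cases
      case 1
      then show ?thesis unfolding e by (simp add: pade_rem_nth)
    next
      case 2
      have "fps_nth (pade_rem \<nu> 0) (Suc 0) = - \<nu>" "fps_nth (pade_rem \<nu> 1) (Suc 0) = 0" "fps_nth (pade_rem \<nu> 0) 0 = 0"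
        using pade_rem_nth(2)[of 0 0 \<nu>] pade_rem_nth(3)[of 0 1 \<nu>] pade_rem_nth(1) by simp_all
      then show ?thesis unfolding e using 2 by simp
    next
      case 3
      define W where "W = (-1) ^ m * \<nu> * pochhammer (1 - \<nu>) m / fact (Suc (Suc m))"
      have nz: "1 + of_nat (Suc m) \<noteq> (0::'a)" "2 + of_nat m \<noteq> (0::'a)" using of_nat_neq_0[of "Suc m", where 'a='a] by simp_all
      have f: "fact (Suc (Suc m)) = (2 + of_nat m) * (fact (Suc m) :: 'a)" by (subst fact_Suc) simp
      have nf: "(fact (Suc m) :: 'a) \<noteq> 0" by (rule fact_nonzero)
      have A: "fps_nth (pade_rem \<nu> 0) k = W * (1 - \<nu> + of_nat m)"
        using pade_rem_nth(2)[of 0 "Suc m" \<nu>] 3 by (simp add: W_def pochhammer_Suc del: fact_Suc)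
      have B: "fps_nth (pade_rem \<nu> 0) (k - 1) = - W * (2 + of_nat m)"
        using pade_rem_nth(2)[of 0 m \<nu>] 3 nz nf unfolding W_def f by (simp del: fact_Suc)
      have C: "fps_nth (pade_rem \<nu> 1) k = W * ((1 + \<nu>) * of_nat m)"
        using pade_rem_nth(2)[of 1 "Suc m" \<nu>] 3 by (simp add: W_def del: fact_Suc)
      have "(if k = 1 then 2 * \<nu> else 0) = 0" "(if k = 0 then 0 else - W * (2 + of_nat m)) = - W * (2 + of_nat m)" using 3 by simp_all
      then show ?thesis unfolding e A B C by (simp only:) (simp add: algebra_simps)
    qed
  qed
  also have "\<dots> = pade \<nu> 1 - fps_binomial \<nu> * pade (- \<nu>) 1"
  proof -
    have "fps_const (2 * \<nu>) = (fps_const (1 + \<nu>) - fps_const (1 - \<nu>) :: 'a fps)" by simp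
    then show ?thesis unfolding R0 pade_1 by (simp add: algebra_simps)
  qed
  finally show "pade_rem \<nu> 1 = pade \<nu> 1 - fps_binomial \<nu> * pade (- \<nu>) 1" .
qed

section \<open>Values of the approximants at complex points\<close>

definition pade_poly :: "'a::field_char_0 \<Rightarrow> nat \<Rightarrow> 'a poly" where
  "pade_poly \<nu> r = (\<Sum>k\<le>r. Polynomial.monom (of_nat ((2 * r - k) choose r) * ((of_nat r + \<nu>) gchoose k)) k)"

lemma pade_eq_poly: "pade \<nu> r = fps_of_poly (pade_poly \<nu> r)"
  by (rule fps_ext) (simp add: pade_def pade_poly_def coeff_sum)

lemma poly_pade_poly: "poly (pade_poly \<nu> r) z = (\<Sum>k\<le>r. of_nat ((2 * r - k) choose r) * ((of_nat r + \<nu>) gchoose k) * z ^ k)"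
  by (simp add: pade_poly_def poly_sum poly_monom)

lemma eval_pade_rem:
  fixes z \<nu> :: complex
  assumes "norm z < 1"
  shows "eval_fps (pade_rem \<nu> r) z = poly (pade_poly \<nu> r) z - (1 + z) powr \<nu> * poly (pade_poly (- \<nu>) r) z"
    "ereal (norm z) < fps_conv_radius (pade_rem \<nu> r)"
proof -
  have b: "ereal (norm z) < fps_conv_radius (fps_binomial \<nu>)"
    using assms by (auto simp: fps_conv_radius_binomial)
  have m: "ereal (norm z) < fps_conv_radius (fps_binomial \<nu> * pade (- \<nu>) r)"
    using fps_conv_radius_mult[of "fps_binomial \<nu>" "pade (- \<nu>) r"] b unfolding pade_eq_poly
    by (simp add: order_less_le_trans)
  show "eval_fps (pade_rem \<nu> r) z = poly (pade_poly \<nu> r) z - (1 + z) powr \<nu> * poly (pade_poly (- \<nu>) r) z"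
    unfolding pade_remainder using assms b m
    by (simp add: eval_fps_diff eval_fps_mult eval_fps_binomial pade_eq_poly)
  show "ereal (norm z) < fps_conv_radius (pade_rem \<nu> r)"
    unfolding pade_remainder
    using fps_conv_radius_diff[of "pade \<nu> r" "fps_binomial \<nu> * pade (- \<nu>) r"] m unfolding pade_eq_poly
    by (simp add: order_less_le_trans)
qed

text \<open>Each step of the recurrence multiplies the determinant by \<open>X ^ 2\<close> and the
  scalar \<open>((r + 1)\<^sup>2 - \<nu>\<^sup>2) / ((r + 1) * (r + 2))\<close>, which is nonzero by
  the second assumption; the start is \<open>2 * \<nu> * X\<close>.\<close>

lemma pade_det_fps:
  fixes \<nu> :: "'a::field_char_0"
  assumes "\<nu> \<noteq> 0" "\<And>s. of_nat (Suc s) ^ 2 \<noteq> \<nu> ^ 2"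
  shows "\<exists>c. c \<noteq> 0 \<and> pade \<nu> (Suc r) * pade (- \<nu>) r - pade \<nu> r * pade (- \<nu>) (Suc r) = fps_const c * fps_X ^ (2 * r + 1)"
proof (induction r)
  case 0
  have "fps_const (2 * \<nu>) = (fps_const (1 + \<nu>) - fps_const (1 - \<nu>) :: 'a fps)" by simp
  then have "pade \<nu> (Suc 0) * pade (- \<nu>) 0 - pade \<nu> 0 * pade (- \<nu>) (Suc 0) = fps_const (2 * \<nu>) * fps_X ^ (2 * 0 + 1)"
    unfolding pade_0 pade_1[unfolded One_nat_def] by (simp add: algebra_simps)
  then show ?case using assms(1) by (intro exI[of _ "2 * \<nu>"]) simp
next
  case (Suc r)
  then obtain c where c: "c \<noteq> 0" "pade \<nu> (Suc r) * pade (- \<nu>) r - pade \<nu> r * pade (- \<nu>) (Suc r) = fps_const c * fps_X ^ (2 * r + 1)" by blast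
  define P where "P = pade \<nu>" define Q where "Q = pade (- \<nu>)"
  define a where "a = (of_nat (r + 2) :: 'a)" define k where "k = (of_nat (r + 1) ^ 2 - \<nu> ^ 2) / of_nat (r + 1)"
  define B where "B = fps_const (of_nat (2 * r + 3)) * (2 + fps_X :: 'a fps)"
  have a0: "a \<noteq> 0" unfolding a_def using of_nat_neq_0[of "Suc r", where 'a='a] by simp
  have k0: "k \<noteq> 0" unfolding k_def using assms(2)[of r] of_nat_neq_0[of r, where 'a='a] by simp
  have rec: "fps_const a * P (r + 2) = B * P (r + 1) - fps_const k * (fps_X ^ 2 * P r)"
    "fps_const a * Q (r + 2) = B * Q (r + 1) - fps_const k * (fps_X ^ 2 * Q r)"
    using pade_recurrence[of \<nu>] pade_recurrence[of "- \<nu>"] unfolding pade_rec_def P_def Q_def a_def B_def k_def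
    by (auto simp: mult.assoc)
  have "fps_const a * (P (r + 2) * Q (r + 1) - P (r + 1) * Q (r + 2)) = (fps_const a * P (r + 2)) * Q (r + 1) - P (r + 1) * (fps_const a * Q (r + 2))"
    by (simp add: algebra_simps)
  also have "\<dots> = fps_const k * fps_X ^ 2 * (P (r + 1) * Q r - P r * Q (r + 1))" unfolding rec by (simp add: algebra_simps)
  also have "P (r + 1) * Q r - P r * Q (r + 1) = fps_const c * fps_X ^ (2 * r + 1)" using c(2) by (simp add: P_def Q_def)
  finally have e: "fps_const a * (P (r + 2) * Q (r + 1) - P (r + 1) * Q (r + 2)) = fps_const (k * c) * fps_X ^ (2 * r + 3)"
    by (simp add: power_add mult_ac power2_eq_square eval_nat_numeral fps_const_mult[symmetric] del: fps_const_mult)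
  have "P (r + 2) * Q (r + 1) - P (r + 1) * Q (r + 2) = fps_const (1 / a) * (fps_const a * (P (r + 2) * Q (r + 1) - P (r + 1) * Q (r + 2)))"
    using a0 by (simp add: mult.assoc[symmetric])
  also have "\<dots> = fps_const (k * c / a) * fps_X ^ (2 * r + 3)" unfolding e by (simp add: mult.assoc[symmetric])
  finally show ?case using a0 k0 c(1) unfolding P_def Q_def by (intro exI[of _ "k * c / a"]) (simp add: eval_nat_numeral)
qed

text \<open>Consecutive approximants differ at every nonzero point, so a given ratio cannot coincide
  with both of them.\<close>

lemma pade_det:
  fixes \<nu> :: "'a::field_char_0"
  assumes "\<nu> \<noteq> 0" "\<And>s. of_nat (Suc s) ^ 2 \<noteq> \<nu> ^ 2" "z \<noteq> 0"
  shows "poly (pade_poly \<nu> (Suc r)) z * poly (pade_poly (- \<nu>) r) z \<noteq> poly (pade_poly \<nu> r) z * poly (pade_poly (- \<nu>) (Suc r)) z"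
proof -
  obtain c where c: "c \<noteq> 0" "pade \<nu> (Suc r) * pade (- \<nu>) r - pade \<nu> r * pade (- \<nu>) (Suc r) = fps_const c * fps_X ^ (2 * r + 1)"
    using pade_det_fps[OF assms(1,2), of r] by blast
  have "fps_of_poly (pade_poly \<nu> (Suc r) * pade_poly (- \<nu>) r - pade_poly \<nu> r * pade_poly (- \<nu>) (Suc r)) = fps_of_poly (Polynomial.monom c (2 * r + 1))"
    using c(2) unfolding pade_eq_poly by (simp add: fps_of_poly_mult fps_of_poly_diff fps_of_poly_monom)
  then have "pade_poly \<nu> (Suc r) * pade_poly (- \<nu>) r - pade_poly \<nu> r * pade_poly (- \<nu>) (Suc r) = Polynomial.monom c (2 * r + 1)"
    by (simp only: fps_of_poly_eq_iff)
  from arg_cong[OF this, of "\<lambda>p. poly p z"]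
  have e: "poly (pade_poly \<nu> (Suc r)) z * poly (pade_poly (- \<nu>) r) z - poly (pade_poly \<nu> r) z * poly (pade_poly (- \<nu>) (Suc r)) z = c * z ^ (2 * r + 1)"
    by (simp only: poly_diff poly_mult poly_monom)
  have "c * z ^ (2 * r + 1) \<noteq> 0" using c(1) assms(3) by simp
  then show ?thesis unfolding e[symmetric] by simp
qed

text \<open>At \<open>j = 0\<close>, raising \<open>r\<close> by 1 multiplies the left side by at
  most 1/4; raising \<open>j\<close> by 1 multiplies it by at most 1.\<close>

lemma pochhammer_quarter_bound:
  "pochhammer (5 / 4 :: real) r * pochhammer (3 / 4) (r + j) / fact (2 * r + 1 + j) \<le> (1 / 4) ^ r"
proof (induction j)
  case 0
  show ?case
  proof (induction r)
    case (Suc r)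
    have f: "(fact (2 * Suc r + 1) :: real) = (2 * of_nat r + 3) * (2 * of_nat r + 2) * fact (2 * r + 1)"
      by (simp add: algebra_simps)
    have "pochhammer (5 / 4 :: real) (Suc r) * pochhammer (3 / 4) (Suc r + 0) / fact (2 * Suc r + 1 + 0)
       = (pochhammer (5 / 4 :: real) r * pochhammer (3 / 4) r / fact (2 * r + 1)) * ((5 / 4 + real r) * (3 / 4 + real r) / ((2 * real r + 3) * (2 * real r + 2)))"
    proof -
      have "a * b * (c * d) / (x * y * z) = a * c / z * (b * d / (x * y))" for a b c d x y z :: real
        by (simp add: mult_ac)
      then show ?thesis unfolding add_0_right f pochhammer_Suc .
    qed
    also have "\<dots> \<le> (1 / 4) ^ r * (1 / 4)"
    proof (rule mult_mono)
      show "pochhammer (5 / 4 :: real) r * pochhammer (3 / 4) r / fact (2 * r + 1) \<le> (1 / 4) ^ r" using Suc by simp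
      have "4 * ((5 / 4 + real r) * (3 / 4 + real r)) \<le> (2 * real r + 3) * (2 * real r + 2)" by (simp add: algebra_simps)
      then show "(5 / 4 + real r) * (3 / 4 + real r) / ((2 * real r + 3) * (2 * real r + 2)) \<le> 1 / 4"
        by (simp add: divide_le_eq)
    qed simp_all
    finally show ?case by (simp add: mult.commute)
  qed simp
next
  case (Suc j)
  have "pochhammer (5 / 4 :: real) r * pochhammer (3 / 4) (r + Suc j) / fact (2 * r + 1 + Suc j)
     = (pochhammer (5 / 4 :: real) r * pochhammer (3 / 4) (r + j) / fact (2 * r + 1 + j)) * ((3 / 4 + real (r + j)) / (2 * real r + 2 + real j))"
    by (simp add: pochhammer_Suc algebra_simps)
  also have "\<dots> \<le> (1 / 4) ^ r * 1"
    using Suc by (intro mult_mono) (simp_all add: pochhammer_nonneg)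
  finally show ?case by simp
qed

lemma pochhammer_of_real: "pochhammer (of_real x :: complex) n = of_real (pochhammer x n)"
  by (induction n) (simp_all add: pochhammer_Suc)

text \<open>The binomial is at most \<open>2 ^ (r + j)\<close>. Writing the result with
  \<open>2 ^ n\<close> lets a geometric series of ratio \<open>2 * norm z\<close> dominate the
  remainder.\<close>

lemma norm_pade_rem_nth:
  assumes "n \<ge> 2 * r + 1"
  shows "norm (fps_nth (pade_rem (1 / 4 :: complex) r) n) \<le> (1 / 8) * (1 / 8) ^ r * 2 ^ n"
proof -
  obtain j where n: "n = 2 * r + 1 + j" using assms le_Suc_ex by blast
  have p: "pochhammer (1 + 1 / 4 :: complex) r = of_real (pochhammer (5 / 4) r)" "pochhammer (1 - 1 / 4 :: complex) (r + j) = of_real (pochhammer (3 / 4) (r + j))"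
    unfolding pochhammer_of_real[symmetric] by simp_all
  have "fps_nth (pade_rem (1 / 4 :: complex) r) (Suc (2 * r + j)) = (-1) ^ Suc (2 * r + j) * (1 / 4) * of_real (pochhammer (5 / 4) r) * of_real (pochhammer (3 / 4) (r + j)) *
      of_nat ((r + j) choose r) / fact (Suc (2 * r + j))"
    using pade_rem_nth(2)[of r "2 * r + j" "1 / 4 :: complex"] unfolding p[symmetric] by (simp del: fact_Suc)
  then have "norm (fps_nth (pade_rem (1 / 4 :: complex) r) n) = (1 / 4) * (pochhammer (5 / 4) r * pochhammer (3 / 4) (r + j) / fact (2 * r + 1 + j)) * real ((r + j) choose r)"
    unfolding n by (simp add: norm_mult norm_divide norm_power pochhammer_nonneg norm_fact del: fact_Suc)
  also have "\<dots> \<le> (1 / 4) * (1 / 4) ^ r * 2 ^ (r + j)"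
  proof (intro mult_mono pochhammer_quarter_bound)
    have "(r + j) choose r \<le> 2 ^ (r + j)" by (rule binomial_le_pow2)
    then show "real ((r + j) choose r) \<le> 2 ^ (r + j)" by (metis of_nat_le_iff of_nat_numeral of_nat_power)
  qed (simp_all add: pochhammer_nonneg)
  also have "\<dots> = (1 / 8) * (1 / 8) ^ r * 2 ^ n"
  proof -
    have "(1 / 4 :: real) ^ r = (1 / 8) ^ r * 2 ^ r" "(2 :: real) ^ r * 2 ^ r = 4 ^ r" by (simp_all add: power_mult_distrib[symmetric])
    then show ?thesis unfolding n by (simp add: power_add power_mult power2_eq_square power_mult_distrib)
  qed
  finally show ?thesis .
qed

lemma norm_eval_pade_rem:
  fixes z :: complex
  assumes z: "norm z < 1 / 2"
  shows "norm (eval_fps (pade_rem (1 / 4) r) z) \<le> norm z / (4 * (1 - 2 * norm z)) * ((norm z)\<^sup>2 / 2) ^ r"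
proof -
  define f where "f n = fps_nth (pade_rem (1 / 4 :: complex) r) n * z ^ n" for n
  define g where "g n = (1 / 8) * (1 / 8) ^ r * (2 * norm z) ^ (2 * r + 1) * (2 * norm z) ^ n" for n
  have "summable f" unfolding f_def using eval_pade_rem(2)[of z "1 / 4" r] z by (intro summable_fps) simp
  have zero: "f n = 0" if "n < 2 * r + 1" for n
  proof (cases n)
    case (Suc m)
    then show ?thesis using that pade_rem_nth(2)[of r m "1 / 4 :: complex"] pade_rem_nth(3)[of m r "1 / 4 :: complex"]
      by (cases "r \<le> m") (simp_all add: f_def binomial_eq_0 del: fact_Suc)
  qed (simp add: f_def pade_rem_nth)
  have "eval_fps (pade_rem (1 / 4) r) z = suminf f" unfolding eval_fps_def f_def ..
  also have "\<dots> = (\<Sum>n. f (n + (2 * r + 1))) + (\<Sum>n<2 * r + 1. f n)"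
    by (rule suminf_split_initial_segment[OF \<open>summable f\<close>])
  also have "(\<Sum>n<2 * r + 1. f n) = 0" using zero by (intro sum.neutral) simp
  finally have e: "eval_fps (pade_rem (1 / 4) r) z = (\<Sum>n. f (n + (2 * r + 1)))" by simp
  have "(\<lambda>n. (2 * norm z) ^ n) sums (1 / (1 - 2 * norm z))" by (rule geometric_sums) (use z in simp)
  from sums_mult[OF this, of "(1 / 8) * (1 / 8) ^ r * (2 * norm z) ^ (2 * r + 1)"]
  have gs: "g sums ((1 / 8) * (1 / 8) ^ r * (2 * norm z) ^ (2 * r + 1) * (1 / (1 - 2 * norm z)))" unfolding g_def by simp
  have "norm (f (n + (2 * r + 1))) \<le> g n" for n
  proof -
    have "norm (f (n + (2 * r + 1))) \<le> ((1 / 8) * (1 / 8) ^ r * 2 ^ (n + (2 * r + 1))) * norm z ^ (n + (2 * r + 1))"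
      unfolding f_def norm_mult norm_power by (intro mult_right_mono norm_pade_rem_nth) simp_all
    also have "\<dots> = g n" unfolding g_def by (simp add: power_add power_mult_distrib)
    finally show ?thesis .
  qed
  then have "norm (eval_fps (pade_rem (1 / 4) r) z) \<le> suminf g"
    unfolding e using gs by (intro norm_suminf_le) (auto simp: sums_iff)
  also have "\<dots> = (1 / 8) * (1 / 8) ^ r * (2 * norm z) ^ (2 * r + 1) * (1 / (1 - 2 * norm z))" using gs by (simp add: sums_iff)
  also have "\<dots> = norm z / (4 * (1 - 2 * norm z)) * ((norm z)\<^sup>2 / 2) ^ r"
  proof -
    have "(1 / 8) ^ r * (2 * norm z) ^ (2 * r + 1) = ((1 / 8) * (2 * norm z)\<^sup>2) ^ r * (2 * norm z)"
      by (simp only: power_mult_distrib[of "1 / 8"] power_add power_mult power_one_right mult.assoc)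
    also have "(1 / 8) * (2 * norm z)\<^sup>2 = (norm z)\<^sup>2 / 2" by (simp add: power2_eq_square)
    finally have e: "(1 / 8) ^ r * (2 * norm z) ^ (2 * r + 1) = ((norm z)\<^sup>2 / 2) ^ r * (2 * norm z)" .
    have "(1 / 8) * (1 / 8) ^ r * (2 * norm z) ^ (2 * r + 1) * (1 / (1 - 2 * norm z)) = (1 / 8) * ((1 / 8) ^ r * (2 * norm z) ^ (2 * r + 1)) * (1 / (1 - 2 * norm z))"
      by (simp only: mult.assoc)
    also have "\<dots> = norm z / (4 * (1 - 2 * norm z)) * ((norm z)\<^sup>2 / 2) ^ r" unfolding e by simp
    finally show ?thesis .
  qed
  finally show ?thesis .
qed

text \<open>For \<open>i < k \<le> r\<close> the number \<open>r - 1 / 4 - i\<close> lies between 0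
  and \<open>r - i\<close>, so the generalised binomial is at most \<open>r choose k\<close>. With
  \<open>4 ^ r\<close> for the other binomial, the binomial theorem sums the bounds.\<close>

lemma norm_pade_denominator:
  fixes z :: complex
  shows "norm (poly (pade_poly (- (1 / 4)) r) z) \<le> (4 * (1 + norm z)) ^ r"
proof -
  have c: "norm ((of_nat r + - (1 / 4) :: complex) gchoose k) \<le> real (r choose k)" if "k \<le> r" for k
  proof -
    have "norm ((of_nat r + - (1 / 4) :: complex) gchoose k) = (\<Prod>i = 0..<k. norm (of_nat r + - (1 / 4) - of_nat i :: complex)) / fact k"
      by (simp add: gbinomial_prod_rev norm_divide prod_norm norm_fact)
    also have "\<dots> \<le> (\<Prod>i = 0..<k. real r - real i) / fact k"
    proof (intro divide_right_mono prod_mono conjI)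
      fix i assume "i \<in> {0..<k}"
      then have "real i + 1 \<le> real r" using that by auto
      moreover have "(of_nat r + - (1 / 4) - of_nat i :: complex) = of_real (real r - 1 / 4 - real i)" by simp
      ultimately show "norm (of_nat r + - (1 / 4) - of_nat i :: complex) \<le> real r - real i" by (simp only: norm_of_real)
    qed simp_all
    also have "\<dots> = real (r choose k)" by (simp add: binomial_gbinomial gbinomial_prod_rev)
    finally show ?thesis .
  qed
  have "norm (poly (pade_poly (- (1 / 4)) r) z) \<le> (\<Sum>k\<le>r. norm (of_nat ((2 * r - k) choose r) * ((of_nat r + - (1 / 4)) gchoose k) * z ^ k))"
    unfolding poly_pade_poly by (rule norm_sum)
  also have "\<dots> \<le> (\<Sum>k\<le>r. 4 ^ r * (real (r choose k) * norm z ^ k))"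
  proof (rule sum_mono)
    fix k assume k: "k \<in> {..r}"
    have "(2 * r - k) choose r \<le> 2 ^ (2 * r - k)" by (rule binomial_le_pow2)
    also have "\<dots> \<le> (2 :: nat) ^ (2 * r)" by (intro power_increasing) simp_all
    finally have "(2 * r - k) choose r \<le> 4 ^ r" by (simp add: power_mult)
    then have "real ((2 * r - k) choose r) \<le> 4 ^ r" by (metis of_nat_le_iff of_nat_numeral of_nat_power)
    then show "norm (of_nat ((2 * r - k) choose r) * ((of_nat r + - (1 / 4)) gchoose k) * z ^ k) \<le> 4 ^ r * (real (r choose k) * norm z ^ k)"
      using c[of k] k unfolding norm_mult norm_power mult.assoc by (intro mult_mono) simp_all
  qed
  also have "\<dots> = 4 ^ r * (norm z + 1) ^ r"
    unfolding binomial_ring by (simp add: sum_distrib_left)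
  finally show ?thesis by (simp only: power_mult_distrib add.commute)
qed

section \<open>Ljunggren's equation\<close>

lemma fact_double: "\<exists>m. odd m \<and> (fact (2 * k) :: int) = 2 ^ k * fact k * m"
proof (induction k)
  case (Suc k)
  then obtain m where m: "odd m" "(fact (2 * k) :: int) = 2 ^ k * fact k * m" by blast
  have "(fact (2 * Suc k) :: int) = (2 * int k + 2) * (2 * int k + 1) * fact (2 * k)" by (simp add: algebra_simps)
  also have "\<dots> = 2 ^ Suc k * fact (Suc k) * ((2 * int k + 1) * m)" unfolding m(2) by (simp add: algebra_simps)
  finally show ?case using m(1) by (intro exI[of _ "(2 * int k + 1) * m"]) simp
qed simp

text \<open>The bound on the exponent of 2 comes from halving the index with
  \<open>fact_double\<close>. It allows \<open>2 ^ k\<close> to absorb the even part of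
  \<open>k!\<close>.\<close>

lemma fact_odd_part: "\<exists>e m. odd m \<and> m > 0 \<and> e \<le> k \<and> (fact k :: int) = 2 ^ e * m"
proof (induction k rule: less_induct)
  case (less k)
  show ?case
  proof (cases "k = 0")
    case True
    then show ?thesis by (intro exI[of _ 0] exI[of _ 1]) simp
  next
    case False
    define j where "j = k div 2"
    have j: "j < k" using False unfolding j_def by simp
    from less[OF j] obtain e m where e: "odd m" "m > 0" "e \<le> j" "(fact j :: int) = 2 ^ e * m" by blast
    obtain m' where m': "odd m'" "(fact (2 * j) :: int) = 2 ^ j * fact j * m'" using fact_double by blast
    have f: "(fact (2 * j) :: int) = 2 ^ (j + e) * (m * m')" unfolding m' e by (simp add: power_add)
    have "(fact (2 * j) :: int) > 0" by (rule fact_gt_zero)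
    then have "m * m' > 0" unfolding f by (simp add: zero_less_mult_iff)
    show ?thesis
    proof (cases "even k")
      case True
      then have "k = 2 * j" unfolding j_def by simp
      then show ?thesis using f e m' \<open>m * m' > 0\<close> by (intro exI[of _ "j + e"] exI[of _ "m * m'"]) simp
    next
      case False
      then have k: "k = Suc (2 * j)" unfolding j_def by presburger
      have "(fact k :: int) = 2 ^ (j + e) * ((2 * int j + 1) * (m * m'))" unfolding k fact_Suc f by (simp add: algebra_simps)
      then show ?thesis using e m' \<open>m * m' > 0\<close> k by (intro exI[of _ "j + e"] exI[of _ "(2 * int j + 1) * (m * m')"]) simp
    qed
  qed
qed

lemma fact_dvd_falling_product: "(fact k :: int) dvd (\<Prod>i<k. int N - int i)"
proof -
  have "real (N choose k) = (\<Prod>i<k. real N - real i) / fact k"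
    by (simp add: binomial_gbinomial gbinomial_prod_rev atLeast0LessThan)
  then have "real_of_int (fact k * int (N choose k)) = real_of_int (\<Prod>i<k. int N - int i)" by simp
  then have "fact k * int (N choose k) = (\<Prod>i<k. int N - int i)" by (simp only: of_int_eq_iff)
  then show ?thesis by (metis dvd_triv_left)
qed

text \<open>Since 4 is invertible modulo the odd part of \<open>k!\<close>, that part divides \<open>n (n - 4) \<dots> (n - 4 (k - 1))\<close>
  as it divides a product of consecutive integers.\<close>

lemma fact_dvd_quarter_product: "(fact k :: int) dvd 2 ^ k * (\<Prod>i<k. n - 4 * int i)"
proof -
  obtain e m where em: "odd m" "m > 0" "e \<le> k" "(fact k :: int) = 2 ^ e * m" using fact_odd_part by blast
  have "coprime 4 m" using em(1) by (metis coprime_power_left_iff coprime_left_2_iff_odd numeral_Bit0 power2_eq_square mult_2 numeral_code(2) one_add_one power_numeral_even)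
  then obtain x where x: "[4 * x = 1] (mod m)" using cong_solve_coprime_int by blast
  define N where "N = nat ((x * n) mod m)"
  have N: "[int N = x * n] (mod m)" using em(2) unfolding N_def by (simp add: cong_def)
  have "[4 * int N = n] (mod m)"
  proof -
    have "[4 * int N = 4 * (x * n)] (mod m)" using N by (intro cong_mult) simp_all
    also have "4 * (x * n) = 4 * x * n" by simp
    also have "[4 * x * n = 1 * n] (mod m)" using x by (intro cong_mult) simp_all
    finally show ?thesis by simp
  qed
  then have "[(\<Prod>i<k. 4 * (int N - int i)) = (\<Prod>i<k. n - 4 * int i)] (mod m)"
    unfolding right_diff_distrib by (intro cong_prod cong_diff) simp_all
  moreover have "m dvd (\<Prod>i<k. 4 * (int N - int i))"
  proof -
    have "m dvd fact k" unfolding em by simp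
    then have "m dvd (\<Prod>i<k. int N - int i)" using fact_dvd_falling_product dvd_trans by blast
    then show ?thesis unfolding prod.distrib by simp
  qed
  ultimately have "m dvd (\<Prod>i<k. n - 4 * int i)" by (simp add: cong_dvd_iff)
  moreover have "(2 :: int) ^ e dvd 2 ^ k" using em(3) by (rule le_imp_power_dvd)
  ultimately show ?thesis unfolding em(4) by (intro mult_dvd_mono)
qed

text \<open>Of \<open>8 ^ k\<close>, the part \<open>4 ^ k\<close> clears the quarters in the
  product and \<open>2 ^ k\<close> the even part of \<open>k!\<close>.\<close>

lemma gbinomial_quarter_int: "\<exists>z :: int. 8 ^ k * ((of_int n / 4 :: complex) gchoose k) = of_int z"
proof -
  obtain z where z: "2 ^ k * (\<Prod>i<k. n - 4 * int i) = fact k * z" using fact_dvd_quarter_product[of k n] by (auto elim: dvdE)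
  have "8 ^ k * ((of_int n / 4 :: complex) gchoose k) = 2 ^ k * (4 ^ k * (\<Prod>i<k. of_int n / 4 - of_nat i)) / fact k"
    by (simp add: gbinomial_prod_rev atLeast0LessThan power_mult_distrib[symmetric] mult.assoc[symmetric])
  also have "4 ^ k * (\<Prod>i<k. of_int n / 4 - of_nat i :: complex) = (\<Prod>i<k. 4 * (of_int n / 4 - of_nat i))"
    unfolding prod.distrib by simp
  also have "\<dots> = of_int (\<Prod>i<k. n - 4 * int i)" by (simp add: right_diff_distrib)
  also have "2 ^ k * of_int (\<Prod>i<k. n - 4 * int i) / fact k = (of_int (2 ^ k * (\<Prod>i<k. n - 4 * int i)) / fact k :: complex)" by simp
  also have "\<dots> = of_int z" unfolding z by simp
  finally show ?thesis by blast
qed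

section \<open>Gaussian integers and approximation of the fourth root\<close>

definition gauss_int :: "complex set" where
  "gauss_int = {Complex (of_int a) (of_int b) | a b. True}"

lemma gauss_intI: "Complex (of_int a) (of_int b) \<in> gauss_int"
  unfolding gauss_int_def by blast

lemma gauss_int_of_int: "of_int a \<in> gauss_int"
  using gauss_intI[of a 0] by (simp add: Complex_eq)

lemma gauss_int_add: "z \<in> gauss_int \<Longrightarrow> w \<in> gauss_int \<Longrightarrow> z + w \<in> gauss_int"
proof -
  assume "z \<in> gauss_int" "w \<in> gauss_int"
  then obtain a b c d :: int where "z = Complex a b" "w = Complex c d" unfolding gauss_int_def by auto
  then have "z + w = Complex (of_int (a + c)) (of_int (b + d))" by (simp add: complex_eq_iff)
  then show ?thesis by (simp only: gauss_intI)
qed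

lemma gauss_int_mult: "z \<in> gauss_int \<Longrightarrow> w \<in> gauss_int \<Longrightarrow> z * w \<in> gauss_int"
proof -
  assume "z \<in> gauss_int" "w \<in> gauss_int"
  then obtain a b c d :: int where "z = Complex a b" "w = Complex c d" unfolding gauss_int_def by auto
  then have "z * w = Complex (of_int (a * c - b * d)) (of_int (a * d + b * c))" by (simp add: complex_eq_iff)
  then show ?thesis by (simp only: gauss_intI)
qed

lemma gauss_int_uminus: "z \<in> gauss_int \<Longrightarrow> - z \<in> gauss_int"
  using gauss_int_mult[OF gauss_int_of_int[of "-1"], of z] by simp

lemma gauss_int_diff: "z \<in> gauss_int \<Longrightarrow> w \<in> gauss_int \<Longrightarrow> z - w \<in> gauss_int"
  using gauss_int_add[OF _ gauss_int_uminus, of z w] by simp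

lemma gauss_int_power: "z \<in> gauss_int \<Longrightarrow> z ^ n \<in> gauss_int"
  using gauss_int_of_int[of 1] by (induction n) (simp_all add: gauss_int_mult)

lemma gauss_int_sum: "(\<And>k. k \<in> A \<Longrightarrow> f k \<in> gauss_int) \<Longrightarrow> sum f A \<in> gauss_int"
  using gauss_int_of_int[of 0] by (induction A rule: infinite_finite_induct) (simp_all add: gauss_int_add)

lemma gauss_int_cnj: "z \<in> gauss_int \<Longrightarrow> cnj z \<in> gauss_int"
proof -
  assume "z \<in> gauss_int"
  then obtain a b :: int where "z = Complex a b" unfolding gauss_int_def by auto
  then have "cnj z = Complex (of_int a) (of_int (- b))" by (simp add: complex_eq_iff)
  then show ?thesis by (simp only: gauss_intI)
qed

lemma gauss_int_ii: "\<i> \<in> gauss_int"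
  using gauss_intI[of 0 1] by (simp add: Complex_eq)

lemma gauss_int_norm:
  assumes "z \<in> gauss_int" "z \<noteq> 0" shows "norm z \<ge> 1"
proof -
  obtain a b :: int where z: "z = Complex a b" using assms(1) unfolding gauss_int_def by auto
  then have "a \<noteq> 0 \<or> b \<noteq> 0" using assms(2) by (auto simp: complex_eq_iff)
  then have "a\<^sup>2 + b\<^sup>2 > 0" by (simp add: sum_power2_gt_zero_iff)
  then have "a\<^sup>2 + b\<^sup>2 \<ge> 1" by simp
  then have "real_of_int (a\<^sup>2 + b\<^sup>2) \<ge> 1" by (simp only: of_int_1_le_iff)
  then show ?thesis unfolding z by (simp add: complex_norm)
qed

text \<open>\<open>1 + pt = (239 - \<i>) / (239 + \<i>)\<close>, because
  \<open>239 + \<i> = (1 + \<i>) * (120 - 119 * \<i>)\<close> and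
  \<open>2 * \<i> = (1 + \<i>)\<^sup>2\<close>. The modulus of \<open>120 - 119 * \<i>\<close> is
  \<open>13\<^sup>2\<close>.\<close>

definition pt :: complex where "pt = - (1 + \<i>) / (120 - 119 * \<i>)"
text \<open>Chosen so that \<open>clr * pt = 8 * \<i>\<close>: then \<open>clr ^ r * pt ^ k\<close>
  contains the \<open>8 ^ k\<close> that clears the binomials. Of the six factors
  \<open>1 + \<i>\<close> making up 8 one is already in \<open>pt\<close>, so five suffice here and
  \<open>clr\<close> stays small.\<close>

definition clr :: complex where "clr = (1 + \<i>) ^ 5 * (120 - 119 * \<i>)"

lemma norm_pt_sq: "(norm pt)\<^sup>2 = 2 / 28561"
  by (simp add: pt_def norm_divide power_divide cmod_power2)

lemma norm_pt: "norm pt < 21 / 2500" "norm pt > 0"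
proof -
  have "(norm pt)\<^sup>2 < (21 / 2500)\<^sup>2" unfolding norm_pt_sq by (simp add: power2_eq_square)
  then show "norm pt < 21 / 2500" by (rule power2_less_imp_less) simp
  show "norm pt > 0" using norm_pt_sq by (auto simp: zero_less_norm_iff)
qed

lemma norm_clr: "norm clr < 957"
proof -
  have "(norm clr)\<^sup>2 = ((norm (1 + \<i>))\<^sup>2) ^ 5 * (norm (120 - 119 * \<i>))\<^sup>2"
    by (simp add: clr_def norm_mult norm_power power_mult_distrib power_mult[symmetric] mult.commute)
  also have "\<dots> = 913952" by (simp add: cmod_power2)
  finally have "(norm clr)\<^sup>2 < 957\<^sup>2" by simp
  then show ?thesis by (rule power2_less_imp_less) simp
qed

lemma pade_clear_denominators:
  assumes e: "e = 1 \<or> e = - 1"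
  shows "clr ^ r * poly (pade_poly (e / 4) r) pt \<in> gauss_int"
proof -
  have i6: "(1 + \<i>) ^ 6 = - 8 * \<i>" by (simp add: eval_nat_numeral complex_eq_iff)
  have t0: "120 - 119 * \<i> \<noteq> 0" by (simp add: complex_eq_iff)
  have "clr ^ r * poly (pade_poly (e / 4) r) pt = (\<Sum>k\<le>r. clr ^ r * (of_nat ((2 * r - k) choose r) * ((of_nat r + e / 4) gchoose k) * pt ^ k))"
    unfolding poly_pade_poly sum_distrib_left ..
  also have "\<dots> \<in> gauss_int"
  proof (rule gauss_int_sum)
    fix k assume "k \<in> {..r}"
    then obtain d where r: "r = k + d" using le_Suc_ex by auto
    obtain z :: int where z: "8 ^ k * ((of_nat r + e / 4) gchoose k) = of_int z"
    proof -
      obtain s :: int where "e = of_int s" using e by (metis of_int_1 of_int_minus)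
      then have "of_nat r + e / 4 = of_int (4 * int r + s) / 4" by simp
      then show thesis using gbinomial_quarter_int[of k "4 * int r + s"] that by metis
    qed
    have "clr ^ r * pt ^ k = clr ^ d * (clr * pt) ^ k" unfolding r by (simp add: power_add power_mult_distrib)
    also have "clr * pt = - ((1 + \<i>) ^ 6)" 
    proof -
      have "a ^ 5 * t * (- a / t) = - (a ^ 6)" if "t \<noteq> 0" for a t :: complex using that by (simp add: eval_nat_numeral)
      from this[OF t0] show ?thesis unfolding clr_def pt_def .
    qed
    also have "\<dots> = \<i> * 8" unfolding i6 by simp
    finally have c: "clr ^ r * pt ^ k = clr ^ d * \<i> ^ k * 8 ^ k" by (simp add: power_mult_distrib)
    have "clr ^ r * (of_nat ((2 * r - k) choose r) * ((of_nat r + e / 4) gchoose k) * pt ^ k)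
      = of_int (int ((2 * r - k) choose r)) * ((of_nat r + e / 4) gchoose k) * (clr ^ r * pt ^ k)" by simp
    also have "\<dots> = of_int (int ((2 * r - k) choose r)) * (8 ^ k * ((of_nat r + e / 4) gchoose k)) * (clr ^ d * \<i> ^ k)" unfolding c by simp
    also have "\<dots> = of_int (int ((2 * r - k) choose r)) * of_int z * (clr ^ d * \<i> ^ k)" unfolding z ..
    also have "\<dots> \<in> gauss_int"
    proof -
      have "of_int 1 + \<i> \<in> gauss_int" "of_int 120 - of_int 119 * \<i> \<in> gauss_int"
        by (intro gauss_int_add gauss_int_diff gauss_int_mult gauss_int_of_int gauss_int_ii)+
      then have "clr \<in> gauss_int" unfolding clr_def by (intro gauss_int_mult gauss_int_power) simp_all
      then show ?thesis by (intro gauss_int_mult gauss_int_power gauss_int_of_int gauss_int_ii)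
    qed
    finally show "clr ^ r * (of_nat ((2 * r - k) choose r) * ((of_nat r + e / 4) gchoose k) * pt ^ k) \<in> gauss_int" .
  qed
  finally show ?thesis .
qed

definition zeta :: complex where "zeta = (1 + pt) powr (1 / 4)"

lemma zeta: "zeta ^ 4 = (239 - \<i>) / (239 + \<i>)" "norm zeta = 1"
proof -
  have t0: "120 - 119 * \<i> \<noteq> 0" "239 + \<i> \<noteq> 0" by (simp_all add: complex_eq_iff)
  have p: "1 + pt = (239 - \<i>) / (239 + \<i>)" unfolding pt_def using t0
    by (simp add: field_simps)
  have "239 - \<i> \<noteq> 0" by (simp add: complex_eq_iff)
  then have "1 + pt \<noteq> 0" unfolding p using t0 by simp
  then have "zeta ^ 4 = 1 + pt" unfolding zeta_def by (simp add: powr_def exp_of_nat_mult[symmetric])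
  then show z: "zeta ^ 4 = (239 - \<i>) / (239 + \<i>)" unfolding p .
  have "norm zeta ^ 4 = norm ((239 - \<i>) / (239 + \<i>))" unfolding z[symmetric] norm_power ..
  also have "\<dots> = 1" unfolding norm_divide by (simp add: cmod_def)
  finally have "norm zeta ^ 4 = 1 ^ 4" by simp
  then show "norm zeta = 1" by (rule power_eq_imp_eq_base) simp_all
qed


text \<open>For large \<open>w\<close> two consecutive approximants \<open>p s / q s\<close> of
  \<open>zeta\<close> would both equal \<open>cnj w / (u * w)\<close>, as the Gaussian integers
  \<open>q s * cnj w - u * w * p s\<close> have modulus below 1; this contradicts
  \<open>pade_det\<close>.\<close>

lemma gauss_approximation_bound:
  assumes w: "w \<in> gauss_int" and u: "u \<in> gauss_int" "norm u = 1"
    and app: "norm (cnj w - u * w * zeta) * norm w ^ 3 \<le> 120"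
  shows "norm w < 200000000"
proof (rule ccontr)
  assume "\<not> norm w < 200000000"
  then have W: "norm w \<ge> 200000000" by simp
  define q where "q r = clr ^ r * poly (pade_poly (- (1 / 4)) r) pt" for r
  define p where "p r = clr ^ r * poly (pade_poly (1 / 4) r) pt" for r
  have pq: "p r \<in> gauss_int" "q r \<in> gauss_int" for r
    unfolding p_def q_def using pade_clear_denominators[of 1 r] pade_clear_denominators[of "- 1" r] by simp_all
  have clr: "norm clr ^ r \<le> 957 ^ r" for r using norm_clr by (intro power_mono) simp_all
  \<comment> \<open>The ratio is
    \<open>957 * (norm pt)\<^sup>2 / 2 = 957 / 28561 < 1 / 29\<close>.\<close>
  have rem: "norm (p r - zeta * q r) \<le> (1 / 400) * (1 / 29) ^ r" for r
  proof -
    have "p r - zeta * q r = clr ^ r * eval_fps (pade_rem (1 / 4) r) pt"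
    proof -
      have "norm pt < 1" using norm_pt by simp
      from eval_pade_rem(1)[OF this, of "1 / 4" r] show ?thesis unfolding p_def q_def zeta_def by (simp only: right_diff_distrib mult.left_commute)
    qed
    then have "norm (p r - zeta * q r) = norm clr ^ r * norm (eval_fps (pade_rem (1 / 4) r) pt)" by (simp add: norm_mult norm_power)
    also have "\<dots> \<le> 957 ^ r * (norm pt / (4 * (1 - 2 * norm pt)) * ((norm pt)\<^sup>2 / 2) ^ r)"
      using norm_pt clr by (intro mult_mono norm_eval_pade_rem) simp_all
    also have "\<dots> = norm pt / (4 * (1 - 2 * norm pt)) * (957 * ((norm pt)\<^sup>2 / 2)) ^ r" by (simp only: power_mult_distrib mult_ac)
    also have "\<dots> \<le> (1 / 400) * (1 / 29) ^ r"
    proof (intro mult_mono power_mono)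
      show "norm pt / (4 * (1 - 2 * norm pt)) \<le> 1 / 400" using norm_pt by (simp add: divide_le_eq)
    qed (use norm_pt in \<open>simp_all add: norm_pt_sq\<close>)
    finally show ?thesis .
  qed
  \<comment> \<open>The base is \<open>957 * 4 * (1 + norm pt)\<close>, and
    \<open>3828 * (1 + 21 / 2500) < 3861\<close>.\<close>
  have den: "norm (q r) \<le> 3861 ^ r" for r
  proof -
    have "norm (q r) = norm clr ^ r * norm (poly (pade_poly (- (1 / 4)) r) pt)" unfolding q_def by (simp add: norm_mult norm_power)
    also have "\<dots> \<le> 957 ^ r * (4 * (1 + norm pt)) ^ r" using clr by (intro mult_mono norm_pade_denominator) simp_all
    also have "\<dots> = (957 * (4 * (1 + norm pt))) ^ r" by (simp only: power_mult_distrib)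
    also have "\<dots> \<le> 3861 ^ r" using norm_pt by (intro power_mono) simp_all
    finally show ?thesis .
  qed
  obtain m where m: "norm w / 200 < 29 ^ m" using real_arch_pow[of 29 "norm w / 200"] by auto
  \<comment> \<open>\<open>norm w < 200 * 29 ^ r\<close> makes the remainder term at most 1/2.
    Minimality of \<open>r\<close> keeps \<open>norm w\<close> at least
    \<open>200 * 29 ^ (r - 1)\<close>, which the other term needs.\<close>
  define r where "r = (LEAST m. norm w / 200 < 29 ^ m)"
  have r: "norm w / 200 < 29 ^ r" unfolding r_def by (rule LeastI[of "\<lambda>m. norm w / 200 < 29 ^ m", OF m])
  \<comment> \<open>\<open>200 * 29 ^ 4\<close> is below the bound \<open>2 * 10 ^ 8\<close>, and
    from \<open>r = 5\<close> on the inequality \<open>key\<close> holds; this is the origin of the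
    bound.\<close>
  have r5: "r \<ge> 5"
  proof (rule ccontr)
    assume "\<not> r \<ge> 5"
    then have "(29 :: real) ^ r \<le> 29 ^ 4" by (intro power_increasing) simp_all
    with r W show False by simp
  qed
  define k where "k = r - 5"
  have k: "r = k + 5" using r5 unfolding k_def by simp
  have "k + 4 < r" unfolding k by simp
  then have "\<not> norm w / 200 < 29 ^ (k + 4)" unfolding r_def by (rule not_less_Least)
  then have w29: "200 * 29 ^ (k + 4) \<le> norm w" by simp
  \<comment> \<open>Since \<open>29 ^ 3 > 3861\<close>, the inequality persists for all
    \<open>k\<close> once it holds for \<open>k = 0\<close>.\<close>
  have key: "240 * 3861 ^ (r + 1) < norm w ^ 3"
  proof -
    have "(3861 :: real) ^ k \<le> (29 ^ 3) ^ k" by (intro power_mono) simp_all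
    then have "240 * 3861 ^ 6 * (3861 :: real) ^ k < 200 ^ 3 * (29 ^ 4) ^ 3 * (29 ^ 3) ^ k"
      by (rule mult_less_le_imp_less[rotated]) simp_all
    also have "\<dots> = (200 * 29 ^ (k + 4)) ^ 3"
    proof -
      have "((29 :: real) ^ k) ^ 3 = (29 ^ 3) ^ k" by (simp only: power_mult[symmetric] mult.commute)
      then show ?thesis by (simp only: power_mult_distrib power_add mult_ac)
    qed
    also have "\<dots> \<le> norm w ^ 3" using w29 by (intro power_mono) simp_all
    finally show ?thesis unfolding k by (simp add: power_add mult_ac)
  qed
  have zero: "q s * cnj w = u * w * p s" if s: "s = r \<or> s = r + 1" for s
  proof -
    have "norm (q s * cnj w - u * w * p s) < 1"
    proof -
      have "q s * cnj w - u * w * p s = q s * (cnj w - u * w * zeta) - u * w * (p s - zeta * q s)" by (simp add: algebra_simps)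
      then have "norm (q s * cnj w - u * w * p s) \<le> norm (q s) * norm (cnj w - u * w * zeta) + norm w * norm (p s - zeta * q s)"
        using norm_triangle_ineq4[of "q s * (cnj w - u * w * zeta)" "u * w * (p s - zeta * q s)"] u by (simp add: norm_mult)
      moreover have "norm (q s) * norm (cnj w - u * w * zeta) < 1 / 2"
      proof -
        have "norm (q s) * (norm (cnj w - u * w * zeta) * norm w ^ 3) \<le> 3861 ^ s * 120" using app den by (intro mult_mono) simp_all
        also have "\<dots> \<le> 3861 ^ (r + 1) * 120" using s by (intro mult_right_mono power_increasing) auto
        also have "\<dots> < (1 / 2) * norm w ^ 3" using key by simp
        finally have "(norm (q s) * norm (cnj w - u * w * zeta)) * norm w ^ 3 < (1 / 2) * norm w ^ 3" by (simp only: mult.assoc)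
        then show ?thesis by (rule mult_right_less_imp_less) simp
      qed
      moreover have "norm w * norm (p s - zeta * q s) \<le> 1 / 2"
      proof -
        have "norm w * norm (p s - zeta * q s) \<le> (200 * 29 ^ r) * ((1 / 400) * (1 / 29) ^ s)"
          using r rem[of s] by (intro mult_mono) simp_all
        also have "\<dots> \<le> (200 * 29 ^ r) * ((1 / 400) * (1 / 29) ^ r)"
          using s by (intro mult_left_mono power_decreasing) auto
        also have "\<dots> = 1 / 2" by (simp add: power_one_over)
        finally show ?thesis .
      qed
      ultimately show ?thesis by linarith
    qed
    moreover have "q s * cnj w - u * w * p s \<in> gauss_int" using pq u(1) w by (intro gauss_int_diff gauss_int_mult gauss_int_cnj)
    ultimately show ?thesis using gauss_int_norm[of "q s * cnj w - u * w * p s"] by force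
  qed
  have w0: "w \<noteq> 0" "cnj w \<noteq> 0" "u \<noteq> 0" using W u by auto
  have "q r * p (r + 1) * cnj w = p (r + 1) * (q r * cnj w)" by simp
  also have "\<dots> = p r * (u * w * p (r + 1))" using zero[of r] by simp
  also have "\<dots> = p r * q (r + 1) * cnj w" using zero[of "r + 1"] by simp
  finally have "q r * p (r + 1) = p r * q (r + 1)" using w0 by simp
  then have "(clr ^ r * clr ^ (r + 1)) * (poly (pade_poly (1 / 4) (Suc r)) pt * poly (pade_poly (- (1 / 4)) r) pt) =
    (clr ^ r * clr ^ (r + 1)) * (poly (pade_poly (1 / 4) r) pt * poly (pade_poly (- (1 / 4)) (Suc r)) pt)"
    unfolding p_def q_def by (simp add: mult_ac)
  moreover have "clr ^ r * clr ^ (r + 1) \<noteq> 0"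
  proof -
    have "1 + \<i> \<noteq> 0" "120 - 119 * \<i> \<noteq> 0" by (simp_all add: complex_eq_iff)
    then have "clr \<noteq> 0" unfolding clr_def by simp
    then show ?thesis by simp
  qed
  ultimately have "poly (pade_poly (1 / 4) (Suc r)) pt * poly (pade_poly (- (1 / 4)) r) pt =
    poly (pade_poly (1 / 4) r) pt * poly (pade_poly (- (1 / 4)) (Suc r)) pt" by (simp only: mult_cancel_left) simp
  moreover have "poly (pade_poly (1 / 4) (Suc r)) pt * poly (pade_poly (- (1 / 4)) r) pt \<noteq>
    poly (pade_poly (1 / 4) r) pt * poly (pade_poly (- (1 / 4)) (Suc r)) pt"
  proof (rule pade_det)
    show "(of_nat (Suc s))\<^sup>2 \<noteq> (1 / 4 :: complex)\<^sup>2" for s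
    proof
      assume "(of_nat (Suc s))\<^sup>2 = (1 / 4 :: complex)\<^sup>2"
      then have "16 * (of_nat (Suc s))\<^sup>2 = (1 :: complex)" by (simp only: power_divide) simp
      then have "(of_nat (16 * (Suc s)\<^sup>2) :: complex) = of_nat 1" by (simp only: of_nat_mult of_nat_power of_nat_numeral of_nat_1)
      then have "16 * (Suc s)\<^sup>2 = 1" by (simp only: of_nat_eq_iff)
      then show False by simp
    qed
    show "pt \<noteq> 0" using norm_pt by auto
  qed simp
  ultimately show False by contradiction
qed

text \<open>Two square roots are taken in turn. By the parallelogram law the farther of
  \<open>s\<close> and \<open>- s\<close> is at distance at least \<open>sqrt 2\<close>, so the
  nearer one gains a factor \<open>sqrt 2\<close> each time.\<close>

lemma fourth_root_close:
  fixes y :: complex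
  assumes "norm y = 1"
  shows "\<exists>u. u \<in> gauss_int \<and> norm u = 1 \<and> norm (y - u) \<le> norm (y ^ 4 - 1) / 2"
proof -
  have sq: "\<exists>t. t\<^sup>2 = s\<^sup>2 \<and> sqrt 2 * norm (x - t) \<le> norm (x\<^sup>2 - s\<^sup>2)" if "norm x = 1" "norm s = 1" for x s :: complex
  proof -
    have par: "(norm (x - s))\<^sup>2 + (norm (x + s))\<^sup>2 = 4"
    proof -
      have "(norm (x - s))\<^sup>2 + (norm (x + s))\<^sup>2 = 2 * (norm x)\<^sup>2 + 2 * (norm s)\<^sup>2"
        unfolding cmod_power2 by (simp add: power2_eq_square algebra_simps)
      then show ?thesis using that by simp
    qed
    have prod: "norm (x\<^sup>2 - s\<^sup>2) = norm (x - s) * norm (x + s)"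
      unfolding norm_mult[symmetric] by (simp add: algebra_simps power2_eq_square)
    show ?thesis
    proof (cases "(norm (x + s))\<^sup>2 \<ge> 2")
      case True
      then have "sqrt 2 \<le> norm (x + s)" by (simp add: real_le_lsqrt)
      then have "sqrt 2 * norm (x - s) \<le> norm (x\<^sup>2 - s\<^sup>2)" using mult_left_mono[of "sqrt 2" "norm (x + s)" "norm (x - s)"] unfolding prod by (simp add: mult.commute)
      then show ?thesis by blast
    next
      case False
      with par have "(norm (x - s))\<^sup>2 \<ge> 2" by simp
      then have "sqrt 2 \<le> norm (x - s)" by (simp add: real_le_lsqrt)
      then have "sqrt 2 * norm (x - (- s)) \<le> norm (x\<^sup>2 - s\<^sup>2)" using mult_right_mono[of "sqrt 2" "norm (x - s)" "norm (x + s)"] unfolding prod by simp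
      then show ?thesis by (intro exI[of _ "- s"]) simp
    qed
  qed
  obtain t where t: "t\<^sup>2 = 1" "sqrt 2 * norm (y\<^sup>2 - t) \<le> norm ((y\<^sup>2)\<^sup>2 - 1)"
    using sq[of "y\<^sup>2" 1] assms by (auto simp: norm_power)
  from t(1) have "t = 1 \<or> t = - 1" by (simp add: power2_eq_1_iff)
  then obtain s where s: "s\<^sup>2 = t" "s \<in> gauss_int" "norm s = 1" "- s \<in> gauss_int"
    using gauss_int_of_int[of 1] gauss_int_of_int[of "- 1"] gauss_int_ii gauss_int_uminus[OF gauss_int_ii]
    by (metis norm_ii norm_one of_int_1 of_int_minus one_power2 power2_i)
  obtain u where u: "u\<^sup>2 = s\<^sup>2" "sqrt 2 * norm (y - u) \<le> norm (y\<^sup>2 - s\<^sup>2)" using sq[OF assms s(3)] by blast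
  from u(1) have "u = s \<or> u = - s" by (simp add: power2_eq_iff)
  then have "u \<in> gauss_int" "norm u = 1" using s by auto
  moreover have "norm (y - u) \<le> norm (y ^ 4 - 1) / 2"
  proof -
    have "2 * norm (y - u) = sqrt 2 * (sqrt 2 * norm (y - u))" by simp
    also have "\<dots> \<le> sqrt 2 * norm (y\<^sup>2 - t)" using u(2) s(1) by simp
    also have "\<dots> \<le> norm ((y\<^sup>2)\<^sup>2 - 1)" by (rule t(2))
    also have "(y\<^sup>2)\<^sup>2 = y ^ 4" by (simp add: power_mult[symmetric])
    finally show ?thesis by simp
  qed
  ultimately show ?thesis by blast
qed


text \<open>The fourth power of \<open>cnj w / (w * zeta)\<close> is
  \<open>(g' - \<i>) / (g' + \<i>)\<close>, at distance of order \<open>1 / f\<^sup>2\<close> from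
  1, and \<open>f\<^sup>2\<close> is proportional to \<open>norm w ^ 4\<close>. Thus
  \<open>cnj w / w\<close> approximates a unit times \<open>zeta\<close> well enough for
  \<open>gauss_approximation_bound\<close>.\<close>

lemma quartic_gauss_bound:
  fixes f g g' s a b :: int
  assumes f: "f = a\<^sup>2 + b\<^sup>2" "f > 0" and g: "g\<^sup>2 + 1 = 2 * f ^ 4" "g'\<^sup>2 = g\<^sup>2"
    and s: "s = 1 \<or> s = - 1" and z: "(1 + \<i>) * (Complex a b) ^ 4 = of_int s * (of_int g' + \<i>)"
  shows "f\<^sup>2 < 10 ^ 31"
proof -
  define z where "z = Complex (of_int a) (of_int b)"
  \<comment> \<open>\<open>(1 - \<i>) * (3 - 2 * \<i>) ^ 4 = - (239 + \<i>)\<close> is the Gaussian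
    form of \<open>239\<^sup>2 + 1 = 2 * 13 ^ 4\<close>; the factor brings the known solution into
    play.\<close>
  define w where "w = z * (3 - 2 * \<i>)"
  have zG: "z \<in> gauss_int" unfolding z_def by (rule gauss_intI)
  have "of_int 3 - of_int 2 * \<i> \<in> gauss_int" by (intro gauss_int_diff gauss_int_mult gauss_int_of_int gauss_int_ii)
  then have wG: "w \<in> gauss_int" unfolding w_def using zG by (intro gauss_int_mult) simp_all
  have nz: "(norm z)\<^sup>2 = of_int f" unfolding z_def f by (simp add: cmod_power2)
  have nw: "(norm w)\<^sup>2 = 13 * of_int f"
  proof -
    have "(norm (3 - 2 * \<i>))\<^sup>2 = 13" by (simp add: cmod_power2)
    then show ?thesis unfolding w_def norm_mult power_mult_distrib nz by simp
  qed
  have "(norm w)\<^sup>2 > 0" using nw f(2) by simp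
  then have w0: "w \<noteq> 0" by auto
  have zeta0: "zeta \<noteq> 0" using zeta(2) by auto
  define y where "y = cnj w / (w * zeta)"
  have y1: "norm y = 1" unfolding y_def using w0 zeta(2) by (simp add: norm_divide norm_mult)
  have t0: "239 + \<i> \<noteq> 0" "239 - \<i> \<noteq> 0" "of_int g' + \<i> \<noteq> 0" by (simp_all add: complex_eq_iff)
  have s0: "(of_int s :: complex) \<noteq> 0" using s by auto
  have z4: "(1 + \<i>) * z ^ 4 = of_int s * (of_int g' + \<i>)" using z unfolding z_def .
  have zc4: "(1 - \<i>) * cnj z ^ 4 = of_int s * (of_int g' - \<i>)"
    using arg_cong[OF z4, of cnj] by simp
  have c1: "(1 - \<i>) * (3 - 2 * \<i>) ^ 4 = - (239 + \<i>)" "(1 + \<i>) * (3 + 2 * \<i>) ^ 4 = - (239 - \<i>)"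
    by (simp_all add: eval_nat_numeral complex_eq_iff)
  have two: "(1 + \<i>) * (1 - \<i>) = 2" by (simp add: complex_eq_iff)
  have w4: "2 * w ^ 4 = - (of_int s * (of_int g' + \<i>) * (239 + \<i>))"
  proof -
    have "2 * w ^ 4 = ((1 + \<i>) * z ^ 4) * ((1 - \<i>) * (3 - 2 * \<i>) ^ 4)"
      unfolding w_def power_mult_distrib two[symmetric] by (simp only: mult_ac)
    then show ?thesis unfolding z4 c1 mult_minus_right .
  qed
  have wc4: "2 * cnj w ^ 4 = - (of_int s * (of_int g' - \<i>) * (239 - \<i>))"
  proof -
    have "cnj w = cnj z * (3 + 2 * \<i>)" unfolding w_def by simp
    then have "2 * cnj w ^ 4 = ((1 - \<i>) * cnj z ^ 4) * ((1 + \<i>) * (3 + 2 * \<i>) ^ 4)"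
      unfolding power_mult_distrib two[symmetric] by (simp only: power_mult_distrib mult_ac)
    then show ?thesis unfolding zc4 c1 mult_minus_right .
  qed
  have "y ^ 4 = (2 * cnj w ^ 4) / (2 * w ^ 4 * zeta ^ 4)" unfolding y_def by (simp add: power_divide power_mult_distrib)
  also have "\<dots> = (of_int g' - \<i>) / (of_int g' + \<i>)"
  proof -
    have "- (t * gm * zm) / (- (t * gp * zp) * (zm / zp)) = gm / gp" if "t \<noteq> 0" "zm \<noteq> 0" "zp \<noteq> 0" for t gm zm gp zp :: complex
      using that by simp
    from this[OF s0 t0(2,1)] show ?thesis unfolding wc4 w4 zeta(1) .
  qed
  finally have y4: "y ^ 4 = (of_int g' - \<i>) / (of_int g' + \<i>)" .
  have "y ^ 4 - 1 = - 2 * \<i> / (of_int g' + \<i>)" unfolding y4 using t0 by (simp add: field_simps)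
  then have n4: "norm (y ^ 4 - 1) = 2 / norm (of_int g' + \<i>)" by (simp add: norm_divide norm_mult)
  have "(norm (of_int g' + \<i>))\<^sup>2 = of_int (g'\<^sup>2 + 1)" by (simp add: cmod_power2)
  also have "\<dots> = 2 * (of_int (f\<^sup>2))\<^sup>2" unfolding g by (simp add: power2_eq_square power4_eq_xxxx)
  finally have ng: "(norm (of_int g' + \<i>))\<^sup>2 = 2 * (of_int (f\<^sup>2))\<^sup>2" .
  have ff: "real_of_int (f\<^sup>2) > 0" using f(2) by simp
  have "(141 / 100 * real_of_int (f\<^sup>2))\<^sup>2 \<le> (norm (of_int g' + \<i>))\<^sup>2" unfolding ng power_mult_distrib
    by (intro mult_right_mono) (simp_all add: power2_eq_square)
  then have ng2: "141 / 100 * real_of_int (f\<^sup>2) \<le> norm (of_int g' + \<i>)" by (rule power2_le_imp_le) simp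
  have "norm (y ^ 4 - 1) \<le> 2 / (141 / 100 * real_of_int (f\<^sup>2))" unfolding n4
    by (rule divide_left_mono[OF ng2]) (use t0(3) ff in \<open>simp_all add: zero_less_mult_iff\<close>)
  moreover obtain u where u: "u \<in> gauss_int" "norm u = 1" "norm (y - u) \<le> norm (y ^ 4 - 1) / 2" using fourth_root_close[OF y1] by blast
  ultimately have yu: "norm (y - u) \<le> 100 / 141 / real_of_int (f\<^sup>2)" by simp
  have "cnj w - u * w * zeta = (y - u) * (w * zeta)" unfolding y_def using w0 zeta0 by (simp add: field_simps)
  then have "norm (cnj w - u * w * zeta) * norm w ^ 3 = norm (y - u) * norm w ^ 4" using zeta(2) by (simp add: norm_mult eval_nat_numeral)
  also have "norm w ^ 4 = 169 * real_of_int (f\<^sup>2)"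
  proof -
    have "norm w ^ 4 = ((norm w)\<^sup>2)\<^sup>2" by (simp add: power_mult[symmetric])
    then show ?thesis unfolding nw by (simp add: power2_eq_square)
  qed
  also have "norm (y - u) * (169 * real_of_int (f\<^sup>2)) \<le> 100 / 141 / real_of_int (f\<^sup>2) * (169 * real_of_int (f\<^sup>2))"
    using yu ff by (intro mult_right_mono) simp_all
  also have "\<dots> \<le> 169 * (100 / 141)" using ff by simp
  finally have "norm (cnj w - u * w * zeta) * norm w ^ 3 \<le> 169 * (100 / 141)" .
  \<comment> \<open>\<open>norm w ^ 4 = 169 * f\<^sup>2\<close> meets the error
    \<open>1 / (1.41 * f\<^sup>2)\<close>, where 1.41 stands for \<open>sqrt 2\<close>; the quotient
    169 / 1.41 is just below 120.\<close>
  then have "norm (cnj w - u * w * zeta) * norm w ^ 3 \<le> 120" by simp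
  from gauss_approximation_bound[OF wG u(1,2) this] have "norm w < 200000000" .
  then have "(norm w)\<^sup>2 < 200000000\<^sup>2" by (intro power_strict_mono) simp_all
  then have "13 * real_of_int f < of_int (4 * 10 ^ 16)" unfolding nw by simp
  then have "13 * f < 4 * 10 ^ 16" by linarith
  \<comment> \<open>\<open>4 * 10 ^ 16 / 13 < 31 * 10 ^ 14\<close>, and
    \<open>31\<^sup>2 < 1000\<close>.\<close>
  then have "f\<^sup>2 < (31 * 10 ^ 14)\<^sup>2" using f(2) by (intro power_strict_mono) simp_all
  then show ?thesis by simp
qed


section \<open>Pythagorean triples and a Pell equation\<close>

lemma coprime_mult_square_int:
  fixes a b x :: int
  assumes "a * b = x\<^sup>2" "coprime a b" "a > 0" "b > 0"
  obtains r s where "r > 0" "s > 0" "a = r\<^sup>2" "b = s\<^sup>2"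
proof -
  have "nat a * nat b = (nat \<bar>x\<bar>)\<^sup>2" using assms by (simp add: nat_mult_distrib[symmetric] nat_power_eq[symmetric])
  then have "is_nth_power 2 (nat a * nat b)" by (metis is_nth_power_def)
  moreover have "coprime (nat a) (nat b)" using assms by (simp add: coprime_int_iff[symmetric])
  ultimately have "is_nth_power 2 (nat a)" "is_nth_power 2 (nat b)"
    using is_nth_power_mult_coprime_natD[of "nat a" "nat b" 2] assms by auto
  then obtain r s where rs: "nat a = r ^ 2" "nat b = s ^ 2" by (auto simp: is_nth_power_def)
  show thesis
  proof (rule that)
    show "a = (int r)\<^sup>2" "b = (int s)\<^sup>2" using rs assms by (metis int_nat_eq of_nat_power order_less_imp_le)+
    then show "int r > 0" "int s > 0" using assms by (auto intro: Nat.gr0I)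
  qed
qed

text \<open>Both legs may be negative: the sign of \<open>y\<close> goes into \<open>n\<close>, that
  of \<open>x\<close> into the order of the two squares.\<close>

lemma pythagorean_triple:
  fixes x y z :: int
  assumes "coprime x y" "odd x" "even y" "y \<noteq> 0" "x\<^sup>2 + y\<^sup>2 = z\<^sup>2" "z > 0"
  obtains m n where "x = m\<^sup>2 - n\<^sup>2" "y = 2 * m * n" "z = m\<^sup>2 + n\<^sup>2" "coprime m n"
proof -
  have "odd (x\<^sup>2 + y\<^sup>2)" using assms(2,3) by simp
  then have "odd z" unfolding assms(5) by simp
  with assms(2) obtain c d where cd: "z + x = 2 * c" "z - x = 2 * d" by (metis even_add even_diff dvd_def)
  then have zx: "z = c + d" "x = c - d" by simp_all
  obtain e where e: "y = 2 * e" using assms(3) by blast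
  have "4 * (c * d) = 4 * e\<^sup>2" using assms(5) unfolding zx e by (simp add: power2_eq_square algebra_simps)
  then have p: "c * d = e\<^sup>2" by simp
  have "e \<noteq> 0" using e assms(4) by simp
  then have "c * d > 0" unfolding p by simp
  moreover have "c + d > 0" using assms(6) zx by simp
  ultimately have pos: "c > 0" "d > 0" by (auto simp: zero_less_mult_iff)
  have cop: "coprime c d"
  proof (rule coprimeI)
    fix q assume q: "q dvd c" "q dvd d"
    then have "q dvd x" unfolding zx by simp
    have "q * q dvd c * d" using q by (intro mult_dvd_mono)
    then have "q\<^sup>2 dvd e\<^sup>2" unfolding p by (simp add: power2_eq_square)
    then have "q dvd e" by simp
    then have "q dvd y" unfolding e by simp
    with \<open>q dvd x\<close> assms(1) show "is_unit q" by (metis coprime_common_divisor)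
  qed
  obtain m n where mn: "m > 0" "n > 0" "c = m\<^sup>2" "d = n\<^sup>2" using coprime_mult_square_int[OF p cop pos] by blast
  have cmn: "coprime m n" using cop unfolding mn by simp
  have "e\<^sup>2 = (m * n)\<^sup>2" using p unfolding mn by (simp add: power_mult_distrib)
  then have "e = m * n \<or> e = - (m * n)" by (simp add: power2_eq_iff)
  then show thesis
  proof
    assume "e = m * n"
    then show thesis using that[of m n] zx mn e cmn by simp
  next
    assume "e = - (m * n)"
    then show thesis using that[of m "- n"] zx mn e cmn by simp
  qed
qed

text \<open>Coordinates of \<open>(1 + \<surd>2) * (3 + 2 * \<surd>2) ^ n\<close>, the elements of
  norm -1.\<close>

fun pell_neg :: "nat \<Rightarrow> int \<times> int" where
  "pell_neg 0 = (1, 1)"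
| "pell_neg (Suc n) = (3 * fst (pell_neg n) + 4 * snd (pell_neg n), 2 * fst (pell_neg n) + 3 * snd (pell_neg n))"

text \<open>Descent by multiplication with \<open>3 - 2 * \<surd>2\<close>, which keeps both
  coordinates positive and lowers \<open>h\<close> as soon as \<open>h \<ge> 3\<close>.\<close>

lemma pell_neg_complete:
  fixes g h :: int
  assumes "g\<^sup>2 + 1 = 2 * h\<^sup>2" "g > 0" "h > 0"
  shows "\<exists>n. (g, h) = pell_neg n"
  using assms
proof (induction "nat h" arbitrary: g h rule: less_induct)
  case less
  show ?case
  proof (cases "h = 1")
    case True
    with less.prems have "g\<^sup>2 = 1" by simp
    with less.prems have "g = 1" by (simp add: power2_eq_1_iff)
    with True show ?thesis by (intro exI[of _ 0]) simp
  next
    case False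
    have "h \<noteq> 2"
    proof
      assume "h = 2"
      then have g7: "g\<^sup>2 = 7" using less.prems by simp
      then have "g < 3" using less.prems by (intro power2_less_imp_less[of g 3]) simp_all
      then have "g = 1 \<or> g = 2" using less.prems by linarith
      then show False using g7 by auto
    qed
    with False less.prems have h2: "h \<ge> 3" by simp
    define g' where "g' = 3 * g - 4 * h" define h' where "h' = 3 * h - 2 * g"
    have eq: "g'\<^sup>2 + 1 = 2 * h'\<^sup>2" unfolding g'_def h'_def using less.prems(1) by (simp add: power2_eq_square algebra_simps)
    have "(4 * h)\<^sup>2 < (3 * g)\<^sup>2"
    proof -
      have "3\<^sup>2 \<le> h\<^sup>2" using h2 by (intro power_mono) simp_all
      then show ?thesis using less.prems(1) unfolding power_mult_distrib by simp
    qed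
    then have 1: "4 * h < 3 * g" by (rule power2_less_imp_less) (use less.prems(2) in simp)
    have "h\<^sup>2 > 0" using less.prems(3) by simp
    then have "4 * g\<^sup>2 < 9 * h\<^sup>2" using less.prems(1) by linarith
    then have "(2 * g)\<^sup>2 < (3 * h)\<^sup>2" by (simp add: power_mult_distrib)
    then have 2: "2 * g < 3 * h" by (rule power2_less_imp_less) (use less.prems(3) in simp)
    have "g > h" using 1 less.prems(3) by linarith
    then have "h' < h" "h' > 0" "g' > 0" unfolding g'_def h'_def using 1 2 by linarith+
    then have "nat h' < nat h" by simp
    from less.hyps[OF this eq \<open>g' > 0\<close> \<open>h' > 0\<close>] obtain n where n: "(g', h') = pell_neg n" by blast
    have "pell_neg (Suc n) = (3 * g' + 4 * h', 2 * g' + 3 * h')" unfolding pell_neg.simps n[symmetric] by simp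
    also have "\<dots> = (g, h)" unfolding g'_def h'_def by simp
    finally have "(g, h) = pell_neg (Suc n)" by simp
    then show ?thesis by blast
  qed
qed

lemma pell_neg_pos: "fst (pell_neg n) > 0 \<and> snd (pell_neg n) > 0"
  by (induction n) auto

lemma pell_neg_mono: "m \<le> n \<Longrightarrow> snd (pell_neg m) \<le> snd (pell_neg n)"
proof (induction n rule: dec_induct)
  case (step n)
  then show ?case using pell_neg_pos[of n] by simp
qed simp


lemma between_squares_not_square:
  fixes f m :: int
  assumes "m\<^sup>2 < f\<^sup>2" "f\<^sup>2 < (m + 1)\<^sup>2" "f > 0" "m > 0"
  shows False
proof -
  have "m < f" using assms by (intro power2_less_imp_less[of m f]) simp_all
  moreover have "f < m + 1" using assms by (intro power2_less_imp_less[of f "m + 1"]) simp_all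
  ultimately show False by simp
qed

text \<open>A certificate to be checked by evaluation: the list holds the integer square roots of
  successive Pell solutions, none of which is a square, until the bound \<open>10 ^ 31\<close> from
  \<open>quartic_gauss_bound\<close> is passed.\<close>

fun nonsquare_chain :: "int list \<Rightarrow> int \<Rightarrow> int \<Rightarrow> bool" where
  "nonsquare_chain [] g h \<longleftrightarrow> 10 ^ 31 \<le> h"
| "nonsquare_chain (m # ms) g h \<longleftrightarrow> m > 0 \<and> m\<^sup>2 < h \<and> h < (m + 1)\<^sup>2 \<and> nonsquare_chain ms (3 * g + 4 * h) (2 * g + 3 * h)"

lemma nonsquare_chain_sound:
  assumes "nonsquare_chain ms g h" "(g, h) = pell_neg k" "k \<le> n" "f\<^sup>2 = snd (pell_neg n)" "f > 0"
  shows "10 ^ 31 \<le> f\<^sup>2"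
  using assms(1-3)
proof (induction ms arbitrary: g h k)
  case Nil
  then have "10 ^ 31 \<le> snd (pell_neg k)" by (metis nonsquare_chain.simps(1) snd_conv)
  also have "\<dots> \<le> f\<^sup>2" using pell_neg_mono[OF Nil(3)] assms(4) by simp
  finally show ?case .
next
  case (Cons m ms)
  have h: "h = snd (pell_neg k)" using Cons.prems(2) by (metis snd_conv)
  have "n \<noteq> k"
  proof
    assume "n = k"
    then have "f\<^sup>2 = h" using assms(4) h by simp
    then show False using between_squares_not_square[of m f] Cons.prems(1) assms(5) by simp
  qed
  then have "Suc k \<le> n" using Cons.prems(3) by simp
  moreover have "(3 * g + 4 * h, 2 * g + 3 * h) = pell_neg (Suc k)"
    unfolding pell_neg.simps Cons.prems(2)[symmetric] by simp
  moreover have "nonsquare_chain ms (3 * g + 4 * h) (2 * g + 3 * h)" using Cons.prems(1) by simp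
  ultimately show ?case using Cons.IH by blast
qed

lemma pell_neg_square:
  fixes f :: int
  assumes f: "f\<^sup>2 = snd (pell_neg n)" "f > 0" "f\<^sup>2 < 10 ^ 31"
  shows "f = 1 \<or> f = 13"
proof -
  have p: "pell_neg 0 = (1, 1)" "pell_neg 1 = (7, 5)" "pell_neg 2 = (41, 29)" "pell_neg 3 = (239, 169)" "pell_neg 4 = (1393, 985)"
    by (simp_all add: eval_nat_numeral)
  \<comment> \<open>The list starts at index 4, just past the square 169 at index 3.\<close>
  have "nonsquare_chain [31, 75, 182, 441, 1066, 2573, 6214, 15001, 36217, 87437, 211093, 509624, 1230343, 2970311,
    7170966, 17312244, 41795454, 100903153, 243601760, 588106675, 1419815110, 3427736897,
    8275288905, 19978314707, 48231918319, 116442151345, 281116221011, 678674593367, 1638465407746,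
    3955605408861, 9549676225469, 23054957859800, 55659591945070, 134374141749942, 324407875444955,
    783189892639852, 1890787660724660]
     1393 985" by simp
  then have "10 ^ 31 \<le> f\<^sup>2" if "4 \<le> n" using nonsquare_chain_sound[OF _ p(5)[symmetric] that f(1,2)] by blast
  with f(3) have "n < 4" by linarith
  then consider "n = 0" | "n = 1" | "n = 2" | "n = 3" by linarith
  then show ?thesis
  proof cases
    case 1
    then have "f\<^sup>2 = 1" using f(1) by simp
    then show ?thesis using f(2) by (simp add: power2_eq_1_iff)
  next
    case 2
    then have "f\<^sup>2 = 5" using f(1) p by simp
    then show ?thesis using between_squares_not_square[of 2 f] f(2) by simp
  next
    case 3
    then have "f\<^sup>2 = 29" using f(1) p by simp
    then show ?thesis using between_squares_not_square[of 5 f] f(2) by simp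
  next
    case 4
    then have "f\<^sup>2 = 13\<^sup>2" using f(1) p by simp
    then have "f = 13 \<or> f = - 13" by (simp only: power2_eq_iff)
    then show ?thesis using f(2) by auto
  qed
qed

text \<open>With \<open>g = 2 * k + 1\<close> the equation says that \<open>k\<close> and
  \<open>k + 1\<close> are the legs of a Pythagorean triple with hypotenuse
  \<open>(f\<^sup>2)\<^sup>2\<close>'s root \<open>f\<^sup>2\<close>. Parametrising twice exhibits
  the legs, up to sign, as the coordinates of a fourth power of a Gaussian integer of norm
  \<open>f\<close>.\<close>

theorem ljunggren:
  fixes f g :: int
  assumes eq: "g\<^sup>2 + 1 = 2 * f ^ 4" and f: "f > 0"
  shows "f = 1 \<or> f = 13"
proof -
  define g0 where "g0 = \<bar>g\<bar>"
  have eq0: "g0\<^sup>2 + 1 = 2 * f ^ 4" unfolding g0_def using eq by simp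
  have "g \<noteq> 0"
  proof
    assume "g = 0"
    then have "1 = 2 * f ^ 4" using eq by simp
    then show False by presburger
  qed
  then have g0: "g0 > 0" unfolding g0_def by simp
  have eqf: "g0\<^sup>2 + 1 = 2 * (f\<^sup>2)\<^sup>2" using eq0 by (simp add: power2_eq_square power4_eq_xxxx)
  obtain n where n: "(g0, f\<^sup>2) = pell_neg n" using pell_neg_complete[OF eqf g0] f by auto
  then have fn: "f\<^sup>2 = snd (pell_neg n)" by (metis snd_conv)
  show ?thesis
  proof (cases "g0 = 1")
    case True
    then have "(f\<^sup>2)\<^sup>2 = 1" using eqf by simp
    then have "f\<^sup>2 = 1 \<or> f\<^sup>2 = - 1" by (simp only: power2_eq_1_iff)
    moreover have "f\<^sup>2 \<ge> 0" by simp
    ultimately have "f\<^sup>2 = 1" by linarith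
    then show ?thesis using f by (simp add: power2_eq_1_iff)
  next
    case False
    have "even (g0\<^sup>2 + 1)" unfolding eq0 by simp
    then obtain k where k: "g0 = 2 * k + 1" by (auto elim: oddE)
    with g0 False have k0: "k > 0" by auto
    have kk: "k\<^sup>2 + (k + 1)\<^sup>2 = (f\<^sup>2)\<^sup>2" using eqf unfolding k by (simp add: power2_eq_square algebra_simps)
    have ck: "coprime k (k + 1)" by simp
    obtain X Y where XY: "odd X" "even Y" "Y \<noteq> 0" "coprime X Y" "X\<^sup>2 + Y\<^sup>2 = (f\<^sup>2)\<^sup>2" "X + Y = g0" "X - Y = 1 \<or> X - Y = - 1"
    proof (cases "even k")
      case True
      then show thesis using that[of "k + 1" k] k0 kk ck k by (auto simp: add.commute coprime_commute)
    next
      case False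
      then show thesis using that[of k "k + 1"] k0 kk ck k by auto
    qed
    obtain m0 n0 where mn0: "X = m0\<^sup>2 - n0\<^sup>2" "Y = 2 * m0 * n0" "f\<^sup>2 = m0\<^sup>2 + n0\<^sup>2" "coprime m0 n0"
      using pythagorean_triple[OF XY(4,1,2,3,5)] f by auto
    have "odd X" by (rule XY(1))
    then have par: "odd m0 \<noteq> odd n0" unfolding mn0 by simp
    \<comment> \<open>The odd one of \<open>m0\<close> and \<open>n0\<close> has to come first for
      the second parametrisation; the exchange costs the sign of \<open>X\<close>.\<close>
    obtain u v where uv: "odd u" "even v" "v \<noteq> 0" "coprime u v" "u\<^sup>2 + v\<^sup>2 = f\<^sup>2" "2 * u * v = Y" "u\<^sup>2 - v\<^sup>2 = X \<or> u\<^sup>2 - v\<^sup>2 = - X"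
    proof (cases "odd m0")
      case True
      then show thesis using that[of m0 n0] mn0 par XY(3) by auto
    next
      case False
      then show thesis using that[of n0 m0] mn0 par XY(3) by (auto simp: coprime_commute mult_ac)
    qed
    obtain a b where ab: "u = a\<^sup>2 - b\<^sup>2" "v = 2 * a * b" "f = a\<^sup>2 + b\<^sup>2"
      using pythagorean_triple[OF uv(4,1,2,3,5) f] by metis
    have z2: "(Complex (of_int a) (of_int b))\<^sup>2 = Complex (of_int u) (of_int v)"
      unfolding ab by (simp add: power2_eq_square complex_eq_iff)
    have z4: "(Complex (of_int a) (of_int b)) ^ 4 = Complex (of_int (u\<^sup>2 - v\<^sup>2)) (of_int Y)"
    proof -
      have "(Complex (of_int a) (of_int b)) ^ 4 = ((Complex (of_int a) (of_int b))\<^sup>2)\<^sup>2" by (simp add: power_mult[symmetric])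
      then show ?thesis unfolding z2 uv(6)[symmetric] by (simp add: power2_eq_square complex_eq_iff)
    qed
    have z4': "(Complex (of_int a) (of_int (- b))) ^ 4 = Complex (of_int (u\<^sup>2 - v\<^sup>2)) (of_int (- Y))"
    proof -
      have e: "Complex (of_int a) (of_int (- b)) = cnj (Complex (of_int a) (of_int b))" by (simp add: complex_eq_iff)
      show ?thesis unfolding e complex_cnj_power[symmetric] z4 by (simp add: complex_eq_iff)
    qed
    have f': "f = a\<^sup>2 + (- b)\<^sup>2" using ab by simp
    have d: "X - Y = 1 \<or> X - Y = - 1" by (rule XY(7))
    have XY1: "X = Y + 1 \<or> X = Y - 1" using d by linarith
    have dd: "((X - Y) * g0)\<^sup>2 = g0\<^sup>2" using d by auto
    from uv(7) have "f\<^sup>2 < 10 ^ 31"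
    proof
      assume r: "u\<^sup>2 - v\<^sup>2 = X"
      \<comment> \<open>\<open>(1 + \<i>) * (X - Y * \<i>)\<close> has imaginary part
        \<open>X - Y\<close>, which is 1 or -1, whereas \<open>(1 + \<i>) * (X + Y * \<i>)\<close>
        has it as real part; hence the conjugate.\<close>
      have "(1 + \<i>) * (Complex (of_int a) (of_int (- b))) ^ 4 = of_int (X - Y) * (of_int ((X - Y) * g0) + \<i>)"
        unfolding z4' r XY(6)[symmetric] using XY1 by (elim disjE) (simp_all add: complex_eq_iff)
      from quartic_gauss_bound[OF f' f eq0 dd d this] show ?thesis .
    next
      assume r: "u\<^sup>2 - v\<^sup>2 = - X"
      have d': "- (X - Y) = 1 \<or> - (X - Y) = - 1" using d by auto
      have "(1 + \<i>) * (Complex (of_int a) (of_int b)) ^ 4 = of_int (- (X - Y)) * (of_int ((X - Y) * g0) + \<i>)"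
        unfolding z4 r XY(6)[symmetric] using XY1 by (elim disjE) (simp_all add: complex_eq_iff)
      from quartic_gauss_bound[OF ab(3) f eq0 dd d' this] show ?thesis .
    qed
    from pell_neg_square[OF fn f this] show ?thesis .
  qed
qed

section \<open>Exponents of solutions\<close>

text \<open>For nonzero \<open>u\<close> the exponent of 2 would be odd on the left and even on the
  right; the induction is the corresponding descent.\<close>

lemma twice_square_neq:
  fixes u x v :: int
  assumes "2 * x\<^sup>2 = u\<^sup>2 * v" "odd v" shows "u = 0"
  using assms(1)
proof (induction "nat \<bar>u\<bar>" arbitrary: u x rule: less_induct)
  case less
  have "even (u\<^sup>2 * v)" using less.prems by (metis dvd_triv_left)
  then obtain u' where u: "u = 2 * u'" using assms(2) by auto
  with less.prems have x2: "x\<^sup>2 = 2 * (u'\<^sup>2 * v)" by (simp add: power_mult_distrib)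
  then have "even (x\<^sup>2)" by simp
  then obtain x' where x: "x = 2 * x'" by auto
  with x2 have e: "2 * x'\<^sup>2 = u'\<^sup>2 * v" by (simp add: power_mult_distrib)
  show "u = 0"
  proof (rule ccontr)
    assume "u \<noteq> 0"
    then have "nat \<bar>u'\<bar> < nat \<bar>u\<bar>" using u by auto
    from less.hyps[OF this e] u \<open>u \<noteq> 0\<close> show False by simp
  qed
qed

lemma odd_solution_two:
  fixes a y B C :: int
  assumes "odd B" "odd C" and eq: "C * a\<^sup>2 - B * y ^ 4 = 2"
  shows "odd y"
proof
  assume "even y"
  have sq4: "4 dvd z\<^sup>2" if "even z" for z :: int
  proof -
    from that obtain w where "z = 2 * w" by blast
    then show ?thesis by (simp add: power_mult_distrib)
  qed
  have "y ^ 4 = (y\<^sup>2)\<^sup>2" by (simp add: power_mult[symmetric])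
  then have B4: "4 dvd B * y ^ 4" using sq4[of "y\<^sup>2"] \<open>even y\<close> by simp
  then have "even (B * y ^ 4)" using dvd_trans[of 2 4 "B * y ^ 4"] by simp
  moreover have "C * a\<^sup>2 = 2 + B * y ^ 4" using eq by simp
  ultimately have "even (C * a\<^sup>2)" by simp
  then have "even a" using assms(2) by simp
  then have "4 dvd C * a\<^sup>2" using sq4 by simp
  from dvd_diff[OF this B4] show False unfolding eq by simp
qed

text \<open>For \<open>z * z' = 1\<close> and \<open>S = z\<^sup>2 + z'\<^sup>2\<close> this is
  \<open>(z ^ (2 * j + 1) - z' ^ (2 * j + 1)) / (z - z')\<close>, a Lehmer sequence at odd indices.
  It measures the \<open>y\<^sup>2\<close> of a solution against the coordinate of the fundamental
  unit.\<close>

fun lucas_odd :: "int \<Rightarrow> nat \<Rightarrow> int" where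
  "lucas_odd S 0 = 1"
| "lucas_odd S (Suc 0) = S + 1"
| "lucas_odd S (Suc (Suc j)) = S * lucas_odd S (Suc j) - lucas_odd S j"

lemma lucas_odd_eq:
  fixes z z' :: real
  assumes "z * z' = 1" "z\<^sup>2 + z'\<^sup>2 = of_int S"
  shows "z ^ (2 * j + 1) - z' ^ (2 * j + 1) = (z - z') * of_int (lucas_odd S j)"
proof (induction j rule: induct_nat_012)
  case 1
  have "z ^ (2 * Suc 0 + 1) - z' ^ (2 * Suc 0 + 1) = (z - z') * (z\<^sup>2 + z'\<^sup>2 + z * z')"
    by (simp add: algebra_simps power2_eq_square power3_eq_cube eval_nat_numeral)
  also have "\<dots> = (z - z') * of_int (lucas_odd S (Suc 0))" unfolding assms by simp
  finally show ?case .
next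
  case (ge2 j)
  have "z ^ (2 * Suc (Suc j) + 1) - z' ^ (2 * Suc (Suc j) + 1)
      = (z\<^sup>2 + z'\<^sup>2) * (z ^ (2 * Suc j + 1) - z' ^ (2 * Suc j + 1)) - (z * z')\<^sup>2 * (z ^ (2 * j + 1) - z' ^ (2 * j + 1))"
    by (simp add: algebra_simps power_add eval_nat_numeral)
  also have "\<dots> = (z - z') * of_int (lucas_odd S (Suc (Suc j)))"
    unfolding ge2 assms by (simp add: algebra_simps)
  finally show ?case .
qed simp

lemma lucas_odd_mod4:
  assumes "S mod 4 = 2"
  shows "lucas_odd S j mod 4 = (if even j then 1 else 3)"
proof (induction j rule: induct_nat_012)
  case 1
  show ?case using assms by simp presburger
next
  case (ge2 j)
  have "lucas_odd S (Suc (Suc j)) mod 4 = ((S mod 4) * (lucas_odd S (Suc j) mod 4) - lucas_odd S j mod 4) mod 4"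
    unfolding lucas_odd.simps cong_def[symmetric] by (intro cong_diff cong_mult) (simp_all add: cong_def)
  then show ?case unfolding assms ge2 by auto
qed simp

lemma lucas_odd_mod8:
  assumes "S mod 8 = 4"
  shows "lucas_odd S j mod 8 = (if j mod 4 = 0 then 1 else if j mod 4 = 1 then 5 else if j mod 4 = 2 then 3 else 7)"
proof (induction j rule: induct_nat_012)
  case 1
  show ?case using assms by simp presburger
next
  case (ge2 j)
  have "lucas_odd S (Suc (Suc j)) mod 8 = ((S mod 8) * (lucas_odd S (Suc j) mod 8) - lucas_odd S j mod 8) mod 8"
    unfolding lucas_odd.simps cong_def[symmetric] by (intro cong_diff cong_mult) (simp_all add: cong_def)
  moreover have "j mod 4 = 0 \<or> j mod 4 = 1 \<or> j mod 4 = 2 \<or> j mod 4 = 3" by presburger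
  ultimately show ?case unfolding assms ge2 by (elim disjE) (simp_all add: mod_Suc)
qed simp

context quartic_equation
begin

definition units :: "real set" where
  "units = {z. z > 0 \<and> (\<exists>i. conj_pair i z (1 / z))}"

lemma fundamental_unit:
  assumes s: "is_sol a y"
  obtains \<epsilon> i where "\<epsilon> > 1" "conj_pair i \<epsilon> (1 / \<epsilon>)" "\<And>a y. is_sol a y \<Longrightarrow> \<exists>k\<ge>1. sol_unit a y = \<epsilon> ^ k"
proof -
  have sol: "sol_unit a y \<in> units" "sol_unit a y > 1" if "is_sol a y" for a y
    using sol_unit[OF that] unfolding units_def by auto
  obtain \<epsilon> where e: "\<epsilon> \<in> units" "\<epsilon> > 1" "\<And>z. z \<in> units \<Longrightarrow> z > 1 \<Longrightarrow> \<exists>n\<ge>1. z = \<epsilon> ^ n"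
  proof (rule discrete_subgroup_cyclic[of units "sol_unit a y"])
    show "z / w \<in> units" if zw: "z \<in> units" "w \<in> units" for z w
    proof -
      from zw obtain i j where p: "conj_pair i z (1 / z)" "conj_pair j w (1 / w)" and pos: "z > 0" "w > 0"
        unfolding units_def by auto
      have "conj_pair (i \<noteq> j) (z * (1 / w)) (1 / z * w)" using pair_mult[OF p(1) pair_swap[OF p(2)]] .
      then show ?thesis using pos unfolding units_def by auto
    qed
    show "finite (units \<inter> {1..K})" for K
    proof -
      have "units \<inter> {1..K} \<subseteq> (\<Union>i. {z. \<exists>z'. conj_pair i z z' \<and> \<bar>z\<bar> \<le> max K 1 \<and> \<bar>z'\<bar> \<le> max K 1})"
      proof
        fix z assume "z \<in> units \<inter> {1..K}"
        then obtain i where i: "conj_pair i z (1 / z)" and z: "z \<ge> 1" "z \<le> K" unfolding units_def by auto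
        moreover have "1 / z \<le> 1" using z by simp
        moreover have "1 \<le> max K 1" "K \<le> max K 1" "1 / z > 0" using z by simp_all
        ultimately have "\<bar>z\<bar> \<le> max K 1" "\<bar>1 / z\<bar> \<le> max K 1" using z by linarith+
        with i show "z \<in> (\<Union>i. {z. \<exists>z'. conj_pair i z z' \<and> \<bar>z\<bar> \<le> max K 1 \<and> \<bar>z'\<bar> \<le> max K 1})" by blast
      qed
      then show ?thesis by (rule finite_subset) (intro finite_UN_I finite_conj_pair, simp)
    qed
  qed (use sol[OF s] in \<open>auto simp: units_def\<close>)
  obtain i where "conj_pair i \<epsilon> (1 / \<epsilon>)" using e(1) unfolding units_def by blast
  then show thesis using that[OF e(2)] e(3) sol by blast
qed

text \<open>With \<open>k2 = k1 + 2 * l\<close> the power \<open>\<epsilon> ^ l\<close> serves as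
  the square root of the ratio and must have grade \<open>False\<close>. If \<epsilon> has grade
  \<open>True\<close>, this requires \<open>l\<close> to be even, hence the modulus 4.\<close>

lemma sol_unique_same_class:
  assumes e: "\<epsilon> > 1" "conj_pair i \<epsilon> (1 / \<epsilon>)"
    and s: "is_sol a1 y1" "is_sol a2 y2" "sol_unit a1 y1 = \<epsilon> ^ k1" "sol_unit a2 y2 = \<epsilon> ^ k2"
    and k: "[k1 = k2] (mod (if i then 4 else 2))"
  shows "y1 = y2"
proof -
  have *: "y1 = y2" if s: "is_sol a1 y1" "is_sol a2 y2" "sol_unit a1 y1 = \<epsilon> ^ k1" "sol_unit a2 y2 = \<epsilon> ^ k2"
    and k: "[k1 = k2] (mod (if i then 4 else 2))" and le: "k1 \<le> k2" for a1 a2 y1 y2 k1 k2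
  proof -
    have "(if i then 4 else 2) dvd k2 - k1" using k le by (metis cong_sym cong_altdef_nat)
    then obtain h where h: "k2 - k1 = (if i then 4 else 2) * h" by (elim dvdE)
    define l where "l = (if i then 2 else 1) * h"
    have l: "k2 = k1 + 2 * l" using h le unfolding l_def by (cases i) auto
    have "(i \<and> odd l) = False" unfolding l_def by auto
    then have "conj_pair False (\<epsilon> ^ l) ((1 / \<epsilon>) ^ l)" using pair_power[OF e(2), of l] by (simp only:)
    then have g: "conj_pair False (\<epsilon> ^ l) (1 / \<epsilon> ^ l)" by (simp add: power_one_over)
    have "sol_unit a2 y2 = (\<epsilon> ^ l)\<^sup>2 * sol_unit a1 y1" unfolding s l by (simp add: power_add power_mult mult.commute power2_eq_square power_mult_distrib)
    from sol_unique_modulo_squares[OF s(1,2) g _ this] e(1) show ?thesis by simp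
  qed
  show ?thesis
  proof (cases "k1 \<le> k2")
    case True
    from *[OF s k True] show ?thesis .
  next
    case False
    with *[OF s(2,1,4,3) cong_sym[OF k]] show ?thesis by simp
  qed
qed

text \<open>Half the trace of the unit is \<open>a * rC\<close>. In grade \<open>False\<close> it
  would be an integer, which makes \<open>c * C\<close> a square.\<close>

lemma sol_not_grade_False:
  assumes ns: "\<And>k :: int. k\<^sup>2 \<noteq> c * C" and s: "is_sol a y"
  shows "\<not> conj_pair False (sol_unit a y) (1 / sol_unit a y)"
proof
  assume "conj_pair False (sol_unit a y) (1 / sol_unit a y)"
  then obtain p q :: int where "sol_unit a y = p + q * rN" "1 / sol_unit a y = p - q * rN"
    unfolding conj_pair_def by auto
  then have "2 * of_int a * rC = 2 * of_int p" using sol_unit(4)[OF s] by simp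
  then have "(of_int a * rC)\<^sup>2 = (of_int p)\<^sup>2" by simp
  then have "of_int c * ((of_int a)\<^sup>2 * (rC * rC)) = of_int c * (of_int p)\<^sup>2" by (simp add: power2_eq_square mult_ac)
  then have "(of_int a)\<^sup>2 * real_of_int C = of_int c * (of_int p)\<^sup>2" using c_pos unfolding r_mult by simp
  then have "real_of_int (a\<^sup>2 * C) = of_int (c * p\<^sup>2)" by (simp only: of_int_mult of_int_power)
  then have e: "a\<^sup>2 * C = c * p\<^sup>2" by (simp only: of_int_eq_iff)
  have a: "a > 0" using s unfolding is_sol_def by simp
  have e2: "a\<^sup>2 * (c * C) = (c * p)\<^sup>2" using e by (simp add: power_mult_distrib power2_eq_square mult_ac)
  then have "a\<^sup>2 dvd (c * p)\<^sup>2" by (metis dvd_triv_left)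
  then have "a dvd c * p" by simp
  then obtain m where "c * p = a * m" by (elim dvdE)
  with e2 a have "c * C = m\<^sup>2" by (simp add: power_mult_distrib)
  with ns show False by metis
qed

text \<open>By \<open>sol_not_grade_False\<close> the fundamental unit has grade \<open>True\<close>
  and solutions occur only among its odd powers. \<open>b\<close> is its coordinate at
  \<open>rB\<close> and \<open>S\<close> the trace of its square.\<close>

lemma sol_in_lucas:
  assumes ns: "\<And>k :: int. k\<^sup>2 \<noteq> c * C" and s: "is_sol a y"
  obtains \<epsilon> b S where "\<epsilon> > 1" "conj_pair True \<epsilon> (1 / \<epsilon>)" "b > 0" "c * S = 4 * B * b\<^sup>2 + 2 * c"
    "\<And>a y. is_sol a y \<Longrightarrow> \<exists>j. sol_unit a y = \<epsilon> ^ (2 * j + 1) \<and> y\<^sup>2 = b * lucas_odd S j"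
proof -
  obtain \<epsilon> i where e: "\<epsilon> > 1" "conj_pair i \<epsilon> (1 / \<epsilon>)" "\<And>a y. is_sol a y \<Longrightarrow> \<exists>k\<ge>1. sol_unit a y = \<epsilon> ^ k"
    using fundamental_unit[OF s] by blast
  have odd: "i \<and> odd k" if "is_sol a y" "sol_unit a y = \<epsilon> ^ k" for a y k
  proof (rule ccontr)
    assume "\<not> (i \<and> odd k)"
    with pair_power[OF e(2), of k] have "conj_pair False (\<epsilon> ^ k) ((1 / \<epsilon>) ^ k)" by (simp only:)
    with sol_not_grade_False[OF ns that(1)] that(2) show False by (simp add: power_one_over)
  qed
  have i: i using e(3)[OF s] odd[OF s] by blast
  with e(2) obtain a0 b :: int where ab: "\<epsilon> = a0 * rC + b * rB" "1 / \<epsilon> = a0 * rC - b * rB"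
    unfolding conj_pair_def by auto
  have "1 / \<epsilon> < 1" using e(1) by simp
  then have d: "\<epsilon> - 1 / \<epsilon> = 2 * of_int b * rB" "2 * of_int b * rB > 0" using ab e(1) by linarith+
  then have b: "b > 0" using r_pos by (simp add: zero_less_mult_iff)
  obtain n :: int where n: "\<epsilon>\<^sup>2 + (1 / \<epsilon>)\<^sup>2 = of_int (2 * n)" using pair_sum_squares[OF e(2)] by auto
  have "c * (\<epsilon>\<^sup>2 + (1 / \<epsilon>)\<^sup>2) = c * ((\<epsilon> - 1 / \<epsilon>)\<^sup>2 + 2)" using e(1) by (simp add: power2_eq_square algebra_simps)
  also have "\<dots> = 4 * (of_int b)\<^sup>2 * (c * (rB * rB)) + 2 * c" unfolding d by (simp add: power2_eq_square algebra_simps)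
  also have "\<dots> = of_int (4 * B * b\<^sup>2 + 2 * c)" unfolding r_mult using c_pos by simp
  finally have "real_of_int (c * (2 * n)) = of_int (4 * B * b\<^sup>2 + 2 * c)" unfolding n by simp
  then have S: "c * (2 * n) = 4 * B * b\<^sup>2 + 2 * c" by (simp only: of_int_eq_iff)
  have "\<exists>j. sol_unit a y = \<epsilon> ^ (2 * j + 1) \<and> y\<^sup>2 = b * lucas_odd (2 * n) j" if s: "is_sol a y" for a y
  proof -
    obtain k where k: "sol_unit a y = \<epsilon> ^ k" using e(3)[OF s] by blast
    with odd[OF s] obtain j where j: "k = 2 * j + 1" by (metis oddE)
    have "\<epsilon> ^ (2 * j + 1) - (1 / \<epsilon>) ^ (2 * j + 1) = (\<epsilon> - 1 / \<epsilon>) * of_int (lucas_odd (2 * n) j)"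
      by (rule lucas_odd_eq) (use e(1) n in auto)
    moreover have "\<epsilon> ^ (2 * j + 1) - (1 / \<epsilon>) ^ (2 * j + 1) = 2 * of_int (y\<^sup>2) * rB"
      using sol_unit(3)[OF s] unfolding k j power_one_over .
    ultimately have "2 * of_int (y\<^sup>2) * rB = 2 * of_int b * rB * of_int (lucas_odd (2 * n) j)"
      unfolding d(1) by (simp only:)
    then have "of_int (y\<^sup>2) * (2 * rB) = of_int (b * lucas_odd (2 * n) j) * (2 * rB)" by (simp only: of_int_mult mult_ac)
    then have "real_of_int (y\<^sup>2) = of_int (b * lucas_odd (2 * n) j)" using r_pos by (simp only: mult_cancel_right) simp
    then have "y\<^sup>2 = b * lucas_odd (2 * n) j" by (simp only: of_int_eq_iff)
    with k j show ?thesis by blast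
  qed
  with that[OF e(1) _ b S] e(2) i show thesis by simp
qed

text \<open>The unknown \<open>b\<close> drops out of the product, leaving a condition on the
  indices alone.\<close>

lemma lucas_ratio_square:
  assumes "y1\<^sup>2 = b * lucas_odd S j1" "y2\<^sup>2 = b * lucas_odd S j2" "b > 0"
  obtains t where "lucas_odd S j1 * lucas_odd S j2 = t\<^sup>2"
proof -
  have e: "(y1 * y2)\<^sup>2 = b\<^sup>2 * (lucas_odd S j1 * lucas_odd S j2)"
    unfolding power_mult_distrib assms by (simp add: power2_eq_square)
  then have "b\<^sup>2 dvd (y1 * y2)\<^sup>2" by simp
  then have "b dvd y1 * y2" by simp
  then obtain t where "y1 * y2 = b * t" by (elim dvdE)
  with e assms(3) have "lucas_odd S j1 * lucas_odd S j2 = t\<^sup>2" by (simp add: power_mult_distrib)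
  then show thesis by (rule that)
qed

text \<open>\<open>S\<close> is 2 modulo 4, so the Lucas values alternate between 1 and 3 modulo 4.
  A square product forces indices of equal parity, that is, exponents congruent modulo 4.\<close>

theorem sol_unique_one:
  assumes c: "c = 1" and ns: "\<And>k :: int. k\<^sup>2 \<noteq> C" and s: "is_sol a1 y1" "is_sol a2 y2"
  shows "y1 = y2"
proof -
  have ns': "k\<^sup>2 \<noteq> c * C" for k using ns c by simp
  obtain \<epsilon> b S where e: "\<epsilon> > 1" "conj_pair True \<epsilon> (1 / \<epsilon>)" "b > 0" "c * S = 4 * B * b\<^sup>2 + 2 * c"
    and j: "\<And>a y. is_sol a y \<Longrightarrow> \<exists>j. sol_unit a y = \<epsilon> ^ (2 * j + 1) \<and> y\<^sup>2 = b * lucas_odd S j"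
    using sol_in_lucas[OF ns' s(1)] by blast
  from j[OF s(1)] j[OF s(2)] obtain j1 j2 where k: "sol_unit a1 y1 = \<epsilon> ^ (2 * j1 + 1)" "sol_unit a2 y2 = \<epsilon> ^ (2 * j2 + 1)"
    and y: "y1\<^sup>2 = b * lucas_odd S j1" "y2\<^sup>2 = b * lucas_odd S j2" by blast
  have "S = 4 * (B * b\<^sup>2) + 2" using e(4) c by simp
  then have S: "S mod 4 = 2" by presburger
  obtain t where t: "lucas_odd S j1 * lucas_odd S j2 = t\<^sup>2" using lucas_ratio_square[OF y e(3)] .
  have "even j1 = even j2"
  proof (rule ccontr)
    assume ne: "even j1 \<noteq> even j2"
    have "t\<^sup>2 mod 4 = ((lucas_odd S j1 mod 4) * (lucas_odd S j2 mod 4)) mod 4" unfolding t[symmetric] by (simp add: mod_simps)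
    also have "\<dots> = 3" unfolding lucas_odd_mod4[OF S] using ne by auto
    finally have t3: "t\<^sup>2 mod 4 = 3" .
    have "t mod 4 = 0 \<or> t mod 4 = 1 \<or> t mod 4 = 2 \<or> t mod 4 = 3" by presburger
    then have "(t mod 4)\<^sup>2 mod 4 \<noteq> 3" by auto
    with t3 show False by (simp add: power_mod)
  qed
  then have "[2 * j1 + 1 = 2 * j2 + 1] (mod 4)" unfolding cong_def by presburger
  then show ?thesis using sol_unique_same_class[OF e(1,2) s k] by simp
qed

text \<open>Since \<open>y1\<close> is odd, so is \<open>b\<close>, and
  \<open>S = 2 * B * b\<^sup>2 + 2\<close> is 4 modulo 8. The Lucas values then run through 1, 5, 3,
  7 modulo 8, and the product of two different ones is never 1, the only odd square.\<close>

theorem sol_unique_two: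
  assumes c: "c = 2" "B mod 4 = 1" and ns: "\<And>k :: int. k\<^sup>2 \<noteq> 2 * C" and s: "is_sol a1 y1" "is_sol a2 y2"
  shows "y1 = y2"
proof -
  have ns': "k\<^sup>2 \<noteq> c * C" for k using ns c by simp
  have odd: "odd B" "odd C" using c_cases c by auto
  obtain \<epsilon> b S where e: "\<epsilon> > 1" "conj_pair True \<epsilon> (1 / \<epsilon>)" "b > 0" "c * S = 4 * B * b\<^sup>2 + 2 * c"
    and j: "\<And>a y. is_sol a y \<Longrightarrow> \<exists>j. sol_unit a y = \<epsilon> ^ (2 * j + 1) \<and> y\<^sup>2 = b * lucas_odd S j"
    using sol_in_lucas[OF ns' s(1)] by blast
  from j[OF s(1)] j[OF s(2)] obtain j1 j2 where k: "sol_unit a1 y1 = \<epsilon> ^ (2 * j1 + 1)" "sol_unit a2 y2 = \<epsilon> ^ (2 * j2 + 1)"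
    and y: "y1\<^sup>2 = b * lucas_odd S j1" "y2\<^sup>2 = b * lucas_odd S j2" by blast
  have "C * a1\<^sup>2 - B * y1 ^ 4 = 2" using s(1) c unfolding is_sol_def by simp
  then have "odd y1" by (rule odd_solution_two[OF odd])
  then have "odd (b * lucas_odd S j1)" unfolding y(1)[symmetric] by simp
  then have "odd b" by simp
  then obtain b' where b': "b = 2 * b' + 1" by (elim oddE)
  have "even (b' * (b' + 1))" by simp
  then obtain d where d: "b' * (b' + 1) = 2 * d" by blast
  have "b\<^sup>2 = 4 * (b' * (b' + 1)) + 1" unfolding b' by (simp add: power2_eq_square algebra_simps)
  then have b2: "b\<^sup>2 = 8 * d + 1" unfolding d by simp
  define B' where "B' = B div 4"
  have B': "B = 4 * B' + 1" unfolding B'_def using c(2) by presburger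
  have "S = 2 * (B * b\<^sup>2) + 2" using e(4) c by simp
  then have "S = 8 * (8 * (B' * d) + 2 * d + B') + 4" unfolding b2 B' by (simp add: algebra_simps)
  then obtain m where "S = 8 * m + 4" by blast
  then have S: "S mod 8 = 4" by presburger
  obtain t where t: "lucas_odd S j1 * lucas_odd S j2 = t\<^sup>2" using lucas_ratio_square[OF y e(3)] .
  have "j1 mod 4 = j2 mod 4"
  proof (rule ccontr)
    assume ne: "j1 mod 4 \<noteq> j2 mod 4"
    have "t\<^sup>2 mod 8 = ((lucas_odd S j1 mod 8) * (lucas_odd S j2 mod 8)) mod 8" unfolding t[symmetric] by (simp add: mod_simps)
    also have "\<dots> \<in> {3, 5, 7}"
    proof -
      have "j1 mod 4 = 0 \<or> j1 mod 4 = 1 \<or> j1 mod 4 = 2 \<or> j1 mod 4 = 3" "j2 mod 4 = 0 \<or> j2 mod 4 = 1 \<or> j2 mod 4 = 2 \<or> j2 mod 4 = 3"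
        by presburger+
      then show ?thesis unfolding lucas_odd_mod8[OF S] using ne by auto
    qed
    finally have t3: "t\<^sup>2 mod 8 \<in> {3, 5, 7}" .
    have "t mod 8 = 0 \<or> t mod 8 = 1 \<or> t mod 8 = 2 \<or> t mod 8 = 3 \<or> t mod 8 = 4 \<or> t mod 8 = 5 \<or> t mod 8 = 6 \<or> t mod 8 = 7"
      by presburger
    then have "(t mod 8)\<^sup>2 mod 8 \<notin> {3, 5, 7}" by (elim disjE) simp_all
    with t3 show False by (simp add: power_mod)
  qed
  then have "[2 * j1 + 1 = 2 * j2 + 1] (mod 4)" by (intro cong_add cong_mult) (simp_all add: cong_def)
  then show ?thesis using sol_unique_same_class[OF e(1,2) s k] by simp
qed

text \<open>If \<open>B\<close> is 3 modulo 4, then \<open>S\<close> is divisible by 8 and the Lucas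
  values 1, 1, 7, 7 modulo 8 leave the parity of the index open. The two parities are the two
  classes of odd exponents modulo 4.\<close>

theorem sol_at_most_two:
  assumes c: "c = 2" and ns: "\<And>k :: int. k\<^sup>2 \<noteq> 2 * C" and s: "is_sol a1 y1" "is_sol a2 y2" "is_sol a3 y3"
  shows "y1 = y2 \<or> y1 = y3 \<or> y2 = y3"
proof -
  have ns': "k\<^sup>2 \<noteq> c * C" for k using ns c by simp
  obtain \<epsilon> b S where e: "\<epsilon> > 1" "conj_pair True \<epsilon> (1 / \<epsilon>)"
    and j: "\<And>a y. is_sol a y \<Longrightarrow> \<exists>j. sol_unit a y = \<epsilon> ^ (2 * j + 1) \<and> y\<^sup>2 = b * lucas_odd S j"
    using sol_in_lucas[OF ns' s(1)] by metis
  from j[OF s(1)] j[OF s(2)] j[OF s(3)] obtain j1 j2 j3 where k: "sol_unit a1 y1 = \<epsilon> ^ (2 * j1 + 1)"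
    "sol_unit a2 y2 = \<epsilon> ^ (2 * j2 + 1)" "sol_unit a3 y3 = \<epsilon> ^ (2 * j3 + 1)" by blast
  consider "even j1 = even j2" | "even j1 = even j3" | "even j2 = even j3" by blast
  then show ?thesis
  proof cases
    case 1
    then have "[2 * j1 + 1 = 2 * j2 + 1] (mod 4)" unfolding cong_def by presburger
    then show ?thesis using sol_unique_same_class[OF e s(1,2) k(1,2)] by simp
  next
    case 2
    then have "[2 * j1 + 1 = 2 * j3 + 1] (mod 4)" unfolding cong_def by presburger
    then show ?thesis using sol_unique_same_class[OF e s(1,3) k(1,3)] by simp
  next
    case 3
    then have "[2 * j2 + 1 = 2 * j3 + 1] (mod 4)" unfolding cong_def by presburger
    then show ?thesis using sol_unique_same_class[OF e s(2,3) k(2,3)] by simp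
  qed
qed


text \<open>For \<open>C = c = 1\<close> both grades describe the same ring, so even exponents are
  possible too, but now two exponents of equal parity already exclude each other. Only a pair of
  opposite parity has to be ruled out.\<close>

theorem sol_unique_pell:
  assumes c: "c = 1" "C = 1" and B: "even B" "\<And>w :: int. B * w ^ 4 \<noteq> 28560"
    and lj: "\<And>f r :: int. r\<^sup>2 = 2 * f ^ 4 - 1 \<Longrightarrow> f > 0 \<Longrightarrow> f = 1 \<or> f = 13"
    and s: "is_sol a1 y1" "is_sol a2 y2"
  shows "y1 = y2"
proof -
  have rC: "rC = 1" and rNB: "rN = rB" unfolding rC_def rN_def rB_def using c by simp_all
  have rBB: "rB * rB = B" using r_mult(1) c by simp
  obtain \<epsilon> i where e: "\<epsilon> > 1" and ei: "conj_pair i \<epsilon> (1 / \<epsilon>)" and ek: "\<And>a y. is_sol a y \<Longrightarrow> \<exists>k\<ge>1. sol_unit a y = \<epsilon> ^ k"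
    using fundamental_unit[OF s(1)] by blast
  have eF: "conj_pair False \<epsilon> (1 / \<epsilon>)" using ei unfolding conj_pair_def rC rNB by (cases i) auto
  have coords: "\<exists>r t :: int. r > 0 \<and> t > 0 \<and> r\<^sup>2 - B * t\<^sup>2 = 1 \<and> \<epsilon> ^ m = of_int r + of_int t * rB \<and> 1 / \<epsilon> ^ m = of_int r - of_int t * rB"
    if m: "m \<ge> 1" for m
  proof -
    have "conj_pair False (\<epsilon> ^ m) ((1 / \<epsilon>) ^ m)" using pair_power[OF eF, of m] by simp
    then obtain r t :: int where rt: "\<epsilon> ^ m = of_int r + of_int t * rB" "1 / \<epsilon> ^ m = of_int r - of_int t * rB"
      unfolding conj_pair_def rNB by (auto simp: power_one_over)
    have em: "\<epsilon> ^ m > 1" using e m by (simp add: one_less_power)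
    then have "1 / \<epsilon> ^ m < 1" "1 / \<epsilon> ^ m > 0" by simp_all
    then have "real_of_int r > 0" "of_int t * rB > 0" using em rt by linarith+
    then have pos: "r > 0" "t > 0" using r_pos by (simp_all add: zero_less_mult_iff)
    have "\<epsilon> ^ m * (1 / \<epsilon> ^ m) = 1" using e by simp
    then have "(of_int r + of_int t * rB) * (of_int r - of_int t * rB) = (1 :: real)" unfolding rt(2) unfolding rt(1) .
    then have "(of_int r)\<^sup>2 - (rB * rB) * (of_int t)\<^sup>2 = (1 :: real)" by (simp add: algebra_simps power2_eq_square)
    then have "real_of_int (r\<^sup>2 - B * t\<^sup>2) = of_int 1" unfolding rBB by simp
    then have "r\<^sup>2 - B * t\<^sup>2 = 1" by (simp only: of_int_eq_iff)
    with pos rt show ?thesis by blast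
  qed
  have cop: "coprime r t" if "r\<^sup>2 - B * t\<^sup>2 = 1" for r t :: int
  proof (rule coprimeI)
    fix d assume "d dvd r" "d dvd t"
    then have "d dvd r * r - B * t * t" by (intro dvd_diff) simp_all
    with that show "is_unit d" by (simp add: power2_eq_square mult.assoc)
  qed
  have rB0: "rB > 0" using r_pos by simp
  have False if s: "is_sol a1 y1" "is_sol a2 y2" and k1: "odd k1" "sol_unit a1 y1 = \<epsilon> ^ k1"
    and k2: "even k2" "sol_unit a2 y2 = \<epsilon> ^ k2" "k2 \<ge> 1" for a1 a2 y1 y2 k1 k2
  proof -
    have y1: "y1 > 0" using s(1) unfolding is_sol_def by simp
    obtain m where m: "k2 = 2 * m" using k2(1) by blast
    with k2(3) have m1: "m \<ge> 1" by simp
    obtain r0 t0 :: int where r0: "r0 > 0" "t0 > 0" "r0\<^sup>2 - B * t0\<^sup>2 = 1"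
      "\<epsilon> ^ m = of_int r0 + of_int t0 * rB" "1 / \<epsilon> ^ m = of_int r0 - of_int t0 * rB" using coords[OF m1] by blast
    have "2 * of_int (y2\<^sup>2) * rB = \<epsilon> ^ k2 - 1 / \<epsilon> ^ k2" using sol_unit(3)[OF s(2)] unfolding k2(2) by simp
    also have "\<dots> = (\<epsilon> ^ m)\<^sup>2 - (1 / \<epsilon> ^ m)\<^sup>2" unfolding m by (simp add: power_mult mult.commute[of 2] power_one_over)
    also have "\<dots> = of_int (2 * r0 * t0) * (2 * rB)" unfolding r0(5) unfolding r0(4) by (simp add: power2_eq_square algebra_simps)
    finally have "of_int (y2\<^sup>2) * (2 * rB) = of_int (2 * r0 * t0) * (2 * rB)" by (simp only: mult_ac)
    then have "real_of_int (y2\<^sup>2) = of_int (2 * r0 * t0)" using rB0 by (simp only: mult_cancel_right) simp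
    then have "y2\<^sup>2 = 2 * r0 * t0" by (simp only: of_int_eq_iff)
    then have y2: "r0 * (2 * t0) = y2\<^sup>2" by simp
    have "r0\<^sup>2 = 1 + B * t0\<^sup>2" using r0(3) by simp
    then have "odd (r0\<^sup>2)" using B(1) by simp
    \<comment> \<open>As \<open>B\<close> is even, \<open>r0\<close> is odd, so the factor 2 of
      \<open>2 * r0 * t0\<close> belongs to \<open>t0\<close>.\<close>
    then have c2: "coprime r0 (2 * t0)" using cop[OF r0(3)] by simp
    have "2 * t0 > 0" using r0 by simp
    from coprime_mult_square_int[OF y2 c2 r0(1) this]
    obtain r t where r: "r0 = r\<^sup>2" and t: "2 * t0 = t\<^sup>2" by metis
    have "even (t\<^sup>2)" unfolding t[symmetric] by simp
    then obtain t' where "t = 2 * t'" by auto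
    with t have t0: "t0 = 2 * t'\<^sup>2" by (simp add: power_mult_distrib)
    show False
    proof (cases "odd m")
      case True
      \<comment> \<open>\<open>t0\<close> and \<open>y1\<^sup>2\<close> are both \<open>b\<close>
        times an odd Lucas value, while \<open>t0\<close> is twice a square: a clash of exponents of
        2.\<close>
      then obtain j where j: "m = 2 * j + 1" by (elim oddE)
      obtain j1 where j1: "k1 = 2 * j1 + 1" using k1(1) by (elim oddE)
      obtain q b :: int where b: "b > 0" "q\<^sup>2 - B * b\<^sup>2 = 1" "\<epsilon> ^ 1 = of_int q + of_int b * rB" "1 / \<epsilon> ^ 1 = of_int q - of_int b * rB"
        using coords[of 1] by blast
      have b': "\<epsilon> = of_int q + of_int b * rB" "1 / \<epsilon> = of_int q - of_int b * rB" using b(3,4) by (simp_all only: power_one_right)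
      define S where "S = 2 * (q\<^sup>2 + B * b\<^sup>2)"
      have d: "\<epsilon> - 1 / \<epsilon> = 2 * of_int b * rB" using b' by linarith
      have "\<epsilon>\<^sup>2 + (1 / \<epsilon>)\<^sup>2 = (of_int q + of_int b * rB)\<^sup>2 + (of_int q - of_int b * rB)\<^sup>2" by (simp only: b'(2)) (simp only: b'(1))
      also have "\<dots> = 2 * ((of_int q)\<^sup>2 + (rB * rB) * (of_int b)\<^sup>2)" by (simp add: power2_eq_square algebra_simps)
      finally have S: "\<epsilon>\<^sup>2 + (1 / \<epsilon>)\<^sup>2 = of_int S" unfolding rBB S_def by simp
      have S4: "S mod 4 = 2"
      proof -
        have "S = 4 * (B * b\<^sup>2) + 2" using b(2) unfolding S_def by simp
        then show ?thesis by presburger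
      qed
      have lucas: "\<epsilon> ^ (2 * j + 1) - 1 / \<epsilon> ^ (2 * j + 1) = of_int (b * lucas_odd S j) * (2 * rB)" for j
        using lucas_odd_eq[of \<epsilon> "1 / \<epsilon>" S j] S e unfolding d power_one_over by simp
      have "of_int t0 * (2 * rB) = of_int (b * lucas_odd S j) * (2 * rB)" using lucas[of j] r0(4,5) unfolding j by linarith
      then have "real_of_int t0 = of_int (b * lucas_odd S j)" using rB0 by (simp only: mult_cancel_right) simp
      then have l: "t0 = b * lucas_odd S j" by (simp only: of_int_eq_iff)
      have "of_int (y1\<^sup>2) * (2 * rB) = of_int (b * lucas_odd S j1) * (2 * rB)"
        using lucas[of j1] sol_unit(3)[OF s(1)] unfolding k1(2) j1 by linarith
      then have "real_of_int (y1\<^sup>2) = of_int (b * lucas_odd S j1)" using rB0 by (simp only: mult_cancel_right) simp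
      then have l1: "y1\<^sup>2 = b * lucas_odd S j1" by (simp only: of_int_eq_iff)
      have "2 * (t' * y1)\<^sup>2 = t0 * y1\<^sup>2" unfolding t0 by (simp add: power_mult_distrib)
      then have eq: "2 * (t' * y1)\<^sup>2 = b\<^sup>2 * (lucas_odd S j * lucas_odd S j1)" unfolding l l1 by (simp add: power2_eq_square)
      have "odd (lucas_odd S j)" for j
      proof -
        have "lucas_odd S j mod 4 = 1 \<or> lucas_odd S j mod 4 = 3" using lucas_odd_mod4[OF S4, of j] by simp
        then show ?thesis by presburger
      qed
      with twice_square_neq[OF eq] b(1) show False by simp
    next
      case False
      \<comment> \<open>Here \<open>\<epsilon> ^ k2\<close> is a fourth power; a second halving
        gives \<open>r0 = 2 * f ^ 4 - 1\<close> and, as \<open>r0 = r\<^sup>2\<close>, Ljunggren's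
        equation.\<close>
      then obtain n where n: "m = 2 * n" by blast
      with m1 have n1: "n \<ge> 1" by simp
      obtain r1 t1 :: int where r1: "r1 > 0" "t1 > 0" "r1\<^sup>2 - B * t1\<^sup>2 = 1"
        "\<epsilon> ^ n = of_int r1 + of_int t1 * rB" "1 / \<epsilon> ^ n = of_int r1 - of_int t1 * rB" using coords[OF n1] by blast
      have sq: "\<epsilon> ^ m = (\<epsilon> ^ n)\<^sup>2" "1 / \<epsilon> ^ m = (1 / \<epsilon> ^ n)\<^sup>2"
        unfolding n by (simp_all add: power_mult mult.commute[of 2] power_one_over)
      define X where "X = (of_int r1)\<^sup>2 + (rB * rB) * (of_int t1)\<^sup>2"
      define Y where "Y = of_int (2 * r1 * t1) * rB"
      have "(of_int r1 + of_int t1 * rB)\<^sup>2 = X + Y" "(of_int r1 - of_int t1 * rB)\<^sup>2 = X - Y"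
        unfolding X_def Y_def by (simp_all add: power2_eq_square algebra_simps)
      with sq r1(4,5) r0(4,5) have "of_int r0 + of_int t0 * rB = X + Y" "of_int r0 - of_int t0 * rB = X - Y" by metis+
      then have "of_int r0 = X" "of_int t0 * rB = Y" by linarith+
      then have "of_int r0 = (of_int r1)\<^sup>2 + (rB * rB) * (of_int t1)\<^sup>2" "of_int t0 * rB = of_int (2 * r1 * t1) * rB"
        unfolding X_def Y_def .
      then have "real_of_int r0 = of_int (r1\<^sup>2 + B * t1\<^sup>2)" "real_of_int t0 = of_int (2 * r1 * t1)"
        using rB0 unfolding rBB by simp_all
      then have rt: "r0 = r1\<^sup>2 + B * t1\<^sup>2" "t0 = 2 * r1 * t1" by (simp_all only: of_int_eq_iff)
      have "r1 * t1 = t'\<^sup>2" using rt(2) t0 by simp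
      from coprime_mult_square_int[OF this cop[OF r1(3)] r1(1,2)]
      obtain f w where f: "f > 0" "r1 = f\<^sup>2" and w: "t1 = w\<^sup>2" by metis
      have "r\<^sup>2 = 2 * (f\<^sup>2)\<^sup>2 - 1" using r rt(1) r1(3) f by simp
      then have "r\<^sup>2 = 2 * f ^ 4 - 1" by (simp add: power2_eq_square power4_eq_xxxx)
      from lj[OF this f(1)] have f13: "f = 1 \<or> f = 13" .
      have Bw: "B * w ^ 4 = f ^ 4 - 1" using r1(3) unfolding f(2) w by (simp add: power2_eq_square power4_eq_xxxx)
      have "w \<noteq> 0" using r1(2) w by auto
      then have "B * w ^ 4 \<noteq> 0" using B_pos by simp
      \<comment> \<open>\<open>f = 1\<close> gives \<open>w = 0\<close>, and \<open>f = 13\<close>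
        gives \<open>B * w ^ 4 = 13 ^ 4 - 1 = 28560\<close>.\<close>
      with f13 Bw B(2)[of w] show False by auto
    qed
  qed
  note mixed = this
  obtain k1 k2 where k: "k1 \<ge> 1" "k2 \<ge> 1" "sol_unit a1 y1 = \<epsilon> ^ k1" "sol_unit a2 y2 = \<epsilon> ^ k2" using ek s by blast
  have "even k1 = even k2" using mixed[OF s _ k(3) _ k(4,2)] mixed[OF s(2,1) _ k(4) _ k(3,1)] by blast
  then have "[k1 = k2] (mod (if False then 4 else 2))" unfolding cong_def by simp presburger
  from sol_unique_same_class[OF e eF s k(3,4) this] show ?thesis .
qed

end

section \<open>Counting solutions of the quartic equations\<close>

lemma card_le_1:
  assumes "\<And>x y. x \<in> S \<Longrightarrow> y \<in> S \<Longrightarrow> x = y"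
  shows "finite S \<and> card S \<le> 1"
proof (cases "S = {}")
  case False
  then obtain x where "x \<in> S" by blast
  with assms have "S = {x}" by blast
  then show ?thesis by simp
qed simp

lemma card_le_2:
  assumes "\<And>x y z. x \<in> S \<Longrightarrow> y \<in> S \<Longrightarrow> z \<in> S \<Longrightarrow> x = y \<or> x = z \<or> y = z"
  shows "finite S \<and> card S \<le> 2"
proof (cases "\<exists>x y. x \<in> S \<and> y \<in> S \<and> x \<noteq> y")
  case True
  then obtain x y where xy: "x \<in> S" "y \<in> S" "x \<noteq> y" by blast
  with assms have "S = {x, y}" by blast
  then show ?thesis using xy(3) by simp
next
  case False
  then have "finite S \<and> card S \<le> 1" by (intro card_le_1) blast
  then show ?thesis by auto
qed

section \<open>Reduction to quartic equations\<close>

text \<open>Only \<open>y\<close> is kept, since in each family it determines \<open>x\<close>; the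
  sign of \<open>a\<close> is left free.\<close>

definition quartic_sols :: "int \<Rightarrow> int \<Rightarrow> int \<Rightarrow> int set" where
  "quartic_sols B C c = {y. y > 0 \<and> (\<exists>a. C * a\<^sup>2 - B * y ^ 4 = c)}"

lemma quartic_sols_is_sol:
  assumes "quartic_equation B C c" "y \<in> quartic_sols B C c"
  shows "\<exists>a. quartic_equation.is_sol B C c a y"
proof -
  obtain a where a: "y > 0" "C * a\<^sup>2 - B * y ^ 4 = c" using assms(2) unfolding quartic_sols_def by blast
  have "a \<noteq> 0"
  proof
    assume "a = 0"
    moreover have "B * y ^ 4 > 0" using a(1) assms(1) unfolding quartic_equation_def by simp
    ultimately show False using a(2) assms(1) unfolding quartic_equation_def by auto
  qed
  then have "quartic_equation.is_sol B C c \<bar>a\<bar> y" using a unfolding quartic_equation.is_sol_def[OF assms(1)] by simp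
  then show ?thesis by blast
qed

lemma at_most_mono: "at_most m S \<Longrightarrow> m \<le> n \<Longrightarrow> at_most n S"
  unfolding at_most_def by simp

lemma at_most_empty: "S = {} \<Longrightarrow> at_most n S"
  unfolding at_most_def by simp

lemma at_most_image: "at_most n S \<Longrightarrow> at_most n (f ` S)"
  unfolding at_most_def by (auto intro: order_trans[OF card_image_le])

lemma at_most_Un: "at_most m S \<Longrightarrow> at_most n T \<Longrightarrow> at_most (m + n) (S \<union> T)"
  unfolding at_most_def using card_Un_le[of S T] by auto

lemma at_most_subset: "at_most n T \<Longrightarrow> S \<subseteq> T \<Longrightarrow> at_most n S"
  unfolding at_most_def by (auto intro: finite_subset order_trans[OF card_mono])

lemma quartic_sols_one:
  assumes "B > 0" "C > 0" "\<And>k :: int. k\<^sup>2 \<noteq> C"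
  shows "at_most 1 (quartic_sols B C 1)"
proof -
  interpret quartic_equation B C 1 using assms by unfold_locales auto
  show ?thesis unfolding at_most_def
    using card_le_1[of "quartic_sols B C 1"] sol_unique_one[OF refl assms(3)] quartic_sols_is_sol[OF quartic_equation_axioms] by metis
qed

lemma odd_twice_not_square: "odd C \<Longrightarrow> (k :: int)\<^sup>2 \<noteq> 2 * C"
proof
  assume "odd C" "k\<^sup>2 = 2 * C"
  then have "even (k\<^sup>2)" by simp
  then obtain j where "k = 2 * j" by auto
  with \<open>k\<^sup>2 = 2 * C\<close> have "C = 2 * j\<^sup>2" by (simp add: power_mult_distrib)
  with \<open>odd C\<close> show False by simp
qed

lemma quartic_sols_two:
  assumes "B > 0" "C > 0" "odd B" "odd C"
  shows "at_most 2 (quartic_sols B C 2)" "B mod 4 = 1 \<Longrightarrow> at_most 1 (quartic_sols B C 2)"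
proof -
  interpret quartic_equation B C 2 using assms by unfold_locales auto
  note ns = odd_twice_not_square[OF assms(4)]
  show "at_most 2 (quartic_sols B C 2)" unfolding at_most_def
    using card_le_2[of "quartic_sols B C 2"] sol_at_most_two[OF refl ns] quartic_sols_is_sol[OF quartic_equation_axioms] by metis
  show "at_most 1 (quartic_sols B C 2)" if "B mod 4 = 1" unfolding at_most_def
    using card_le_1[of "quartic_sols B C 2"] sol_unique_two[OF refl that ns] quartic_sols_is_sol[OF quartic_equation_axioms] by metis
qed

lemma quartic_sols_pell:
  assumes "B > 0" "even B" "\<And>w :: int. B * w ^ 4 \<noteq> 28560"
  shows "at_most 1 (quartic_sols B 1 1)"
proof -
  interpret quartic_equation B 1 1 using assms by unfold_locales auto
  have lj: "f = 1 \<or> f = 13" if "r\<^sup>2 = 2 * f ^ 4 - 1" "f > 0" for f r :: int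
    using ljunggren[of r f] that by simp
  show ?thesis unfolding at_most_def
  proof (rule card_le_1)
    fix y1 y2 assume "y1 \<in> quartic_sols B 1 1" "y2 \<in> quartic_sols B 1 1"
    then obtain a1 a2 where "is_sol a1 y1" "is_sol a2 y2" using quartic_sols_is_sol[OF quartic_equation_axioms] by metis
    from sol_unique_pell[OF refl refl assms(2,3) _ this] lj show "y1 = y2" by blast
  qed
qed

text \<open>The exponent of 2 on the left is a multiple of 4. This disposes of the exceptional value
  \<open>28560 = 16 * 1785\<close> after the factor 2 or 8 of the coefficient has been
  removed.\<close>

lemma odd_mult_fourth_power_neq:
  fixes v w m :: int
  assumes "odd v" "even m" "\<not> 16 dvd m"
  shows "v * w ^ 4 \<noteq> m"
proof (cases "even w")
  case True
  then obtain z where "w = 2 * z" by blast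
  then have "v * w ^ 4 = 16 * (v * z ^ 4)" by (simp add: power_mult_distrib)
  then show ?thesis using assms(3) by (metis dvd_triv_left)
next
  case False
  then have "odd (v * w ^ 4)" using assms(1) by simp
  then show ?thesis using assms(2) by metis
qed

text \<open>Descent: with a suitable root \<open>u\<close> the cofactor \<open>t\<close> of
  \<open>n\<close> in \<open>u\<^sup>2 - 2\<close> is smaller than \<open>n\<close> and again 3 or 5
  modulo 8. The modulus is arbitrary because \<open>t\<close> may be composite.\<close>

lemma two_not_square_mod:
  fixes n v :: int
  assumes "n > 0" "n mod 8 = 3 \<or> n mod 8 = 5"
  shows "\<not> n dvd v\<^sup>2 - 2"
  using assms
proof (induction "nat n" arbitrary: n v rule: less_induct)
  case less
  show ?case
  proof
    assume dvd: "n dvd v\<^sup>2 - 2"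
    have odd: "odd n" using less.prems(2) by presburger
    have n3: "n \<ge> 3" using less.prems by (cases "n = 1 \<or> n = 2") auto
    define r where "r = v mod n"
    \<comment> \<open>As \<open>n\<close> is odd, \<open>r\<close> and \<open>n - r\<close> differ
      in parity; the odd one makes \<open>u\<^sup>2 - 2\<close> equal to 7 modulo 8.\<close>
    define u where "u = (if odd r then r else n - r)"
    have r: "0 \<le> r" "r < n" unfolding r_def using less.prems(1) by simp_all
    have u: "odd u" "0 < u" "u \<le> n" using r odd unfolding u_def by (auto simp: odd_pos intro!: order_neq_le_trans)
    have "[u\<^sup>2 = v\<^sup>2] (mod n)"
    proof -
      have "[r = v] (mod n)" unfolding r_def by (simp add: cong_def)
      then have "[r\<^sup>2 = v\<^sup>2] (mod n)" by (rule cong_pow)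
      moreover have "[(n - r)\<^sup>2 = r\<^sup>2] (mod n)"
      proof -
        have "(n - r)\<^sup>2 - r\<^sup>2 = n * (n - 2 * r)" by (simp add: power2_eq_square algebra_simps)
        then show ?thesis by (simp add: cong_iff_dvd_diff)
      qed
      ultimately show ?thesis unfolding u_def by (auto intro: cong_trans)
    qed
    then have "[u\<^sup>2 - 2 = v\<^sup>2 - 2] (mod n)" by (intro cong_diff) simp_all
    with dvd have "n dvd u\<^sup>2 - 2" by (simp add: cong_dvd_iff)
    then obtain t where t: "u\<^sup>2 - 2 = n * t" by (elim dvdE)
    have "u \<noteq> 1"
    proof
      assume "u = 1"
      with t have "n * t = - 1" by simp
      then have "n dvd - 1" by (metis dvd_triv_left)
      with n3 show False by simp
    qed
    with u have u2: "u \<ge> 2" by simp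
    have "u\<^sup>2 \<ge> 2\<^sup>2" using u2 by (intro power_mono) simp_all
    then have "n * t > 0" using t by simp
    then have t0: "t > 0" using less.prems(1) by (simp add: zero_less_mult_iff)
    have "u\<^sup>2 \<le> n\<^sup>2" using u by (intro power_mono) simp_all
    then have "n * t < n * n" using t by (simp add: power2_eq_square)
    then have tn: "t < n" using less.prems(1) by simp
    obtain j where j: "u = 2 * j + 1" using u(1) by (elim oddE)
    have "even (j * (j + 1))" by simp
    then obtain d where d: "j * (j + 1) = 2 * d" by blast
    have "u\<^sup>2 = 4 * (j * (j + 1)) + 1" unfolding j by (simp add: power2_eq_square algebra_simps)
    then have "n * t = 8 * d - 1" using t d by simp
    then have "(n mod 8) * (t mod 8) mod 8 = (8 * d - 1) mod 8" by (metis mod_mult_eq)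
    also have "(8 * d - 1) mod 8 = 7" by presburger
    finally have m: "(n mod 8) * (t mod 8) mod 8 = 7" .
    have "t mod 8 = 0 \<or> t mod 8 = 1 \<or> t mod 8 = 2 \<or> t mod 8 = 3 \<or> t mod 8 = 4 \<or> t mod 8 = 5 \<or> t mod 8 = 6 \<or> t mod 8 = 7"
      by presburger
    then have "t mod 8 = 3 \<or> t mod 8 = 5" using m less.prems(2) by auto
    moreover have "t dvd u\<^sup>2 - 2" using t by simp
    moreover have "nat t < nat n" using tn t0 by simp
    ultimately show False using less.hyps t0 by blast
  qed
qed

lemma square_mod8_odd: "odd (v :: int) \<Longrightarrow> \<exists>d. v\<^sup>2 = 8 * d + 1"
proof -
  assume "odd v"
  then obtain j where j: "v = 2 * j + 1" by (elim oddE)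
  have "even (j * (j + 1))" by simp
  then obtain d where d: "j * (j + 1) = 2 * d" by blast
  have "v\<^sup>2 = 4 * (j * (j + 1)) + 1" unfolding j by (simp add: power2_eq_square algebra_simps)
  then show ?thesis using d by auto
qed

lemma mult_square_mod8: "odd (v :: int) \<Longrightarrow> (a * v\<^sup>2) mod 8 = a mod 8"
proof -
  assume "odd v"
  then obtain d where "v\<^sup>2 = 8 * d + 1" using square_mod8_odd by blast
  then have "a * v\<^sup>2 = a + 8 * (a * d)" by (simp add: algebra_simps)
  then show ?thesis by simp
qed

lemma fourth_eq: "(u :: int) ^ 4 = (u\<^sup>2)\<^sup>2"
  by (simp add: power_mult[symmetric])

lemma quartic_sols_two_mod8:
  assumes "odd B" "odd C" "y \<in> quartic_sols B C 2"
  shows "(C - B) mod 8 = 2" "odd y"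
proof -
  obtain a where eq: "C * a\<^sup>2 - B * y ^ 4 = 2" using assms(3) unfolding quartic_sols_def by blast
  show y: "odd y" by (rule odd_solution_two[OF assms(1,2) eq])
  have "C * a\<^sup>2 = 2 + B * y ^ 4" using eq by simp
  then have "odd (C * a\<^sup>2)" using assms(1) y by simp
  then have a: "odd a" by simp
  have "(C - B) mod 8 = (C * a\<^sup>2 - B * y ^ 4) mod 8"
    using mult_square_mod8[OF a, of C] mult_square_mod8[of "y\<^sup>2" B] y unfolding fourth_eq by (metis even_power mod_diff_eq)
  then show "(C - B) mod 8 = 2" unfolding eq by simp
qed

lemma quartic_sols_one_mod8:
  assumes "odd A" "odd p" "y \<in> quartic_sols (2 * A) p 1"
  shows "p mod 8 = 1 \<or> p mod 8 = (1 + 2 * A) mod 8"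
proof -
  obtain a where eq: "p * a\<^sup>2 - 2 * A * y ^ 4 = 1" using assms(3) unfolding quartic_sols_def by blast
  have pa: "p * a\<^sup>2 = 1 + 2 * A * y ^ 4" using eq by simp
  then have "odd (p * a\<^sup>2)" by simp
  then have "odd a" by simp
  then have p: "p mod 8 = (1 + 2 * A * y ^ 4) mod 8" using mult_square_mod8[of a p] pa by simp
  show ?thesis
  proof (cases "even y")
    case True
    then obtain z where "y = 2 * z" by blast
    then have "1 + 2 * A * y ^ 4 = 1 + 8 * (4 * A * z ^ 4)" by (simp add: power_mult_distrib)
    moreover have "(1 + 8 * k) mod 8 = 1" for k :: int by presburger
    ultimately show ?thesis unfolding p by (simp only: simp_thms)
  next
    case False
    then have "(2 * A * y ^ 4) mod 8 = (2 * A) mod 8" using mult_square_mod8[of "y\<^sup>2" "2 * A"] unfolding fourth_eq by simp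
    then show ?thesis unfolding p by (metis mod_add_right_eq)
  qed
qed

text \<open>Multiplication by \<open>A\<close> or \<open>2 * A\<close> completes a square and
  exhibits \<open>- 2 * A\<close> as a square modulo \<open>p\<close>; and \<open>p dvd A\<close>
  would force \<open>p\<close> to divide 2 or 1.\<close>

lemma quartic_sols_residue:
  assumes p: "prime p" "odd p" and ne: "quartic_sols A p 2 \<noteq> {} \<or> quartic_sols (2 * A) p 1 \<noteq> {}"
  shows "\<not> p dvd A \<and> Legendre (- 2 * A) p \<noteq> - 1"
proof -
  have p2: "\<not> p dvd 2"
  proof
    assume "p dvd 2"
    then have "p \<le> 2" by (rule zdvd_imp_le) simp
    with prime_ge_2_int[OF p(1)] p(2) show False by simp
  qed
  have "\<not> p dvd A \<and> (\<exists>z. [z\<^sup>2 = - 2 * A] (mod p))" using ne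
  proof
    assume "quartic_sols A p 2 \<noteq> {}"
    then obtain u a where "p * a\<^sup>2 - A * u ^ 4 = 2" unfolding quartic_sols_def by blast
    then have e: "p * a\<^sup>2 = A * u ^ 4 + 2" by simp
    have "\<not> p dvd A"
    proof
      assume "p dvd A"
      then have "p dvd p * a\<^sup>2 - A * u ^ 4" by (intro dvd_diff) simp_all
      with e p2 show False by simp
    qed
    moreover have "(A * u\<^sup>2)\<^sup>2 - (- 2 * A) = A * (A * u ^ 4 + 2)" by (simp add: fourth_eq power2_eq_square algebra_simps)
    then have "p dvd (A * u\<^sup>2)\<^sup>2 - (- 2 * A)" unfolding e[symmetric] by simp
    then have "[(A * u\<^sup>2)\<^sup>2 = - 2 * A] (mod p)" by (simp only: cong_iff_dvd_diff)
    ultimately show ?thesis by blast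
  next
    assume "quartic_sols (2 * A) p 1 \<noteq> {}"
    then obtain u a where "p * a\<^sup>2 - 2 * A * u ^ 4 = 1" unfolding quartic_sols_def by blast
    then have e: "p * a\<^sup>2 = 2 * A * u ^ 4 + 1" by simp
    have "\<not> p dvd A"
    proof
      assume "p dvd A"
      then have "p dvd p * a\<^sup>2 - 2 * A * u ^ 4" by (intro dvd_diff) simp_all
      with e have "p dvd 1" by simp
      then show False using p by (simp add: prime_int_iff)
    qed
    moreover have "(2 * A * u\<^sup>2)\<^sup>2 - (- 2 * A) = 2 * A * (2 * A * u ^ 4 + 1)" by (simp add: fourth_eq power2_eq_square algebra_simps)
    then have "p dvd (2 * A * u\<^sup>2)\<^sup>2 - (- 2 * A)" unfolding e[symmetric] by simp
    then have "[(2 * A * u\<^sup>2)\<^sup>2 = - 2 * A] (mod p)" by (simp only: cong_iff_dvd_diff)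
    ultimately show ?thesis by blast
  qed
  then show ?thesis unfolding Legendre_def QuadRes_def by auto
qed

section \<open>Factorisation into families\<close>

lemma coprime_mult_square_pos:
  fixes a b x :: int
  assumes "x\<^sup>2 = a * b" "coprime a b" "a > 0" "b > 0"
  obtains r s where "r > 0" "s > 0" "a = r\<^sup>2" "b = s\<^sup>2"
  using coprime_mult_square_int[of a b x] assms by metis

text \<open>The four sets correspond to the parity of \<open>x\<close> and to which of two coprime
  factors \<open>p\<close> divides. For even \<open>x\<close> a factor 4 is split off first to make
  the factors coprime, which halves \<open>x\<close>.\<close>

lemma pos_solutions_odd_prime:
  assumes p: "prime p" "odd p" and A: "odd A" "A > 1"
  shows "fst ` pos_solutions p A \<subseteq> (\<lambda>u. p * u\<^sup>2) ` quartic_sols (A * p\<^sup>2) 1 2 \<union> (\<lambda>u. u\<^sup>2) ` quartic_sols A p 2 \<union>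
     (\<lambda>u. 2 * p * u\<^sup>2) ` quartic_sols (2 * A * p\<^sup>2) 1 1 \<union> (\<lambda>u. 2 * u\<^sup>2) ` quartic_sols (2 * A) p 1"
    (is "_ \<subseteq> ?S1 \<union> ?S2 \<union> ?S3 \<union> ?S4")
proof
  fix x assume "x \<in> fst ` pos_solutions p A"
  then obtain y where x: "x \<ge> 1" and y: "y \<ge> 1" and eq: "y\<^sup>2 = p * x * (A * x\<^sup>2 + 2)"
    unfolding pos_solutions_def by auto
  have p0: "p > 0" using p(1) by (simp add: prime_gt_0_int)
  have "p dvd y\<^sup>2" unfolding eq by simp
  then have "p dvd y" using p(1) by (metis prime_dvd_power)
  then obtain z where "y = p * z" by (elim dvdE)
  with eq have "p * (p * z\<^sup>2) = p * (x * (A * x\<^sup>2 + 2))" by (simp add: power2_eq_square mult_ac)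
  with p0 have z: "p * z\<^sup>2 = x * (A * x\<^sup>2 + 2)" by simp
  show "x \<in> ?S1 \<union> ?S2 \<union> ?S3 \<union> ?S4"
  proof (cases "odd x")
    case True
    have cop: "coprime x (A * x\<^sup>2 + 2)"
    proof -
      have "coprime x 2" using True by simp
      moreover have "gcd x (A * x\<^sup>2 + 2) = gcd x 2"
        using gcd_add_mult[of x "A * x" 2] by (simp add: power2_eq_square mult_ac)
      ultimately show ?thesis by (simp add: coprime_iff_gcd_eq_1)
    qed
    have "p dvd x * (A * x\<^sup>2 + 2)" unfolding z[symmetric] by simp
    then consider "p dvd x" | "p dvd A * x\<^sup>2 + 2" using p(1) prime_dvd_mult_iff by blast
    then show ?thesis
    proof cases
      case 1
      then obtain w where w: "x = p * w" by (elim dvdE)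
      then have e: "z\<^sup>2 = w * (A * x\<^sup>2 + 2)" using z p0 by (simp add: mult.assoc)
      have "w > 0" using w x p0 by (simp add: zero_less_mult_iff) (smt (verit) mult_nonneg_nonpos)
      moreover have "A * x\<^sup>2 + 2 > 0" using A by (simp add: add_nonneg_pos)
      moreover have "coprime w (A * x\<^sup>2 + 2)" using cop unfolding w by simp
      ultimately obtain u v where u: "u > 0" "w = u\<^sup>2" "A * x\<^sup>2 + 2 = v\<^sup>2" using coprime_mult_square_pos[OF e] by metis
      then have "1 * v\<^sup>2 - A * p\<^sup>2 * u ^ 4 = 2" unfolding w fourth_eq by (simp add: power_mult_distrib)
      then have "u \<in> quartic_sols (A * p\<^sup>2) 1 2" unfolding quartic_sols_def using u(1) by blast
      then show ?thesis using w u by auto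
    next
      case 2
      then obtain t where t: "A * x\<^sup>2 + 2 = p * t" by (elim dvdE)
      then have e: "z\<^sup>2 = x * t" using z p0 by simp
      have "A * x\<^sup>2 + 2 > 0" using A by (simp add: add_nonneg_pos)
      then have "t > 0" using p0 unfolding t by (simp add: zero_less_mult_iff)
      moreover have "coprime x t" using cop unfolding t by simp
      ultimately obtain u v where u: "u > 0" "x = u\<^sup>2" "t = v\<^sup>2" using coprime_mult_square_pos[OF e] x by (metis zero_less_one order_less_le_trans)
      then have "p * v\<^sup>2 - A * u ^ 4 = 2" using t unfolding fourth_eq by simp
      then have "u \<in> quartic_sols A p 2" unfolding quartic_sols_def using u(1) by blast
      then show ?thesis using u by auto
    qed
  next
    case False
    then obtain w where w: "x = 2 * w" by auto
    have w0: "w > 0" using w x by simp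
    have z': "p * z\<^sup>2 = 4 * (w * (2 * A * w\<^sup>2 + 1))" using z unfolding w by (simp add: power2_eq_square algebra_simps)
    then have "even (p * z\<^sup>2)" by simp
    then have "even z" using p(2) by simp
    then obtain q where q: "z = 2 * q" by blast
    then have q2: "p * q\<^sup>2 = w * (2 * A * w\<^sup>2 + 1)" using z' by (simp add: power_mult_distrib)
    have cop: "coprime w (2 * A * w\<^sup>2 + 1)"
      using gcd_add_mult[of w "2 * A * w" 1] by (simp add: coprime_iff_gcd_eq_1 power2_eq_square mult_ac)
    have pos: "2 * A * w\<^sup>2 + 1 > 0" using A by (simp add: add_nonneg_pos)
    have "p dvd w * (2 * A * w\<^sup>2 + 1)" unfolding q2[symmetric] by simp
    then consider "p dvd w" | "p dvd 2 * A * w\<^sup>2 + 1" using p(1) prime_dvd_mult_iff by blast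
    then show ?thesis
    proof cases
      case 1
      then obtain r where r: "w = p * r" by (elim dvdE)
      then have e: "q\<^sup>2 = r * (2 * A * w\<^sup>2 + 1)" using q2 p0 by (simp add: mult.assoc)
      have "r > 0" using w0 p0 unfolding r by (simp add: zero_less_mult_iff)
      moreover have "coprime r (2 * A * w\<^sup>2 + 1)" using cop unfolding r by simp
      ultimately obtain u v where u: "u > 0" "r = u\<^sup>2" "2 * A * w\<^sup>2 + 1 = v\<^sup>2" using coprime_mult_square_pos[OF e] pos by metis
      then have "1 * v\<^sup>2 - 2 * A * p\<^sup>2 * u ^ 4 = 1" unfolding r fourth_eq by (simp add: power_mult_distrib)
      then have "u \<in> quartic_sols (2 * A * p\<^sup>2) 1 1" unfolding quartic_sols_def using u(1) by blast
      then show ?thesis using w r u by auto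
    next
      case 2
      then obtain t where t: "2 * A * w\<^sup>2 + 1 = p * t" by (elim dvdE)
      then have e: "q\<^sup>2 = w * t" using q2 p0 by simp
      have "t > 0" using p0 pos unfolding t by (simp add: zero_less_mult_iff)
      moreover have "coprime w t" using cop unfolding t by simp
      ultimately obtain u v where u: "u > 0" "w = u\<^sup>2" "t = v\<^sup>2" using coprime_mult_square_pos[OF e] w0 by metis
      then have "p * v\<^sup>2 - 2 * A * u ^ 4 = 1" using t unfolding fourth_eq by simp
      then have "u \<in> quartic_sols (2 * A) p 1" unfolding quartic_sols_def using u(1) by blast
      then show ?thesis using w u by auto
    qed
  qed
qed

text \<open>For \<open>p = 2\<close> evenness passes from \<open>y\<close> to \<open>x\<close> and
  on to \<open>x / 2\<close>, so that a single family remains.\<close>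

lemma pos_solutions_two:
  assumes A: "odd A" "A > 1"
  shows "fst ` pos_solutions 2 A \<subseteq> (\<lambda>u. 4 * u\<^sup>2) ` quartic_sols (8 * A) 1 1"
proof
  fix x assume "x \<in> fst ` pos_solutions 2 A"
  then obtain y where x: "x \<ge> 1" and eq: "y\<^sup>2 = 2 * x * (A * x\<^sup>2 + 2)"
    unfolding pos_solutions_def by auto
  have half: "\<exists>z. y = 2 * z \<and> 2 * z\<^sup>2 = b" if "y\<^sup>2 = 2 * b" for y b :: int
  proof -
    have "even (y\<^sup>2)" unfolding that by simp
    then obtain z where "y = 2 * z" by auto
    with that show ?thesis by (simp add: power_mult_distrib)
  qed
  from half[of y "x * (A * x\<^sup>2 + 2)"] eq obtain z where z: "2 * z\<^sup>2 = x * (A * x\<^sup>2 + 2)" by auto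
  have "even (x * (A * x\<^sup>2 + 2))" unfolding z[symmetric] by simp
  then have "even x" using A(1) by auto
  then obtain w where w: "x = 2 * w" by blast
  have "z\<^sup>2 = 2 * (w * (2 * A * w\<^sup>2 + 1))" using z unfolding w by (simp add: power2_eq_square algebra_simps)
  from half[OF this] obtain q where q: "2 * q\<^sup>2 = w * (2 * A * w\<^sup>2 + 1)" by auto
  have "even (w * (2 * A * w\<^sup>2 + 1))" unfolding q[symmetric] by simp
  then have "even w" by simp
  then obtain t where t: "w = 2 * t" by blast
  have e: "q\<^sup>2 = t * (8 * A * t\<^sup>2 + 1)" using q unfolding t by (simp add: power2_eq_square algebra_simps)
  have "t > 0" using x w t by simp
  moreover have "8 * A * t\<^sup>2 + 1 > 0" using A by (simp add: add_nonneg_pos)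
  moreover have "coprime t (8 * A * t\<^sup>2 + 1)"
    using gcd_add_mult[of t "8 * A * t" 1] by (simp add: coprime_iff_gcd_eq_1 power2_eq_square mult_ac)
  ultimately obtain u v where u: "u > 0" "t = u\<^sup>2" "8 * A * t\<^sup>2 + 1 = v\<^sup>2" using coprime_mult_square_pos[OF e] by metis
  then have "1 * v\<^sup>2 - 8 * A * u ^ 4 = 1" unfolding fourth_eq by simp
  then have "u \<in> quartic_sols (8 * A) 1 1" unfolding quartic_sols_def using u(1) by blast
  then show "x \<in> (\<lambda>u. 4 * u\<^sup>2) ` quartic_sols (8 * A) 1 1" using w t u by auto
qed

lemma at_most_pos_solutions:
  assumes "at_most n (fst ` pos_solutions p A)"
  shows "at_most n (pos_solutions p A)"
proof -
  have "inj_on fst (pos_solutions p A)"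
  proof (rule inj_onI)
    fix s t assume st: "s \<in> pos_solutions p A" "t \<in> pos_solutions p A" "fst s = fst t"
    then have "(snd s)\<^sup>2 = (snd t)\<^sup>2" "snd s \<ge> 0" "snd t \<ge> 0" unfolding pos_solutions_def by auto
    then have "snd s = snd t" by (simp add: power2_eq_iff_nonneg)
    with st(3) show "s = t" by (simp add: prod_eq_iff)
  qed
  then show ?thesis using assms unfolding at_most_def by (simp add: card_image finite_image_iff)
qed


lemma at_most_pos_solutions_odd_prime:
  assumes p: "prime p" "odd p" and A: "odd A" "A > 1"
    and T: "at_most n1 (quartic_sols (A * p\<^sup>2) 1 2)" "at_most n2 (quartic_sols A p 2)" "at_most n4 (quartic_sols (2 * A) p 1)"
  shows "at_most (n1 + n2 + 1 + n4) (pos_solutions p A)"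
proof -
  have p0: "p > 0" using p(1) by (simp add: prime_gt_0_int)
  have "at_most 1 (quartic_sols (2 * A * p\<^sup>2) 1 1)"
  proof (rule quartic_sols_pell)
    \<comment> \<open>\<open>28560 = 2 * 14280\<close>, and \<open>14280 = 8 * 1785\<close>.\<close>
    show "2 * A * p\<^sup>2 * w ^ 4 \<noteq> 28560" for w
      using odd_mult_fourth_power_neq[of "A * p\<^sup>2" 14280 w] p A by (simp add: mult.assoc)
  qed (use p0 A in auto)
  with T show ?thesis
    by (intro at_most_pos_solutions at_most_subset[OF _ pos_solutions_odd_prime[OF p A]] at_most_Un at_most_image)
qed

text \<open>The arguments are the residues of \<open>A\<close> and \<open>p\<close> modulo 8. The
  summands belong, in this order, to \<open>quartic_sols (A * p\<^sup>2) 1 2\<close>,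
  \<open>quartic_sols A p 2\<close>, \<open>quartic_sols (2 * A * p\<^sup>2) 1 1\<close> and
  \<open>quartic_sols (2 * A) p 1\<close>.\<close>

definition solution_bound :: "int \<Rightarrow> int \<Rightarrow> nat" where
  "solution_bound a r = (if a = 7 \<and> (r = 1 \<or> r = 7) then 2 else 0) + (if (r - a) mod 8 = 2 then if a mod 4 = 1 then 1 else 2 else 0) + 1 +
     (if r = 1 \<or> r = (1 + 2 * a) mod 8 then 1 else 0)"

text \<open>Modulo \<open>p\<close> the equation makes 2 a square, so \<open>p\<close> is 1 or 7
  modulo 8; modulo 8 it forces \<open>A\<close> to be 7. Then \<open>A * p\<^sup>2\<close> is 3
  modulo 4, where \<open>quartic_sols_two\<close> gives the bound 2.\<close>

lemma quartic_sols_first: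
  assumes p: "prime p" "odd p" and A: "odd A" "A > 1"
  shows "at_most (if A mod 8 = 7 \<and> (p mod 8 = 1 \<or> p mod 8 = 7) then 2 else 0) (quartic_sols (A * p\<^sup>2) 1 2)"
proof (cases "quartic_sols (A * p\<^sup>2) 1 2 = {}")
  case False
  then obtain u a where u: "u \<in> quartic_sols (A * p\<^sup>2) 1 2" and "1 * a\<^sup>2 - A * p\<^sup>2 * u ^ 4 = 2" unfolding quartic_sols_def by blast
  then have "a\<^sup>2 - 2 = A * p\<^sup>2 * u ^ 4" by simp
  then have "a\<^sup>2 - 2 = p * (A * p * u ^ 4)" by (simp only: power2_eq_square mult_ac)
  then have "p dvd a\<^sup>2 - 2" by simp
  moreover have p0: "p > 0" using p(1) by (simp add: prime_gt_0_int)
  ultimately have "\<not> (p mod 8 = 3 \<or> p mod 8 = 5)" using two_not_square_mod by blast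
  then have "p mod 8 = 1 \<or> p mod 8 = 7" using p(2) by presburger
  moreover have "(1 - A * p\<^sup>2) mod 8 = 2" using quartic_sols_two_mod8(1)[OF _ _ u] p A by simp
  then have "(1 - A) mod 8 = 2" using mult_square_mod8[OF p(2), of A] by (metis mod_diff_right_eq)
  then have "A mod 8 = 7" by presburger
  ultimately show ?thesis using quartic_sols_two(1)[of "A * p\<^sup>2" 1] p p0 A by simp
qed (rule at_most_empty)

lemma pos_solutions_bound:
  assumes p: "prime p" "odd p" and A: "odd A" "A > 1"
  shows "at_most (solution_bound (A mod 8) (p mod 8)) (pos_solutions p A)"
  unfolding solution_bound_def
proof (rule at_most_pos_solutions_odd_prime[OF p A quartic_sols_first[OF p A]])
  have p0: "p > 0" using p(1) by (simp add: prime_gt_0_int)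
  have "A mod 8 mod 4 = A mod 4" by (rule mod_mod_cancel) simp
  then show "at_most (if (p mod 8 - A mod 8) mod 8 = 2 then if A mod 8 mod 4 = 1 then 1 else 2 else 0) (quartic_sols A p 2)"
  proof (cases "(p - A) mod 8 = 2")
    case True
    then show ?thesis using \<open>A mod 8 mod 4 = A mod 4\<close> quartic_sols_two[of A p] p p0 A by (simp add: mod_diff_eq)
  next
    case False
    then have "quartic_sols A p 2 = {}" using quartic_sols_two_mod8(1)[OF A(1) p(2)] by blast
    then show ?thesis by (rule at_most_empty)
  qed
  have nsq: "k\<^sup>2 \<noteq> p" for k
  proof
    assume k: "k\<^sup>2 = p"
    then have "p dvd k\<^sup>2" by simp
    then have "p dvd k" using p(1) by (metis prime_dvd_power)
    then obtain j where "k = p * j" by (elim dvdE)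
    with k have "p * (p * j\<^sup>2) = p * 1" by (simp add: power2_eq_square mult_ac)
    with p0 have "p * j\<^sup>2 = 1" by (simp only: mult_cancel_left) simp
    then have "p dvd 1" by (metis dvd_triv_left)
    with p(1) show False by (simp add: prime_int_iff)
  qed
  show "at_most (if p mod 8 = 1 \<or> p mod 8 = (1 + 2 * (A mod 8)) mod 8 then 1 else 0) (quartic_sols (2 * A) p 1)"
  proof (cases "p mod 8 = 1 \<or> p mod 8 = (1 + 2 * (A mod 8)) mod 8")
    case True
    have "at_most 1 (quartic_sols (2 * A) p 1)" by (rule quartic_sols_one[OF _ p0 nsq]) (use A in simp)
    with True show ?thesis by (simp only: if_True)
  next
    case False
    moreover have "(1 + 2 * (A mod 8)) mod 8 = (1 + 2 * A) mod 8" by (metis mod_add_right_eq mod_mult_right_eq)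
    ultimately have "quartic_sols (2 * A) p 1 = {}" using quartic_sols_one_mod8[OF A(1) p(2)] by (metis equals0I)
    then show ?thesis by (rule at_most_empty)
  qed
qed

lemma pos_solutions_nonresidue:
  assumes p: "prime p" "odd p" and A: "odd A" "A > 1" and r: "p dvd A \<or> Legendre (- 2 * A) p = - 1"
  shows "at_most (if A mod 8 = 7 \<and> (p mod 8 = 1 \<or> p mod 8 = 7) then 3 else 1) (pos_solutions p A)"
proof -
  have "quartic_sols A p 2 = {}" "quartic_sols (2 * A) p 1 = {}" using quartic_sols_residue[OF p, of A] r by blast+
  then show ?thesis
    using at_most_pos_solutions_odd_prime[OF p A quartic_sols_first[OF p A] at_most_empty at_most_empty, of 0 0] by (auto split: if_splits)
qed

theorem theorem1p3:
  fixes p A :: int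
  assumes "prime p" and "odd A" and "A > 1"
  shows
    "(p = 2 \<longrightarrow> at_most 1 (pos_solutions p A)) \<and>
     (odd p \<and> (p dvd A \<or> Legendre (- 2 * A) p = - 1) \<longrightarrow>
        (if \<exists>rs \<in> {(7,1), (7,7)}. cong8 A p rs
         then at_most 3 (pos_solutions p A)
         else at_most 1 (pos_solutions p A))) \<and>
     (odd p \<and> Legendre (- 2 * A) p = 1 \<longrightarrow>
        ((\<exists>rs \<in> {(1,5), (1,7), (3,3), (5,5), (7,3), (7,5)}. cong8 A p rs) \<longrightarrow>
           at_most 1 (pos_solutions p A)) \<and>
        ((\<exists>rs \<in> {(1,1), (3,1), (3,7), (5,1), (5,3), (5,7)}. cong8 A p rs) \<longrightarrow>
           at_most 2 (pos_solutions p A)) \<and>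
        ((\<exists>rs \<in> {(1,3), (3,5)}. cong8 A p rs) \<longrightarrow>
           at_most 3 (pos_solutions p A)) \<and>
        (cong8 A p (7,7) \<longrightarrow> at_most 4 (pos_solutions p A)) \<and>
        (cong8 A p (7,1) \<longrightarrow> at_most 6 (pos_solutions p A)))"
proof (intro conjI impI)
  assume "p = 2"
  have "at_most 1 (quartic_sols (8 * A) 1 1)"
  proof (rule quartic_sols_pell)
    \<comment> \<open>\<open>28560 = 8 * 3570\<close>, and 3570 is twice an odd number.\<close>
    show "8 * A * w ^ 4 \<noteq> 28560" for w
      using odd_mult_fourth_power_neq[of A 3570 w] assms(2) by (simp add: mult.assoc)
  qed (use assms in auto)
  with \<open>p = 2\<close> show "at_most 1 (pos_solutions p A)"
    using at_most_pos_solutions[OF at_most_subset[OF at_most_image pos_solutions_two[OF assms(2,3)]]] by blast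
next
  assume "odd p \<and> (p dvd A \<or> Legendre (- 2 * A) p = - 1)"
  then have "at_most (if A mod 8 = 7 \<and> (p mod 8 = 1 \<or> p mod 8 = 7) then 3 else 1) (pos_solutions p A)"
    using pos_solutions_nonresidue[of p A] assms by blast
  moreover have "(\<exists>rs \<in> {(7,1), (7,7)}. cong8 A p rs) \<longleftrightarrow> A mod 8 = 7 \<and> (p mod 8 = 1 \<or> p mod 8 = 7)"
    by (auto simp: cong8_def cong_def)
  ultimately show "if \<exists>rs \<in> {(7,1), (7,7)}. cong8 A p rs then at_most 3 (pos_solutions p A) else at_most 1 (pos_solutions p A)"
    by (cases "A mod 8 = 7 \<and> (p mod 8 = 1 \<or> p mod 8 = 7)") (simp_all only: if_True if_False simp_thms)
next
  assume "odd p \<and> Legendre (- 2 * A) p = 1"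
  then have b: "at_most (solution_bound (A mod 8) (p mod 8)) (pos_solutions p A)"
    using pos_solutions_bound[of p A] assms by blast
  \<comment> \<open>The bound depends on the residues only, so every pair of residues is settled by
    evaluation.\<close>
  have c: "at_most n (pos_solutions p A)" if "cong8 A p (a, r)" "solution_bound (a mod 8) (r mod 8) \<le> n" for n a r
    using at_most_mono[OF b, of n] that by (simp add: cong8_def cong_def)
  show "at_most 1 (pos_solutions p A)" if "\<exists>rs \<in> {(1,5), (1,7), (3,3), (5,5), (7,3), (7,5)}. cong8 A p rs"
    using that by (elim bexE insertE emptyE) (rule c, simp, simp add: solution_bound_def)+
  show "at_most 2 (pos_solutions p A)" if "\<exists>rs \<in> {(1,1), (3,1), (3,7), (5,1), (5,3), (5,7)}. cong8 A p rs"
    using that by (elim bexE insertE emptyE) (rule c, simp, simp add: solution_bound_def)+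
  show "at_most 3 (pos_solutions p A)" if "\<exists>rs \<in> {(1,3), (3,5)}. cong8 A p rs"
    using that by (elim bexE insertE emptyE) (rule c, simp, simp add: solution_bound_def)+
  show "at_most 4 (pos_solutions p A)" if "cong8 A p (7,7)" by (rule c[OF that]) (simp add: solution_bound_def)
  show "at_most 6 (pos_solutions p A)" if "cong8 A p (7,1)" by (rule c[OF that]) (simp add: solution_bound_def)
qed

end
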